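(* Let $n\geq 4$ be an integer, $\Lambda_n=GL_n(\mathbb{Z})$ and $p$ a prime number. (1) The finite set $R^{(n)}(p)=R_0^{(n)}(p)\sqcup R_1^{(n)}(p)$ (defined in the context) has cardinality $$\deg\left(\mathrm{diag}(1,\underbrace{p,\dots,p}_{n-2},p^2)\right)=p\,\frac{(p^{n-1}-1)(p^n-1)}{(p-1)^2}$$ and is a complete system of representatives of the distinct $\Lambda_n$ right cosets of $\Lambda_n\,\mathrm{diag}(1,\underbrace{p,\dots,p}_{n-2},p^2)\,\Lambda_n$ modulo $\Lambda_n$. (2) The following formulas for the degrees hold: $$\deg\left(\mathrm{diag}(p,\underbrace{p^2,\dots,p^2}_{n-2},p^3)\right)=p\,\frac{(p^{n-1}-1)(p^n-1)}{(p-1)^2},$$ $$\deg\left(\mathrm{diag}(1,\underbrace{p^2,\dots,p^2}_{n-3},p^3,p^3)\right)=p^{n+1}\,\frac{(p^{n-2}-1)(p^{n-1}-1)(p^n-1)}{(p-1)^2(p^2-1)},$$ $$\deg\left(\mathrm{diag}(1,\underbrace{p^2,\dots,p^2}_{n-2},p^4)\right)=p^{2n-1}\,\frac{(p^{n-1}-1)(p^n-1)}{(p-1)^2},$$ $$\deg\left(\mathrm{diag}(p,p,\underbrace{p^2,\dots,p^2}_{n-3},p^4)\right)=p^{n+1}\,\frac{(p^{n-2}-1)(p^{n-1}-1)(p^n-1)}{(p-1)^2(p^2-1)},$$ $$\deg\left(\mathrm{diag}(p,p,\underbrace{p^2,\dots,p^2}_{n-4},p^3,p^3)\right)=p^4\,\frac{(p^{n-3}-1)(p^{n-2}-1)(p^{n-1}-1)(p^n-1)}{(p-1)^2(p^2-1)^2}.$$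 (3) In the absolute Hecke algebra, $$\begin{aligned} &\Lambda_n\mathrm{diag}(1,\underbrace{p,\dots,p}_{n-2},p^2)\Lambda_n\ast\Lambda_n\mathrm{diag}(1,\underbrace{p,\dots,p}_{n-2},p^2)\Lambda_n\\ &=\frac{2p^n-p^2-2p+1}{p-1}\,\Lambda_n\mathrm{diag}(p,\underbrace{p^2,\dots,p^2}_{n-2},p^3)\Lambda_n +p\,\frac{(p^{n-1}-1)(p^n-1)}{(p-1)^2}\,\Lambda_n\mathrm{diag}(\underbrace{p^2,\dots,p^2}_{n})\Lambda_n\\ &\quad+\Lambda_n\mathrm{diag}(1,\underbrace{p^2,\dots,p^2}_{n-2},p^4)\Lambda_n +(p+1)\,\Lambda_n\mathrm{diag}(1,\underbrace{p^2,\dots,p^2}_{n-3},p^3,p^3)\Lambda_n\\ &\quad+(p+1)\,\Lambda_n\mathrm{diag}(p,p,\underbrace{p^2,\dots,p^2}_{n-3},p^4)\Lambda_n +(p+1)^2\,\Lambda_n\mathrm{diag}(p,p,\underbrace{p^2,\dots,p^2}_{n-4},p^3,p^3)\Lambda_n. \end{aligned}$$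
   Context: Notation: $\mathrm{diag}(a_1,\dots,a_n)$ is the diagonal $n\times n$ matrix with diagonal entries $a_1,\dots,a_n$. A $\Lambda_n$ right coset is a set $\Lambda_n g$ with $g\in GL_n(\mathbb{Q})$. For $g\in GL_n(\mathbb{Q})$ the double coset $\Lambda_n g\Lambda_n$ is a finite union of right cosets, and the degree of $g$ is $\deg(g)=\mathrm{card}(\Lambda_n\backslash\Lambda_n g\Lambda_n)$. Absolute Hecke algebra: the free $\mathbb{Z}$-module on the double cosets $\Lambda_n g\Lambda_n$, $g\in GL_n(\mathbb{Q})$, with the following product. If $\Lambda_n g_1\Lambda_n=\bigsqcup_{i=1}^{\deg(g_1)}\Lambda_n\alpha_i$ and $\Lambda_n g_2\Lambda_n=\bigsqcup_{j=1}^{\deg(g_2)}\Lambda_n\beta_j$, then $$\Lambda_n g_1\Lambda_n\ast\Lambda_n g_2\Lambda_n=\sum_{\Lambda_n h\Lambda_n\subset\Lambda_n g_1\Lambda_n g_2\Lambda_n}m(g_1,g_2;h)\,\Lambda_n h\Lambda_n,\qquad m(g_1,g_2;h)=\mathrm{card}\{(i,j):\alpha_i\beta_j\in\Lambda_n h\},$$ where $h$ ranges over a system of representatives of the $\Lambda_n$ double cosets contained in $\Lambda_n g_1\Lambda_n g_2\Lambda_n$. Determinantal divisors: for an $n\times n$ integer matrix $g$ and $1\leq k\leq n$, $d_k(g)\geq 0$ is the greatest common divisor of all $k\times k$ minors of $g$ (and $0$ if they all vanish). The set $R_0^{(n)}(p)$: the set of upper-triangular $n\times n$ integer matrices $C=[c_{i,j}]$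 such that - $d_k(C)=p^{k-1}$ for $1\leq k\leq n-1$ and $d_n(C)=p^n$; - $c_{i,i}=p$ for all $1\leq i\leq n$; - $0\leq c_{i,j}<p$ for all $1\leq i<j\leq n$. The set $R_1^{(n)}(p)$: the set of upper-triangular $n\times n$ integer matrices $C=[c_{i,j}]$ such that - $c_{i,i}\in\{1,p,p^2\}$ for all $1\leq i\leq n$; - there is exactly one $i$ with $c_{i,i}=1$ and exactly one $i$ with $c_{i,i}=p^2$; - $0\leq c_{i,j}<c_{j,j}$ for all $1\leq i<j\leq n$; - for every $i\in\{1,\dots,n-1\}$, if $p\mid c_{i,i}$ then $p\mid c_{i,j}$ for all $j\in\{i+1,\dots,n\}$. *)

theory Defs
  imports
    "HOL-Library.Poly_Mapping"
    "HOL-Computational_Algebra.Primes"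
    "HOL-Algebra.Coset"
    "Jordan_Normal_Form.Determinant"
    "Jordan_Normal_Form.DL_Submatrix"
begin

text \<open>Matrices are those of Jordan_Normal_Form, so all row and column indices start at 0.\<close>

definition GL :: "'a::comm_ring_1 itself \<Rightarrow> nat \<Rightarrow> 'a mat monoid" where
  "GL ty n = units_of (ring_mat ty n ())"

abbreviation GLQ :: "nat \<Rightarrow> rat mat monoid" where
  "GLQ n \<equiv> GL TYPE(rat) n"

abbreviation rat_mat :: "int mat \<Rightarrow> rat mat" where
  "rat_mat \<equiv> map_mat rat_of_int"

definition Lam :: "nat \<Rightarrow> rat mat set" where
  "Lam n = rat_mat ` carrier (GL TYPE(int) n)"

definition diag :: "nat list \<Rightarrow> rat mat" where
  "diag as = mat_diag (length as) (\<lambda>i. of_nat (as ! i))"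


section \<open>Cosets and degree\<close>

definition right_coset :: "nat \<Rightarrow> rat mat \<Rightarrow> rat mat set" where
  "right_coset n g = Lam n #>\<^bsub>GLQ n\<^esub> g"

definition double_coset :: "nat \<Rightarrow> rat mat \<Rightarrow> rat mat set" where
  "double_coset n g = (Lam n #>\<^bsub>GLQ n\<^esub> g) <#>\<^bsub>GLQ n\<^esub> Lam n"

definition double_cosets :: "nat \<Rightarrow> rat mat set set" where
  "double_cosets n = double_coset n ` carrier (GLQ n)"

definition right_cosets_in :: "nat \<Rightarrow> rat mat set \<Rightarrow> rat mat set set" where
  "right_cosets_in n D = right_coset n ` D"

definition deg :: "nat \<Rightarrow> rat mat \<Rightarrow> nat" where
  "deg n g = card (right_cosets_in n (double_coset n g))"

definition complete_reps :: "nat \<Rightarrow> rat mat set \<Rightarrow> rat mat set \<Rightarrow> bool" where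
  "complete_reps n D A \<longleftrightarrow> A \<subseteq> D \<and> bij_betw (right_coset n) A (right_cosets_in n D)"


section \<open>The absolute Hecke algebra\<close>

text \<open>
  The structure constants are defined from chosen representatives: of the right cosets in the
  double cosets \<open>D1\<close> and \<open>D2\<close>, and of the double coset \<open>D\<close>.  They do not depend on these choices.
\<close>

definition coset_reps :: "nat \<Rightarrow> rat mat set \<Rightarrow> rat mat set" where
  "coset_reps n D = (SOME A. complete_reps n D A)"

definition hecke_coeff :: "nat \<Rightarrow> rat mat set \<Rightarrow> rat mat set \<Rightarrow> rat mat set \<Rightarrow> nat" where
  "hecke_coeff n D1 D2 D =
     card {(a, b). a \<in> coset_reps n D1 \<and> b \<in> coset_reps n D2 \<and>
                   a \<otimes>\<^bsub>GLQ n\<^esub> b \<in> right_coset n (SOME h. h \<in> D)}"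

definition hecke_mult_basis ::
    "nat \<Rightarrow> rat mat set \<Rightarrow> rat mat set \<Rightarrow> (rat mat set \<Rightarrow>\<^sub>0 int)" where
  "hecke_mult_basis n D1 D2 =
     (\<Sum>D \<in> {D \<in> double_cosets n. D \<subseteq> D1 <#>\<^bsub>GLQ n\<^esub> D2}.
        Poly_Mapping.single D (int (hecke_coeff n D1 D2 D)))"

definition hecke_mult ::
    "nat \<Rightarrow> (rat mat set \<Rightarrow>\<^sub>0 int) \<Rightarrow> (rat mat set \<Rightarrow>\<^sub>0 int) \<Rightarrow> (rat mat set \<Rightarrow>\<^sub>0 int)" where
  "hecke_mult n x y =
     (\<Sum>D1 \<in> Poly_Mapping.keys x. \<Sum>D2 \<in> Poly_Mapping.keys y.
        Poly_Mapping.map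
          (\<lambda>c. Poly_Mapping.lookup x D1 * Poly_Mapping.lookup y D2 * c)
          (hecke_mult_basis n D1 D2))"

definition hecke_algebra :: "nat \<Rightarrow> (rat mat set \<Rightarrow>\<^sub>0 int) ring" where
  "hecke_algebra n =
     \<lparr>carrier = {x. Poly_Mapping.keys x \<subseteq> double_cosets n},
      monoid.mult = hecke_mult n,
      one = Poly_Mapping.single (double_coset n \<one>\<^bsub>GLQ n\<^esub>) 1,
      zero = 0,
      add = (+)\<rparr>"

text \<open>The multiple \<open>c \<cdot> \<Lambda>g\<Lambda>\<close> of a basis element.\<close>

definition hecke_term :: "nat \<Rightarrow> int \<Rightarrow> rat mat \<Rightarrow> (rat mat set \<Rightarrow>\<^sub>0 int)" where
  "hecke_term n c g = Poly_Mapping.single (double_coset n g) c"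


section \<open>Representatives\<close>

definition det_divisor :: "nat \<Rightarrow> int mat \<Rightarrow> int" where
  "det_divisor k g =
     Gcd {det (submatrix g I J) | I J.
            I \<subseteq> {..<dim_row g} \<and> J \<subseteq> {..<dim_col g} \<and> card I = k \<and> card J = k}"

definition R0 :: "nat \<Rightarrow> nat \<Rightarrow> int mat set" where
  "R0 n p = {C \<in> carrier_mat n n. upper_triangular C \<and>
     (\<forall>k \<in> {1..n-1}. det_divisor k C = int p ^ (k - 1)) \<and> det_divisor n C = int p ^ n \<and>
     (\<forall>i < n. C $$ (i, i) = int p) \<and>
     (\<forall>i j. i < j \<and> j < n \<longrightarrow> 0 \<le> C $$ (i, j) \<and> C $$ (i, j) < int p)}"

definition R1 :: "nat \<Rightarrow> nat \<Rightarrow> int mat set" where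
  "R1 n p = {C \<in> carrier_mat n n. upper_triangular C \<and>
     (\<forall>i < n. C $$ (i, i) \<in> {1, int p, int p ^ 2}) \<and>
     (\<exists>!i. i < n \<and> C $$ (i, i) = 1) \<and> (\<exists>!i. i < n \<and> C $$ (i, i) = int p ^ 2) \<and>
     (\<forall>i j. i < j \<and> j < n \<longrightarrow> 0 \<le> C $$ (i, j) \<and> C $$ (i, j) < C $$ (j, j)) \<and>
     (\<forall>i < n - 1. int p dvd C $$ (i, i) \<longrightarrow>
        (\<forall>j. i < j \<and> j < n \<longrightarrow> int p dvd C $$ (i, j)))}"

end

theory Submission
  imports Defs "HOL-Library.Function_Algebras"
begin

text \<open>
  The right coset \<open>\<Lambda>\<^sub>n g\<close> is determined by the lattice \<open>\<int>\<^sup>n g\<close> spanned by the rows of \<open>g\<close>. Call two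
  lattices adjacent if their intersection has index \<open>p\<close> in both of them. By the Smith normal form,
  the cosets in the double coset of \<open>diag(1, p, \<dots>, p, p\<^sup>2)\<close> correspond to the lattices adjacent to
  \<open>p \<int>\<^sup>n\<close>, and the other double cosets correspond to the lattices \<open>K\<close> for which \<open>L = p\<^sup>2 \<int>\<^sup>n\<close> and
  \<open>K\<close> are equal, or adjacent, or have an intersection of index \<open>p\<^sup>2\<close> in both, where each of
  \<open>L/(L \<inter> K)\<close> and \<open>K/(L \<inter> K)\<close> may be cyclic or elementary abelian. So the degrees count lattices in
  a given relative position, which is done by double counting chains of sublattices of index \<open>p\<close>,
  and the coefficient of a double coset in the square is the number of common neighbours of \<open>L\<close>
  and \<open>K\<close>. The matrices of \<open>R\<close> are the Hermite normal forms of the lattices adjacent to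
  \<open>p \<int>\<^sup>n\<close>: the double coset is recognized by the minors of sizes \<open>1\<close> and \<open>2\<close> and the
  determinant.
\<close>

section \<open>Subgroups of finite index\<close>

text \<open>Everything is counted in vector spaces over the field with p elements. A lattice
  containing N with index p lies in p^-1 N, and one of index p in L contains p L, so the single
  steps are lines and hyperplanes of n-dimensional spaces, and there are \<open>br p n\<close> = 1 +
  p + ... + p^(n-1) of either kind. The obstacle at index p^2 is that the quotient need not be a
  vector space: cyclic quotients are obtained as the complement of the elementary abelian ones, and
  each quotient is reached through as many chains as it has proper intermediate groups, namely 1 or
  p + 1. The products of these two numbers for L and K are the coefficients 1, p + 1 and (p + 1)^2
  in the square. For adjacent L and K the coefficient is an inclusion-exclusion:
  \<open>br p n\<close> - 2 further lattices lie over L \<inter> K, as many lie in L + K, and p - 1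
  do both. For L = K all neighbours of L are counted, so that coefficient is again the degree.
  Matrices enter through one principle: every lattice near a multiple of the standard one can be
  made diagonal, and its relative position then fixes the multiset of exponents.\<close>

definition sbgp :: "'a::ab_group_add set \<Rightarrow> bool" where
  "sbgp H \<longleftrightarrow> 0 \<in> H \<and> (\<forall>x\<in>H. \<forall>y\<in>H. x - y \<in> H)"

text \<open>An infinite index is represented by \<open>0\<close>.\<close>

definition idx :: "'a::ab_group_add set \<Rightarrow> 'a set \<Rightarrow> nat" where
  "idx L N = card ((\<lambda>x. (+) x ` N) ` L)"

definition gsum :: "'a::ab_group_add set \<Rightarrow> 'a set \<Rightarrow> 'a set" where
  "gsum A B = {a + b | a b. a \<in> A \<and> b \<in> B}"

lemma sbgp_zero: "sbgp H \<Longrightarrow> 0 \<in> H"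
  and sbgp_diff: "sbgp H \<Longrightarrow> x \<in> H \<Longrightarrow> y \<in> H \<Longrightarrow> x - y \<in> H"
  by (auto simp: sbgp_def)

lemma sbgp_minus: "sbgp H \<Longrightarrow> x \<in> H \<Longrightarrow> - x \<in> H"
  using sbgp_diff[of H 0 x] sbgp_zero[of H] by simp

lemma sbgp_add: "sbgp H \<Longrightarrow> x \<in> H \<Longrightarrow> y \<in> H \<Longrightarrow> x + y \<in> H"
  using sbgp_diff[of H x "- y"] sbgp_minus[of H y] by simp

lemma sbgp_sum: "sbgp H \<Longrightarrow> (\<And>i. i \<in> I \<Longrightarrow> f i \<in> H) \<Longrightarrow> sum f I \<in> H"
  by (induction I rule: infinite_finite_induct) (auto intro: sbgp_add sbgp_zero)

lemma sbgp_of_nat_mult: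
  fixes H :: "'a::ring_1 set"
  shows "sbgp H \<Longrightarrow> x \<in> H \<Longrightarrow> of_nat k * x \<in> H"
  by (induction k) (auto simp: distrib_right intro: sbgp_add sbgp_zero)

lemma sbgp_Int: "sbgp A \<Longrightarrow> sbgp B \<Longrightarrow> sbgp (A \<inter> B)"
  by (auto simp: sbgp_def)

lemma sbgp_gsum:
  assumes "sbgp A" "sbgp B"
  shows "sbgp (gsum A B)"
  unfolding sbgp_def
proof (intro conjI ballI)
  show "0 \<in> gsum A B"
    unfolding gsum_def using sbgp_zero[OF assms(1)] sbgp_zero[OF assms(2)]
    by (auto intro!: exI[of _ 0])
  fix x y assume "x \<in> gsum A B" "y \<in> gsum A B"
  then obtain a b a' b' where *: "x = a + b" "y = a' + b'" "a \<in> A" "b \<in> B" "a' \<in> A" "b' \<in> B"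
    unfolding gsum_def by blast
  have "x - y = (a - a') + (b - b')"
    using * by (simp add: algebra_simps)
  moreover have "a - a' \<in> A" "b - b' \<in> B"
    using * assms by (auto intro: sbgp_diff)
  ultimately show "x - y \<in> gsum A B"
    unfolding gsum_def by blast
qed

lemma gsum_memI: "a \<in> A \<Longrightarrow> b \<in> B \<Longrightarrow> a + b \<in> gsum A B"
  unfolding gsum_def by blast

lemma gsum_upper1: "sbgp B \<Longrightarrow> A \<subseteq> gsum A B"
  using gsum_memI[of _ A 0 B] sbgp_zero by auto

lemma gsum_upper2: "sbgp A \<Longrightarrow> B \<subseteq> gsum A B"
  using gsum_memI[of 0 A _ B] sbgp_zero by auto

lemma gsum_least: "sbgp C \<Longrightarrow> A \<subseteq> C \<Longrightarrow> B \<subseteq> C \<Longrightarrow> gsum A B \<subseteq> C"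
  unfolding gsum_def by (auto intro: sbgp_add)

lemma gsum_comm: "gsum A B = gsum B A"
  unfolding gsum_def by (auto simp: add.commute) (metis add.commute)+

lemma coset_eq_iff:
  assumes "sbgp N"
  shows "(+) x ` N = (+) y ` N \<longleftrightarrow> x - y \<in> N"
proof
  assume "(+) x ` N = (+) y ` N"
  then have "x + 0 \<in> (+) y ` N"
    using sbgp_zero[OF assms] by blast
  then show "x - y \<in> N" by auto
next
  assume d: "x - y \<in> N"
  have sub: "(+) u ` N \<subseteq> (+) v ` N" if "u - v \<in> N" for u v
  proof
    fix z assume "z \<in> (+) u ` N"
    then obtain m where m: "m \<in> N" "z = u + m" by auto
    have "(u - v) + m \<in> N" using sbgp_add[OF assms that m(1)] .
    moreover have "z = v + ((u - v) + m)" using m by simp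
    ultimately show "z \<in> (+) v ` N" by blast
  qed
  have "y - x \<in> N" using sbgp_minus[OF assms d] by simp
  then show "(+) x ` N = (+) y ` N" using sub d by blast
qed

text \<open>Both images are models of the same quotient of L. Indices can thus be computed with any
  convenient invariant of cosets, and degrees by counting lattices; infinite images are covered as
  well.\<close>

lemma card_image_same_kernel:
  assumes "\<And>x y. x \<in> L \<Longrightarrow> y \<in> L \<Longrightarrow> f x = f y \<longleftrightarrow> g x = g y"
  shows "card (f ` L) = card (g ` L)"
proof -
  have "bij_betw (\<lambda>c. g (inv_into L f c)) (f ` L) (g ` L)"
    unfolding bij_betw_def
  proof
    show "inj_on (\<lambda>c. g (inv_into L f c)) (f ` L)"
      by (rule inj_onI) (metis assms f_inv_into_f inv_into_into)
    show "(\<lambda>c. g (inv_into L f c)) ` f ` L = g ` L"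
    proof (intro subset_antisym subsetI)
      fix z assume "z \<in> (\<lambda>c. g (inv_into L f c)) ` f ` L"
      then show "z \<in> g ` L" by (auto intro: inv_into_into)
    next
      fix z assume "z \<in> g ` L"
      then obtain x where x: "x \<in> L" "z = g x" by auto
      have "f (inv_into L f (f x)) = f x" "inv_into L f (f x) \<in> L"
        using x by (auto intro: f_inv_into_f inv_into_into)
      then have "z = g (inv_into L f (f x))" using assms x by metis
      then show "z \<in> (\<lambda>c. g (inv_into L f c)) ` f ` L" using x by blast
    qed
  qed
  then show ?thesis by (rule bij_betw_same_card)
qed

lemma idx_eq_card:
  assumes "sbgp N" and "\<And>x y. x \<in> L \<Longrightarrow> y \<in> L \<Longrightarrow> f x = f y \<longleftrightarrow> x - y \<in> N"
  shows "idx L N = card (f ` L)"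
  unfolding idx_def by (rule card_image_same_kernel) (simp add: coset_eq_iff assms)

lemma idx_pos_iff: "sbgp L \<Longrightarrow> idx L N > 0 \<longleftrightarrow> finite ((\<lambda>x. (+) x ` N) ` L)"
  unfolding idx_def using sbgp_zero[of L] by (auto simp: card_gt_0_iff)

text \<open>A choice \<open>r\<close> of representatives modulo M splits x into its class modulo M
  and the remainder x - r in M, read modulo N. This is a bijection of L/N with (L/M) x (M/N), so the
  formula also holds for infinite indices.\<close>

lemma idx_mult:
  assumes "sbgp N" "sbgp M" "sbgp L" "N \<subseteq> M" "M \<subseteq> L"
  shows "idx L N = idx L M * idx M N"
proof -
  define r where "r C = (SOME y. y \<in> C)" for C :: "'a set"
  define f where "f x = ((+) x ` M, (+) (x - r ((+) x ` M)) ` N)" for x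
  have r: "r ((+) x ` M) - x \<in> M" for x
  proof -
    have "x + 0 \<in> (+) x ` M" using sbgp_zero[OF assms(2)] by blast
    then have "r ((+) x ` M) \<in> (+) x ` M" unfolding r_def by (rule someI)
    then show ?thesis by auto
  qed
  have r': "x - r ((+) x ` M) \<in> M" for x
    using sbgp_minus[OF assms(2) r[of x]] by simp
  have "f x = f y \<longleftrightarrow> x - y \<in> N" for x y
  proof
    assume "f x = f y"
    then have "(+) x ` M = (+) y ` M" "(x - r ((+) x ` M)) - (y - r ((+) y ` M)) \<in> N"
      unfolding f_def using coset_eq_iff[OF assms(1)] by auto
    then show "x - y \<in> N" by simp
  next
    assume d: "x - y \<in> N"
    then have "(+) x ` M = (+) y ` M"
      using coset_eq_iff[OF assms(2)] assms(4) by blast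
    then show "f x = f y" unfolding f_def using d coset_eq_iff[OF assms(1)] by auto
  qed
  then have "idx L N = card (f ` L)" using assms by (intro idx_eq_card) auto
  also have "f ` L = ((\<lambda>x. (+) x ` M) ` L) \<times> ((\<lambda>x. (+) x ` N) ` M)"
  proof (intro subset_antisym subsetI)
    fix z assume "z \<in> f ` L"
    then show "z \<in> ((\<lambda>x. (+) x ` M) ` L) \<times> ((\<lambda>x. (+) x ` N) ` M)"
      unfolding f_def using r' by auto
  next
    fix z assume "z \<in> ((\<lambda>x. (+) x ` M) ` L) \<times> ((\<lambda>x. (+) x ` N) ` M)"
    then obtain x m where z: "x \<in> L" "m \<in> M" "z = ((+) x ` M, (+) m ` N)" by auto
    \<comment> \<open>The prescribed remainder m is added to the chosen representative of the class
      of x, not to x itself, so that \<open>f y\<close> has exactly the second component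
      required.\<close>
    define y where "y = r ((+) x ` M) + m"
    have "y - x \<in> M"
      using sbgp_add[OF assms(2) r[of x] z(2)] by (simp add: y_def algebra_simps)
    then have e: "(+) y ` M = (+) x ` M" using coset_eq_iff[OF assms(2)] by blast
    have "y = x + (y - x)" by simp
    then have "y \<in> L" using sbgp_add[OF assms(3) z(1)] \<open>y - x \<in> M\<close> assms(5)
      by (metis subsetD)
    moreover have "f y = z" unfolding f_def e z(3) by (simp add: y_def)
    ultimately show "z \<in> f ` L" by blast
  qed
  finally show ?thesis unfolding idx_def by (simp add: card_cartesian_product)
qed

lemma idx_refl: "sbgp N \<Longrightarrow> idx N N = 1"
proof -
  assume N: "sbgp N"
  have "idx N N = card ((\<lambda>x. ()) ` N)"
    using N by (intro idx_eq_card) (auto intro: sbgp_diff)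
  also have "(\<lambda>x. ()) ` N = {()}" using sbgp_zero[OF N] by auto
  finally show ?thesis by simp
qed

lemma idx_eq_1_imp:
  assumes "sbgp N" "sbgp L" "N \<subseteq> L" "idx L N = 1"
  shows "L = N"
proof
  show "L \<subseteq> N"
  proof
    fix x assume x: "x \<in> L"
    obtain C where C: "(\<lambda>x. (+) x ` N) ` L = {C}"
      using assms(4) unfolding idx_def by (auto simp: card_1_singleton_iff)
    have "(+) x ` N \<in> {C}"
      unfolding C[symmetric] using x by (rule imageI)
    moreover have "(+) 0 ` N \<in> {C}"
      unfolding C[symmetric] using sbgp_zero[OF assms(2)] by (rule imageI)
    ultimately have "(+) x ` N = (+) 0 ` N" by simp
    then show "x \<in> N" using coset_eq_iff[OF assms(1), of x 0] by simp
  qed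
qed (rule assms(3))

text \<open>The second isomorphism theorem: every class of L + K modulo L has a representative in
  K.\<close>

lemma idx_gsum:
  assumes "sbgp L" "sbgp K"
  shows "idx (gsum L K) L = idx K (L \<inter> K)"
proof -
  have "idx K (L \<inter> K) = card ((\<lambda>x. (+) x ` L) ` K)"
    using assms by (intro idx_eq_card sbgp_Int) (auto simp: coset_eq_iff intro: sbgp_diff)
  also have "(\<lambda>x. (+) x ` L) ` K = (\<lambda>x. (+) x ` L) ` gsum L K"
  proof (intro subset_antisym subsetI)
    fix C assume "C \<in> (\<lambda>x. (+) x ` L) ` K"
    then show "C \<in> (\<lambda>x. (+) x ` L) ` gsum L K" using gsum_upper2[OF assms(1)] by blast
  next
    fix C assume "C \<in> (\<lambda>x. (+) x ` L) ` gsum L K"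
    then obtain a b where C: "C = (+) (a + b) ` L" "a \<in> L" "b \<in> K" unfolding gsum_def by blast
    then have "C = (+) b ` L" using coset_eq_iff[OF assms(1), of "a + b" b] by simp
    then show "C \<in> (\<lambda>x. (+) x ` L) ` K" using C by blast
  qed
  finally show ?thesis by (simp add: idx_def)
qed

lemma idx_image:
  assumes "sbgp N" "sbgp (f ` N)" "N \<subseteq> L" "sbgp L" "inj_on f L"
    and "\<And>x y. x \<in> L \<Longrightarrow> y \<in> L \<Longrightarrow> f (x - y) = f x - f y"
  shows "idx (f ` L) (f ` N) = idx L N"
proof -
  have "idx L N = card ((\<lambda>x. (+) (f x) ` f ` N) ` L)"
  proof (intro idx_eq_card assms(1))
    fix x y assume xy: "x \<in> L" "y \<in> L"
    then have "f x - f y \<in> f ` N \<longleftrightarrow> f (x - y) \<in> f ` N" using assms(6) by simp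
    also have "\<dots> \<longleftrightarrow> x - y \<in> N"
      using inj_on_image_mem_iff[OF assms(5) _ assms(3)] sbgp_diff[OF assms(4)] xy by blast
    finally show "(+) (f x) ` f ` N = (+) (f y) ` f ` N \<longleftrightarrow> x - y \<in> N"
      by (simp add: coset_eq_iff assms(2))
  qed
  then show ?thesis by (simp add: idx_def image_image)
qed

text \<open>The sum of a system of representatives of \<open>L/N\<close> is unchanged modulo \<open>N\<close> under
  translation by \<open>x\<close>, and it changes by \<open>|L/N| x\<close>.\<close>

lemma idx_mult_mem:
  fixes L :: "'a::ring_1 set"
  assumes "sbgp N" "sbgp L" "N \<subseteq> L" "idx L N > 0" "x \<in> L"
  shows "of_nat (idx L N) * x \<in> N"
proof -
  define Q where "Q = (\<lambda>x. (+) x ` N) ` L"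
  define r where "r C = (SOME y. y \<in> C)" for C :: "'a set"
  define t where "t C = (+) x ` C" for C
  have fin: "finite Q" using assms(2,4) unfolding Q_def by (simp add: idx_pos_iff)
  have t: "t ((+) y ` N) = (+) (x + y) ` N" for y
    unfolding t_def image_image by (simp add: add.assoc)
  have r: "r ((+) y ` N) - y \<in> N" for y
  proof -
    have "y + 0 \<in> (+) y ` N" using sbgp_zero[OF assms(1)] by blast
    then have "r ((+) y ` N) \<in> (+) y ` N" unfolding r_def by (rule someI)
    then show ?thesis by auto
  qed
  have "inj t" unfolding t_def by (rule injI) (simp add: inj_image_eq_iff)
  then have inj: "inj_on t Q" by (rule inj_on_subset) simp
  have "t ` Q \<subseteq> Q"
  proof
    fix C assume "C \<in> t ` Q"
    then obtain y where "y \<in> L" "C = t ((+) y ` N)" unfolding Q_def by blast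
    then show "C \<in> Q" using t sbgp_add[OF assms(2,5)] unfolding Q_def by blast
  qed
  then have "bij_betw t Q Q"
    using endo_inj_surj[OF fin _ inj] inj by (simp add: bij_betw_def)
  then have "(\<Sum>C\<in>Q. r (t C)) = (\<Sum>C\<in>Q. r C)" by (rule sum.reindex_bij_betw)
  then have "of_nat (card Q) * x = - (\<Sum>C\<in>Q. r (t C) - x - r C)"
    by (simp add: sum_subtractf)
  moreover have "(\<Sum>C\<in>Q. r (t C) - x - r C) \<in> N"
  proof (rule sbgp_sum[OF assms(1)])
    fix C assume "C \<in> Q"
    then obtain y where y: "C = (+) y ` N" unfolding Q_def by blast
    have "r (t C) - x - r C = (r ((+) (x + y) ` N) - (x + y)) - (r ((+) y ` N) - y)"
      unfolding y t by simp
    then show "r (t C) - x - r C \<in> N" using r sbgp_diff[OF assms(1)] by metis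
  qed
  ultimately have "of_nat (card Q) * x \<in> N" using sbgp_minus[OF assms(1)] by simp
  then show ?thesis unfolding Q_def idx_def .
qed

lemma prime_idx_intermediate:
  fixes p :: nat
  assumes "Factorial_Ring.prime p" "idx L N = p" "sbgp N" "sbgp M" "sbgp L" "N \<subseteq> M" "M \<subseteq> L"
  shows "M = N \<or> M = L"
proof -
  have "p = idx L M * idx M N" using idx_mult assms by metis
  then have "idx L M = 1 \<or> idx M N = 1"
    using prime_product assms(1) by metis
  then show ?thesis using idx_eq_1_imp assms by metis
qed

text \<open>An intermediate group is the union of its cosets of N, hence determined by a subset of
  the finite quotient S/N.\<close>

lemma finite_intermediate:
  assumes "sbgp N" "sbgp S" "idx S N > 0"
  shows "finite {K. sbgp K \<and> N \<subseteq> K \<and> K \<subseteq> S}"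
proof -
  let ?q = "\<lambda>x. (+) x ` N"
  let ?A = "{K. sbgp K \<and> N \<subseteq> K \<and> K \<subseteq> S}"
  have fin: "finite (?q ` S)" using assms by (simp add: idx_pos_iff)
  have U: "\<Union> (?q ` K) = K" if "K \<in> ?A" for K
    using that sbgp_add[of K] sbgp_zero[OF assms(1)] by fastforce
  have "(\<lambda>K. ?q ` K) ` ?A \<subseteq> Pow (?q ` S)" by blast
  then have "finite ((\<lambda>K. ?q ` K) ` ?A)" using fin finite_subset by blast
  moreover have "inj_on (\<lambda>K. ?q ` K) ?A" by (rule inj_onI) (metis U)
  ultimately show ?thesis by (rule finite_imageD)
qed

section \<open>Lines and hyperplanes in elementary abelian p-groups\<close>

definition br :: "nat \<Rightarrow> nat \<Rightarrow> nat" where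
  "br p k = (\<Sum>i<k. p ^ i)"

lemma br_0 [simp]: "br p 0 = 0" and br_Suc: "br p (Suc k) = 1 + p * br p k"
  by (simp_all add: br_def sum.lessThan_Suc_shift sum_distrib_left del: sum.lessThan_Suc)

lemma br_Suc': "br p (Suc k) = br p k + p ^ k"
  by (simp add: br_def)

text \<open>The division-free form of (p^k - 1)/(p - 1), the number of lines in a k-dimensional
  space over the field with p elements.\<close>

lemma br_mult: "p > 0 \<Longrightarrow> br p k * (p - 1) + 1 = p ^ k"
proof (induction k)
  case (Suc k)
  have "br p (Suc k) * (p - 1) + 1 = br p k * (p - 1) + 1 + p ^ k * (p - 1)"
    by (simp add: br_Suc' add_mult_distrib)
  also have "\<dots> = p ^ k * (1 + (p - 1))" using Suc by (simp add: algebra_simps)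
  finally show ?case using Suc.prems by simp
qed simp

lemma br_1 [simp]: "br p (Suc 0) = 1" by (simp add: br_Suc)

lemma br_2: "br p 2 = p + 1" by (simp add: br_Suc numeral_2_eq_2)

lemma br_pos: "k > 0 \<Longrightarrow> br p k > 0"
  by (cases k) (simp_all add: br_Suc)

text \<open>The assumption \<open>el\<close> makes S/N a vector space of dimension k over the field
  with p elements, and the groups K are its lines. Without their zero they are disjoint sets
  \<open>E K\<close> of size p - 1 that exhaust the p^k - 1 nonzero classes.\<close>

lemma card_covers:
  fixes S :: "'a::comm_ring_1 set"
  assumes p: "Factorial_Ring.prime (p::nat)" and N: "sbgp N" and S: "sbgp S" and NS: "N \<subseteq> S"
    and el: "\<And>x. x \<in> S \<Longrightarrow> of_nat p * x \<in> N" and k: "idx S N = p ^ k"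
  shows "card {K. sbgp K \<and> N \<subseteq> K \<and> K \<subseteq> S \<and> idx K N = p} = br p k"
proof -
  let ?q = "\<lambda>x. (+) x ` N"
  let ?A = "{K. sbgp K \<and> N \<subseteq> K \<and> K \<subseteq> S \<and> idx K N = p}"
  define E where "E K = ?q ` K - {N}" for K
  have p1: "p > 1" using p by (rule prime_gt_1_nat)
  have pos: "idx S N > 0" using k p1 by simp
  have finA: "finite ?A"
    by (rule finite_subset[OF _ finite_intermediate[OF N S pos]]) auto
  have finS: "finite (?q ` S)" using S pos by (simp add: idx_pos_iff)
  have N0: "?q 0 = N" by simp
  have Nin: "N \<in> ?q ` K" if "sbgp K" for K
    using N0 sbgp_zero[OF that] by blast
  have qN: "?q x = N \<longleftrightarrow> x \<in> N" for x
    using coset_eq_iff[OF N, of x 0] by simp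
  have cE: "card (E K) = p - 1" if "K \<in> ?A" for K
  proof -
    have "card (?q ` K) = p" using that by (simp add: idx_def)
    then show ?thesis unfolding E_def using Nin that by simp
  qed
  \<comment> \<open>The line through x: the multiples of x together with N.\<close>
  have cover: "\<exists>K\<in>?A. x \<in> K" if x: "x \<in> S" "x \<notin> N" for x
  proof -
    define K where "K = {of_nat i * x + y | i y. y \<in> N}"
    have KS: "K \<subseteq> S"
      unfolding K_def using sbgp_add[OF S sbgp_of_nat_mult[OF S x(1)]] NS by auto
    \<comment> \<open>Since p x lies in N, coefficients of x matter only modulo p.\<close>
    have red: "\<exists>i<p. \<exists>y\<in>N. z = of_nat i * x + y" if zK: "z \<in> K" for z
    proof -
      obtain i y where z: "z = of_nat i * x + y" "y \<in> N" using zK unfolding K_def by auto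
      have "(of_nat i :: 'a) = of_nat (i div p * p + i mod p)" by simp
      then have "of_nat i * x = of_nat (i div p) * (of_nat p * x) + of_nat (i mod p) * x"
        by (simp only: of_nat_add of_nat_mult algebra_simps)
      then have "z = of_nat (i mod p) * x + (of_nat (i div p) * (of_nat p * x) + y)"
        using z by simp
      moreover have "of_nat (i div p) * (of_nat p * x) + y \<in> N"
        using sbgp_add[OF N sbgp_of_nat_mult[OF N el[OF x(1)]] z(2)] .
      moreover have "i mod p < p" using p1 by simp
      ultimately show ?thesis by blast
    qed
    have K: "sbgp K"
      unfolding sbgp_def
    proof (intro conjI ballI)
      show "0 \<in> K" unfolding K_def using sbgp_zero[OF N] by (auto intro!: exI[of _ 0])
      fix z w assume "z \<in> K" "w \<in> K"
      then obtain i y j v where *: "z = of_nat i * x + y" "y \<in> N" "w = of_nat j * x + v" "v \<in> N" "j < p"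
        using red unfolding K_def by blast
      \<comment> \<open>Coefficients are natural numbers, so -j is replaced by p - j; the surplus p
        x is an element of N.\<close>
      have "z - w = of_nat (i + (p - j)) * x + ((y - v) - of_nat p * x)"
        using * by (simp add: of_nat_diff algebra_simps)
      moreover have "(y - v) - of_nat p * x \<in> N"
        using sbgp_diff[OF N sbgp_diff[OF N *(2,4)] el[OF x(1)]] .
      ultimately show "z - w \<in> K" unfolding K_def by blast
    qed
    have KI: "of_nat i * x + y \<in> K" if "y \<in> N" for i y
      unfolding K_def using that by blast
    have NK: "N \<subseteq> K" using KI[of _ 0] by auto
    have xK: "x \<in> K" using KI[of 0 1] sbgp_zero[OF N] by simp
    have "?q ` K \<subseteq> (\<lambda>i. ?q (of_nat i * x)) ` {..<p}"
    proof
      fix C assume "C \<in> ?q ` K"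
      then obtain i y where "i < p" "y \<in> N" "C = ?q (of_nat i * x + y)" using red by blast
      then have "C = ?q (of_nat i * x)" by (simp add: coset_eq_iff N)
      then show "C \<in> (\<lambda>i. ?q (of_nat i * x)) ` {..<p}" using \<open>i < p\<close> by blast
    qed
    then have "idx K N \<le> card ((\<lambda>i. ?q (of_nat i * x)) ` {..<p})"
      unfolding idx_def by (intro card_mono) auto
    also have "\<dots> \<le> p" using card_image_le[of "{..<p}"] by simp
    finally have le: "idx K N \<le> p" .
    \<comment> \<open>The index is a power of p, at most p, and not 1 because x lies outside
      N.\<close>
    have "idx K N dvd p ^ k" using idx_mult[OF N K S NK KS] k by simp
    then obtain j where j: "idx K N = p ^ j" using divides_primepow_nat[OF p] by blast
    have "idx K N \<noteq> 1" using idx_eq_1_imp[OF N K NK] xK x(2) by blast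
    then have "j > 0" using j by (cases j) auto
    then have "p \<le> p ^ j" using p1 by (simp add: self_le_power)
    then have "idx K N = p" using le j by simp
    then show ?thesis using K NK KS xK by blast
  qed
  have "(\<Union>K\<in>?A. E K) = ?q ` S - {N}"
  proof (intro subset_antisym subsetI)
    fix C assume "C \<in> (\<Union>K\<in>?A. E K)"
    then show "C \<in> ?q ` S - {N}" unfolding E_def by blast
  next
    fix C assume "C \<in> ?q ` S - {N}"
    then obtain x where x: "x \<in> S" "C = ?q x" "x \<notin> N" using qN by auto
    then obtain K where "K \<in> ?A" "x \<in> K" using cover by blast
    moreover from this have "C \<in> E K" unfolding E_def x(2) using x(3) qN by simp
    ultimately show "C \<in> (\<Union>K\<in>?A. E K)" by blast
  qed
  moreover have "card (\<Union>K\<in>?A. E K) = (\<Sum>K\<in>?A. card (E K))"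
  proof (rule card_UN_disjoint[OF finA])
    show "\<forall>K\<in>?A. finite (E K)"
    proof
      fix K assume "K \<in> ?A"
      then have "?q ` K \<subseteq> ?q ` S" by blast
      then show "finite (E K)" unfolding E_def using finite_subset[OF _ finS] by blast
    qed
    show "\<forall>K\<in>?A. \<forall>K'\<in>?A. K \<noteq> K' \<longrightarrow> E K \<inter> E K' = {}"
    proof (intro ballI impI, rule ccontr)
      fix K K' assume KK: "K \<in> ?A" "K' \<in> ?A" "K \<noteq> K'" "E K \<inter> E K' \<noteq> {}"
      from KK(4) obtain C where C: "C \<in> ?q ` K" "C \<in> ?q ` K'" "C \<noteq> N" unfolding E_def by auto
      from C(1) obtain x where x: "x \<in> K" "C = ?q x" by (rule imageE)
      from C(2) obtain y where y: "y \<in> K'" "C = ?q y" by (rule imageE)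
      have xy: "x \<in> K" "y \<in> K'" "?q x = ?q y" "?q x \<noteq> N" using x y C(3) by auto
      then have "x \<notin> N" unfolding qN by blast
      have "x - y \<in> N" using coset_eq_iff[OF N] xy(3) by simp
      then have "x - y \<in> K'" using KK(2) by blast
      then have "x - y + y \<in> K'" using sbgp_add[of K' "x - y" y] KK(2) xy(2) by blast
      then have xK: "x \<in> K \<inter> K'" using xy by simp
      \<comment> \<open>A prime index leaves no proper intermediate group, so two lines sharing a
        class other than N coincide.\<close>
      have "K \<inter> K' = N \<or> K \<inter> K' = K" "K \<inter> K' = N \<or> K \<inter> K' = K'"
        by (rule prime_idx_intermediate[OF p]; use KK N in \<open>auto intro: sbgp_Int\<close>)+
      then show False using xK \<open>x \<notin> N\<close> KK by blast
    qed
  qed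
  ultimately have "card (?q ` S - {N}) = card ?A * (p - 1)" using cE by simp
  moreover have "card (?q ` S - {N}) = p ^ k - 1" using k Nin[OF S] unfolding idx_def by simp
  moreover have "br p k * (p - 1) = p ^ k - 1" using br_mult[of p k] p1 by simp
  ultimately have "card ?A * (p - 1) = br p k * (p - 1)" by metis
  then show ?thesis using p1 by simp
qed

lemma double_count:
  assumes "finite A" "finite B"
    and "\<And>a. a \<in> A \<Longrightarrow> card {b\<in>B. R a b} = c"
    and "\<And>b. b \<in> B \<Longrightarrow> card {a\<in>A. R a b} = d"
  shows "card A * c = card B * d"
proof -
  have "(\<Sum>a\<in>A. card {b\<in>B. R a b}) = d * card B"
    using sum_multicount[OF assms(1,2)] assms(4) by blast
  then show ?thesis using assms(3) by simp
qed

text \<open>Duality without dual spaces: incident pairs of a line K and a hyperplane M are counted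
  in two ways. By induction \<open>br p k\<close> hyperplanes contain a given K, since they are
  those of S/K, and by \<open>card_covers\<close> a given M contains \<open>br p k\<close> lines. So
  there are as many hyperplanes as lines.\<close>

lemma card_maximal:
  fixes S :: "'a::comm_ring_1 set"
  assumes p: "Factorial_Ring.prime (p::nat)" and N: "sbgp N" and S: "sbgp S" and NS: "N \<subseteq> S"
    and el: "\<And>x. x \<in> S \<Longrightarrow> of_nat p * x \<in> N" and k: "idx S N = p ^ k"
  shows "card {M. sbgp M \<and> N \<subseteq> M \<and> M \<subseteq> S \<and> idx S M = p} = br p k"
  using N NS el k
proof (induction k arbitrary: N)
  case 0
  then have "S = N" using idx_eq_1_imp[OF 0(1) S] by simp
  moreover have "p \<noteq> 1" using p by auto
  ultimately have "{M. sbgp M \<and> N \<subseteq> M \<and> M \<subseteq> S \<and> idx S M = p} = {}"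
    using idx_refl[OF S] by auto
  then show ?case by (simp only: card.empty br_0)
next
  case (Suc k)
  have p1: "p > 1" using p by (rule prime_gt_1_nat)
  have pos: "idx S N > 0" using Suc p1 by simp
  let ?A = "{K. sbgp K \<and> N \<subseteq> K \<and> K \<subseteq> S \<and> idx K N = p}"
  let ?B = "{M. sbgp M \<and> N \<subseteq> M \<and> M \<subseteq> S \<and> idx S M = p}"
  show ?case
  \<comment> \<open>In dimension one the common factor \<open>br p k\<close> of the double count is
    0 and cannot be cancelled.\<close>
  proof (cases "k = 0")
    case True
    have "?B = {N}"
    proof (intro subset_antisym subsetI)
      fix M assume M: "M \<in> ?B"
      then have "idx S N = idx S M * idx M N" using idx_mult Suc.prems(1,2) S by blast
      then have "p = p * idx M N" using M Suc.prems(4) True by simp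
      then have "idx M N = 1" using p1 by simp
      then show "M \<in> {N}" using idx_eq_1_imp[of N M] M Suc.prems by simp
    next
      fix M assume "M \<in> {N}"
      then show "M \<in> ?B" using Suc.prems True by simp
    qed
    then show ?thesis using True by simp
  next
    case False
    have fin: "finite ?A" "finite ?B"
      by (rule finite_subset[OF _ finite_intermediate[OF Suc.prems(1) S pos]]; auto)+
    have "card ?A * br p k = card ?B * br p k"
    proof (rule double_count[OF fin, where R = "\<lambda>K M. K \<subseteq> M"])
      fix K assume K: "K \<in> ?A"
      then have "p ^ Suc k = idx S K * p" using idx_mult[of N K S] Suc.prems S by simp
      then have "idx S K = p ^ k" using p1 by simp
      then have "card {M. sbgp M \<and> K \<subseteq> M \<and> M \<subseteq> S \<and> idx S M = p} = br p k"
        using K Suc.prems by (intro Suc.IH) auto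
      moreover have "{M. sbgp M \<and> K \<subseteq> M \<and> M \<subseteq> S \<and> idx S M = p} = {M\<in>?B. K \<subseteq> M}"
        using K by auto
      ultimately show "card {M\<in>?B. K \<subseteq> M} = br p k" by simp
    next
      fix M assume M: "M \<in> ?B"
      then have "p ^ Suc k = p * idx M N" using idx_mult[of N M S] Suc.prems S by simp
      then have "idx M N = p ^ k" using p1 by simp
      then have "card {K. sbgp K \<and> N \<subseteq> K \<and> K \<subseteq> M \<and> idx K N = p} = br p k"
        using M Suc.prems by (intro card_covers p) auto
      moreover have "{K. sbgp K \<and> N \<subseteq> K \<and> K \<subseteq> M \<and> idx K N = p} = {K\<in>?A. K \<subseteq> M}"
        using M by auto
      ultimately show "card {K\<in>?A. K \<subseteq> M} = br p k" by simp
    qed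
    then have "card ?B = card ?A" using br_pos[of k p] False by simp
    then show ?thesis using card_covers[OF p Suc.prems(1) S Suc.prems(2,3,4)] by simp
  qed
qed

lemma card_fibres:
  assumes "finite A" "f ` B \<subseteq> A"
    and "\<And>a. a \<in> A \<Longrightarrow> finite {b\<in>B. f b = a}" "\<And>a. a \<in> A \<Longrightarrow> card {b\<in>B. f b = a} = c"
  shows "finite B" "card B = card A * c"
proof -
  have B: "B = (\<Union>a\<in>A. {b\<in>B. f b = a})" using assms(2) by auto
  show "finite B" by (subst B) (use assms in auto)
  have "card (\<Union>a\<in>A. {b\<in>B. f b = a}) = (\<Sum>a\<in>A. card {b\<in>B. f b = a})"
    by (rule card_UN_disjoint) (use assms in auto)
  then show "card B = card A * c" using B assms(4) by simp
qed

lemma idx_eq_cancel: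
  assumes "sbgp N" "sbgp M" "sbgp L" "N \<subseteq> M" "M \<subseteq> L" "idx L N = a * b" "idx L M = a" "a > 0"
  shows "idx M N = b"
  using idx_mult[OF assms(1-5)] assms(6-8) by simp

lemma idx_eq_cancel':
  assumes "sbgp N" "sbgp M" "sbgp L" "N \<subseteq> M" "M \<subseteq> L" "idx L N = a * b" "idx M N = b" "b > 0"
  shows "idx L M = a"
  using idx_mult[OF assms(1-5)] assms(6-8) by simp

lemma idx_eq_imp_eq:
  assumes "sbgp N" "sbgp M" "sbgp L" "N \<subseteq> M" "M \<subseteq> L" "idx L N = idx L M" "idx L M > 0"
  shows "M = N"
proof -
  have "idx M N = 1" using idx_eq_cancel[OF assms(1-5), of "idx L M" 1] assms(6,7) by simp
  then show ?thesis using idx_eq_1_imp assms by blast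
qed

section \<open>Counting neighbouring lattices\<close>

text \<open>A commutative ring in which p has an inverse \<open>u\<close> serves as ambient space:
  it contains p^-1 L along with L. The instance used later is the ring of functions from nat to rat
  with pointwise operations.\<close>

locale p_lattices =
  fixes p n :: nat and u :: "'a::comm_ring_1"
  assumes p: "Factorial_Ring.prime p" and u: "u * of_nat p = 1" and n: "n \<ge> 2"
begin

definition pmul :: "'a set \<Rightarrow> 'a set" where "pmul L = (*) (of_nat p) ` L"
definition pinv :: "'a set \<Rightarrow> 'a set" where "pinv L = (*) u ` L"

text \<open>Stands for "lattice of rank n": only the order of p^-1 L / L enters the counting, and by
  \<open>good_iff\<close> it does not change between commensurable groups.\<close>

definition good :: "'a set \<Rightarrow> bool" where
  "good L \<longleftrightarrow> sbgp L \<and> idx (pinv L) L = p ^ n"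

definition adj :: "'a set \<Rightarrow> 'a set \<Rightarrow> bool" where
  "adj L K \<longleftrightarrow> idx L (L \<inter> K) = p \<and> idx K (L \<inter> K) = p"

text \<open>The flags say whether \<open>L/(L \<inter> K)\<close> and \<open>K/(L \<inter> K)\<close> are elementary abelian.\<close>

definition ty2 :: "bool \<Rightarrow> bool \<Rightarrow> 'a set \<Rightarrow> 'a set \<Rightarrow> bool" where
  "ty2 a b L K \<longleftrightarrow> idx L (L \<inter> K) = p ^ 2 \<and> idx K (L \<inter> K) = p ^ 2 \<and>
     (pmul L \<subseteq> L \<inter> K \<longleftrightarrow> a) \<and> (pmul K \<subseteq> L \<inter> K \<longleftrightarrow> b)"

definition mids :: "'a set \<Rightarrow> 'a set \<Rightarrow> 'a set set" where
  "mids L N = {M. sbgp M \<and> N \<subseteq> M \<and> M \<subseteq> L \<and> idx M N = p}"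

definition covers :: "'a set \<Rightarrow> 'a set set" where
  "covers N = {K. sbgp K \<and> N \<subseteq> K \<and> idx K N = p}"

definition maxs :: "'a set \<Rightarrow> 'a set set" where
  "maxs L = {M. sbgp M \<and> M \<subseteq> L \<and> idx L M = p}"

text \<open>The number of proper intermediate subgroups of an elementary abelian or cyclic group of order \<open>p\<^sup>2\<close>.\<close>

definition mult2 :: "bool \<Rightarrow> nat" where
  "mult2 a = (if a then p + 1 else 1)"

lemma p1: "p > 1" using p by (rule prime_gt_1_nat)

lemma p0: "p > 0" using p1 by simp

lemma u': "of_nat p * (u * x) = x" "u * (of_nat p * x) = x"
proof -
  have "of_nat p * (u * x) = (u * of_nat p) * x" "u * (of_nat p * x) = (u * of_nat p) * x"
    by (simp_all add: ac_simps)
  then show "of_nat p * (u * x) = x" "u * (of_nat p * x) = x" by (simp_all add: u)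
qed

lemma mem_pinv: "x \<in> pinv L \<longleftrightarrow> of_nat p * x \<in> L"
  unfolding pinv_def by (metis image_iff u')

lemma mem_pmul: "x \<in> pmul L \<longleftrightarrow> u * x \<in> L"
  unfolding pmul_def by (metis image_iff u')

lemma pmul_subset_iff: "pmul L \<subseteq> N \<longleftrightarrow> L \<subseteq> pinv N"
  unfolding pmul_def by (auto simp: mem_pinv)

lemma pinv_pmul: "pinv (pmul L) = L"
  by (auto simp: mem_pinv mem_pmul u')

lemma pmul_pinv: "pmul (pinv L) = L"
  by (auto simp: mem_pinv mem_pmul u')

lemma sbgp_pmul: "sbgp L \<Longrightarrow> sbgp (pmul L)"
  unfolding sbgp_def by (auto simp: mem_pmul right_diff_distrib)

lemma sbgp_pinv: "sbgp L \<Longrightarrow> sbgp (pinv L)"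
  unfolding sbgp_def by (auto simp: mem_pinv right_diff_distrib)

lemma pmul_sub: "sbgp L \<Longrightarrow> pmul L \<subseteq> L"
  unfolding pmul_def by (auto intro: sbgp_of_nat_mult)

lemma sub_pinv: "sbgp L \<Longrightarrow> L \<subseteq> pinv L"
  by (auto simp: mem_pinv intro: sbgp_of_nat_mult)

lemma pinv_mono: "A \<subseteq> B \<Longrightarrow> pinv A \<subseteq> pinv B"
  unfolding pinv_def by blast

lemma idx_pmul:
  assumes "sbgp N" "sbgp L" "N \<subseteq> L"
  shows "idx (pmul L) (pmul N) = idx L N"
  unfolding pmul_def
proof (rule idx_image[OF assms(1) _ assms(3) assms(2)])
  show "sbgp ((*) (of_nat p) ` N)" using sbgp_pmul[OF assms(1)] by (simp add: pmul_def)
  show "inj_on ((*) (of_nat p)) L" by (rule inj_onI) (metis u'(2))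
qed (simp add: right_diff_distrib)

lemma idx_pinv:
  assumes "sbgp N" "sbgp L" "N \<subseteq> L"
  shows "idx (pinv L) (pinv N) = idx L N"
  using idx_pmul[of "pinv N" "pinv L"] assms by (simp add: pmul_pinv sbgp_pinv pinv_mono)

text \<open>Multiplication by the index p sends L into N. This confines all groups lying over N with
  index p to the elementary abelian quotient p^-1 N / N.\<close>

lemma sub_pinv_of_idx:
  assumes "sbgp N" "sbgp L" "N \<subseteq> L" "idx L N = p"
  shows "L \<subseteq> pinv N"
  using idx_mult_mem[OF assms(1-3)] assms(4) p0 by (auto simp: mem_pinv)

lemma good_sbgp: "good L \<Longrightarrow> sbgp L" by (simp add: good_def)

text \<open>The index of N in p^-1 L is computed through L and through p^-1 N. Division by p
  preserves the index of N in L, and this finite index cancels.\<close>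

lemma good_iff:
  assumes "sbgp N" "sbgp L" "N \<subseteq> L" "idx L N > 0"
  shows "good N \<longleftrightarrow> good L"
proof -
  have "idx (pinv L) N = idx (pinv L) L * idx L N"
    using assms by (intro idx_mult sbgp_pinv sub_pinv) auto
  moreover have "idx (pinv L) N = idx (pinv L) (pinv N) * idx (pinv N) N"
    using assms by (intro idx_mult sbgp_pinv sub_pinv pinv_mono) auto
  ultimately have "idx (pinv L) L = idx (pinv N) N"
    using idx_pinv[OF assms(1-3)] assms(4) by simp
  then show ?thesis using assms by (simp add: good_def)
qed

lemma card_covers_good:
  assumes "good N"
  shows "card (covers N) = br p n"
proof -
  have N: "sbgp N" using assms good_sbgp by simp
  have "covers N = {K. sbgp K \<and> N \<subseteq> K \<and> K \<subseteq> pinv N \<and> idx K N = p}"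
    unfolding covers_def using sub_pinv_of_idx[OF N] by blast
  also have "card \<dots> = br p n"
    using assms N by (intro card_covers p sbgp_pinv sub_pinv) (auto simp: mem_pinv good_def)
  finally show ?thesis .
qed

lemma card_maxs_good:
  assumes "good L"
  shows "card (maxs L) = br p n"
proof -
  have L: "sbgp L" using assms good_sbgp by simp
  have i: "idx L (pmul L) = p ^ n"
    using idx_pinv[of "pmul L" L] L assms by (simp add: pinv_pmul sbgp_pmul pmul_sub good_def)
  have "maxs L = {M. sbgp M \<and> pmul L \<subseteq> M \<and> M \<subseteq> L \<and> idx L M = p}"
    unfolding maxs_def pmul_subset_iff using sub_pinv_of_idx[OF _ L] by blast
  also have "card \<dots> = br p n"
    using L i by (intro card_maximal p sbgp_pmul pmul_sub) (auto simp: mem_pmul u')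
  finally show ?thesis .
qed

lemma finite_covers: "good N \<Longrightarrow> finite (covers N)"
  using card_covers_good[of N] br_pos[of n p] n by (intro card_ge_0_finite) simp

lemma finite_maxs: "good L \<Longrightarrow> finite (maxs L)"
  using card_maxs_good[of L] br_pos[of n p] n by (intro card_ge_0_finite) simp

text \<open>The condition on K says that K/N is elementary abelian. Such K are the lines of p^-1 N /
  M, a space of dimension n - 1.\<close>

lemma card_covers_elem:
  assumes "good N" "M \<in> covers N"
  shows "card {K \<in> covers M. K \<subseteq> pinv N} = br p (n - 1)"
proof -
  have N: "sbgp N" and M: "sbgp M" "N \<subseteq> M" "idx M N = p"
    using assms good_sbgp by (auto simp: covers_def)
  have Mp: "M \<subseteq> pinv N" using sub_pinv_of_idx N M by simp
  have "idx (pinv N) M = p ^ (n - 1)"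
  proof (rule idx_eq_cancel'[OF N M(1) sbgp_pinv[OF N] M(2) Mp _ M(3) p0])
    have "p ^ n = p ^ (n - 1) * p" using n by (cases n) auto
    then show "idx (pinv N) N = p ^ (n - 1) * p" using assms(1) by (simp add: good_def)
  qed
  then have "card {K. sbgp K \<and> M \<subseteq> K \<and> K \<subseteq> pinv N \<and> idx K M = p} = br p (n - 1)"
    using N M Mp by (intro card_covers p sbgp_pinv) (auto simp: mem_pinv)
  moreover have "{K. sbgp K \<and> M \<subseteq> K \<and> K \<subseteq> pinv N \<and> idx K M = p} = {K \<in> covers M. K \<subseteq> pinv N}"
    by (auto simp: covers_def)
  ultimately show ?thesis by simp
qed

text \<open>Dually, N contains p L exactly when L/N is elementary abelian, and such N are
  hyperplanes of the (n - 1)-dimensional space M / p L.\<close>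

lemma card_maxs_elem:
  assumes "good L" "M \<in> maxs L"
  shows "card {N \<in> maxs M. pmul L \<subseteq> N} = br p (n - 1)"
proof -
  have L: "sbgp L" and M: "sbgp M" "M \<subseteq> L" "idx L M = p"
    using assms good_sbgp by (auto simp: maxs_def)
  have Mp: "pmul L \<subseteq> M" unfolding pmul_subset_iff using sub_pinv_of_idx L M by simp
  have i: "idx L (pmul L) = p ^ n"
    using idx_pinv[of "pmul L" L] L assms by (simp add: pinv_pmul sbgp_pmul pmul_sub good_def)
  have "idx M (pmul L) = p ^ (n - 1)"
  proof (rule idx_eq_cancel[OF sbgp_pmul[OF L] M(1) L Mp M(2) _ M(3) p0])
    have "p ^ n = p * p ^ (n - 1)" using n by (cases n) auto
    then show "idx L (pmul L) = p * p ^ (n - 1)" using i by simp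
  qed
  then have "card {N. sbgp N \<and> pmul L \<subseteq> N \<and> N \<subseteq> M \<and> idx M N = p} = br p (n - 1)"
    using L M Mp by (intro card_maximal p sbgp_pmul) (auto simp: mem_pmul u')
  moreover have "{N. sbgp N \<and> pmul L \<subseteq> N \<and> N \<subseteq> M \<and> idx M N = p} = {N \<in> maxs M. pmul L \<subseteq> N}"
    by (auto simp: maxs_def)
  ultimately show ?thesis by simp
qed

section \<open>Adjacent lattices\<close>

lemma adj_sym: "adj L K \<longleftrightarrow> adj K L"
  unfolding adj_def by (auto simp: Int_commute)

lemma not_adj_refl: "sbgp L \<Longrightarrow> \<not> adj L L"
  unfolding adj_def using idx_refl[of L] p1 by auto

lemma cover_not_sub:
  assumes "sbgp N" "sbgp M" "N \<subseteq> M" "idx M N = p"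
  shows "\<not> M \<subseteq> N"
proof
  assume "M \<subseteq> N"
  then have "M = N" using assms by blast
  then show False using idx_refl assms p1 by (metis less_irrefl)
qed

lemma Int_covers:
  assumes "sbgp N" "sbgp L" "N \<subseteq> L" "M \<in> covers N" "\<not> M \<subseteq> L"
  shows "L \<inter> M = N"
proof -
  have "L \<inter> M = N \<or> L \<inter> M = M"
    using assms by (intro prime_idx_intermediate[OF p]) (auto simp: covers_def intro: sbgp_Int)
  then show ?thesis using assms by blast
qed

lemma adj_covers:
  assumes "sbgp N" "L \<in> covers N" "K \<in> covers N" "K \<noteq> L"
  shows "L \<inter> K = N" "adj L K"
proof -
  have "\<not> K \<subseteq> L"
  proof
    assume "K \<subseteq> L"
    then have "K = N \<or> K = L"
      using assms by (intro prime_idx_intermediate[OF p]) (auto simp: covers_def)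
    then show False using assms cover_not_sub[of N K] by (auto simp: covers_def)
  qed
  then show *: "L \<inter> K = N" using assms Int_covers by (auto simp: covers_def)
  show "adj L K" unfolding adj_def * using assms by (auto simp: covers_def)
qed

lemma adjD:
  assumes "sbgp L" "sbgp K" "adj L K"
  shows "sbgp (L \<inter> K)" "L \<inter> K \<in> maxs L" "L \<inter> K \<in> maxs K" "L \<in> covers (L \<inter> K)" "K \<in> covers (L \<inter> K)" "K \<noteq> L"
proof -
  show "K \<noteq> L" using not_adj_refl assms by blast
qed (use assms sbgp_Int in \<open>auto simp: adj_def maxs_def covers_def\<close>)

lemma good_maxs: "good L \<Longrightarrow> M \<in> maxs L \<Longrightarrow> good M"
  using good_iff[of M L] p0 good_sbgp[of L] by (auto simp: maxs_def)

lemma good_covers: "good N \<Longrightarrow> M \<in> covers N \<Longrightarrow> good M"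
  using good_iff[of N M] p0 good_sbgp[of N] by (auto simp: covers_def)

text \<open>A neighbour is found by choosing N = L \<inter> K among the maximal sublattices of L and
  then K among the covers of N other than L; distinct covers of N automatically meet in N.\<close>

lemma card_adj:
  assumes "good L"
  shows "finite {K. sbgp K \<and> adj L K}" "card {K. sbgp K \<and> adj L K} = br p n * (br p n - 1)"
proof -
  let ?B = "{K. sbgp K \<and> adj L K}"
  have L: "sbgp L" using assms good_sbgp by simp
  have fib: "{K \<in> ?B. L \<inter> K = N} = covers N - {L}" if "N \<in> maxs L" for N
  proof (intro subset_antisym subsetI)
    fix K assume "K \<in> {K \<in> ?B. L \<inter> K = N}"
    then show "K \<in> covers N - {L}" using adjD[OF L, of K] by auto
  next
    fix K assume K: "K \<in> covers N - {L}"
    have N: "sbgp N" "L \<in> covers N" using that L by (auto simp: maxs_def covers_def)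
    then show "K \<in> {K \<in> ?B. L \<inter> K = N}" using adj_covers[OF N, of K] K by (auto simp: covers_def)
  qed
  have cov: "finite (covers N)" "card (covers N - {L}) = br p n - 1" if "N \<in> maxs L" for N
    using card_covers_good finite_covers good_maxs[OF assms that] that L
    by (auto simp: covers_def maxs_def)
  have sub: "(\<lambda>K. L \<inter> K) ` ?B \<subseteq> maxs L" using adjD[OF L] by blast
  note * = card_fibres[OF finite_maxs[OF assms] sub, of "br p n - 1"]
  show "finite ?B" by (rule *(1)) (simp_all only: fib cov finite_Diff)
  have "card ?B = card (maxs L) * (br p n - 1)" by (rule *(2)) (simp_all only: fib cov finite_Diff)
  then show "card ?B = br p n * (br p n - 1)" by (simp add: card_maxs_good assms)
qed

section \<open>Pairs of lattices whose intersection has index p^2\<close>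

lemma mids_alt:
  assumes "sbgp N" "sbgp L" "N \<subseteq> L" "idx L N = p ^ 2"
  shows "mids L N = {M. sbgp M \<and> N \<subseteq> M \<and> M \<subseteq> L \<and> idx L M = p}"
proof -
  have "idx M N = p \<longleftrightarrow> idx L M = p" if "sbgp M" "N \<subseteq> M" "M \<subseteq> L" for M
    using idx_mult[OF assms(1) that(1) assms(2) that(2,3)] assms(4) p0 by (auto simp: power2_eq_square)
  then show ?thesis unfolding mids_def by blast
qed

lemma idx_p2_cases:
  assumes "a * b = p ^ 2"
  shows "(a = 1 \<and> b = p ^ 2) \<or> (a = p \<and> b = p) \<or> (a = p ^ 2 \<and> b = 1)"
proof -
  have "a dvd p ^ 2" using assms by (metis dvd_triv_left)
  then obtain i where i: "i \<le> 2" "a = p ^ i" using divides_primepow_nat[OF p] by blast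
  then consider "i = 0" | "i = 1" | "i = 2" by linarith
  then show ?thesis
    by cases (use assms i p0 in \<open>auto simp: power2_eq_square\<close>)
qed

text \<open>If \<open>L/N\<close> has order \<open>p\<^sup>2\<close> and is not elementary abelian, then it is cyclic and
  \<open>N + pL\<close> is its only proper intermediate subgroup.\<close>

lemma card_mids:
  assumes N: "sbgp N" and L: "sbgp L" and NL: "N \<subseteq> L" and i: "idx L N = p ^ 2"
  shows "card (mids L N) = mult2 (pmul L \<subseteq> N)" "finite (mids L N)"
proof -
  show c: "card (mids L N) = mult2 (pmul L \<subseteq> N)"
  proof (cases "pmul L \<subseteq> N")
    case True
    have "card (mids L N) = br p 2"
      unfolding mids_def using True
      by (intro card_covers p N L NL i) (auto simp: pmul_def)
    then show ?thesis using True by (simp add: mult2_def br_2)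
  next
    case False
    define X where "X = gsum N (pmul L)"
    have X: "sbgp X" "N \<subseteq> X" "pmul L \<subseteq> X" "X \<subseteq> L"
      using sbgp_gsum[OF N sbgp_pmul[OF L]] gsum_upper1[OF sbgp_pmul[OF L], of N]
        gsum_upper2[OF N, of "pmul L"] gsum_least[OF L NL pmul_sub[OF L]]
      by (simp_all add: X_def)
    have XN: "X \<noteq> N" using False X by blast
    have XL: "X \<noteq> L"
    proof
      \<comment> \<open>A Nakayama argument: substituting L = N + p L into p L gives p L = p N + p^2
        L, and both summands lie in N because the index is p^2.\<close>
      assume eq: "X = L"
      have "pmul L \<subseteq> N"
      proof
        fix x assume "x \<in> pmul L"
        then obtain y where y: "y \<in> L" "x = of_nat p * y" unfolding pmul_def by blast
        then obtain m w where m: "m \<in> N" "w \<in> pmul L" "y = m + w"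
          using eq unfolding X_def gsum_def by blast
        then obtain z where z: "z \<in> L" "w = of_nat p * z" unfolding pmul_def by blast
        have "x = of_nat p * m + of_nat (idx L N) * z"
          unfolding y m z i by (simp add: power2_eq_square algebra_simps)
        then show "x \<in> N"
          using sbgp_add[OF N sbgp_of_nat_mult[OF N m(1)] idx_mult_mem[OF N L NL _ z(1)]] i p0
          by simp
      qed
      then show False using False by simp
    qed
    have "idx L X * idx X N = p ^ 2" using idx_mult[OF N X(1) L X(2,4)] i by simp
    then have "idx X N = p"
      using idx_p2_cases idx_eq_1_imp[OF N X(1,2)] idx_eq_1_imp[OF X(1) L X(4)] XN XL by metis
    then have "X \<in> mids L N" using X by (simp add: mids_def)
    moreover have "M = X" if M: "M \<in> mids L N" for M
    proof -
      have M': "sbgp M" "N \<subseteq> M" "M \<subseteq> L" "idx L M = p"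
        using M mids_alt[OF N L NL i] by auto
      have "pmul L \<subseteq> M" unfolding pmul_subset_iff using sub_pinv_of_idx[of M L] M' L by blast
      then have "X \<subseteq> M" unfolding X_def using M' by (intro gsum_least)
      moreover have "idx M N = p" using M by (simp add: mids_def)
      ultimately show "M = X"
        using prime_idx_intermediate[OF p _ N X(1) M'(1) X(2)] XN by blast
    qed
    ultimately have "mids L N = {X}" by blast
    then show ?thesis using False by (simp add: mult2_def)
  qed
  show "finite (mids L N)" by (rule card_ge_0_finite) (simp add: c mult2_def)
qed

definition subs2 :: "bool \<Rightarrow> 'a set \<Rightarrow> 'a set set" where
  "subs2 a L = {N. sbgp N \<and> N \<subseteq> L \<and> idx L N = p ^ 2 \<and> (pmul L \<subseteq> N \<longleftrightarrow> a)}"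

lemma good_subs2: "good L \<Longrightarrow> N \<in> subs2 a L \<Longrightarrow> good N"
  using good_iff[of N L] p0 good_sbgp[of L] by (auto simp: subs2_def)

text \<open>Chains N \<subseteq> M \<subseteq> L with both steps of index p are counted from the top
  and from the bottom. A given N of type \<open>a\<close> lies in \<open>mult2 a\<close> groups M;
  this factor stays on the left so that no division occurs.\<close>

lemma card_subs2:
  assumes "good L"
  shows "finite (subs2 a L)"
    and "card (subs2 a L) * mult2 a = br p n * (if a then br p (n - 1) else br p n - br p (n - 1))"
proof -
  have L: "sbgp L" using assms good_sbgp by simp
  have mids: "{M \<in> maxs L. N \<subseteq> M} = mids L N" if "N \<in> subs2 a L" for N
    using mids_alt[of N L] that L by (auto simp: subs2_def maxs_def)
  have cm: "card (mids L N) = mult2 a" if "N \<in> subs2 a L" for N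
    using card_mids[of N L] that L by (simp add: subs2_def)
  have "subs2 a L \<subseteq> (\<Union>M\<in>maxs L. maxs M)"
  proof
    fix N assume N: "N \<in> subs2 a L"
    then have "card {M \<in> maxs L. N \<subseteq> M} > 0" using cm mids by (simp add: mult2_def)
    then obtain M where M: "M \<in> maxs L" "N \<subseteq> M" by (metis (mono_tags, lifting) card_gt_0_iff equals0I mem_Collect_eq)
    have "idx M N = p"
      using N M p0 L by (intro idx_eq_cancel[of N M L p]) (auto simp: maxs_def subs2_def power2_eq_square)
    then show "N \<in> (\<Union>M\<in>maxs L. maxs M)" using N M by (auto simp: maxs_def subs2_def)
  qed
  moreover have "finite (\<Union>M\<in>maxs L. maxs M)"
    using finite_maxs assms good_maxs by blast
  ultimately show fin: "finite (subs2 a L)" by (rule finite_subset)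
  have "card (maxs L) * (if a then br p (n - 1) else br p n - br p (n - 1)) = card (subs2 a L) * mult2 a"
  proof (rule double_count[OF finite_maxs[OF assms] fin, where R = "\<lambda>M N. N \<subseteq> M"])
    fix N assume "N \<in> subs2 a L"
    then show "card {M \<in> maxs L. N \<subseteq> M} = mult2 a" using mids cm by simp
  next
    fix M assume M: "M \<in> maxs L"
    then have M': "sbgp M" "M \<subseteq> L" "idx L M = p" by (auto simp: maxs_def)
    have idx: "idx M N = p \<longleftrightarrow> idx L N = p ^ 2" if "sbgp N" "N \<subseteq> M" for N
      using idx_mult[OF that(1) M'(1) L that(2) M'(2)] M'(3) p0 by (auto simp: power2_eq_square)
    have eq: "{N \<in> subs2 a L. N \<subseteq> M} = {N \<in> maxs M. pmul L \<subseteq> N \<longleftrightarrow> a}"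
      unfolding subs2_def maxs_def using idx M' by auto
    show "card {N \<in> subs2 a L. N \<subseteq> M} = (if a then br p (n - 1) else br p n - br p (n - 1))"
    proof (cases a)
      case True
      then show ?thesis using eq card_maxs_elem[OF assms M] by simp
    next
      case False
      have "{N \<in> maxs M. \<not> pmul L \<subseteq> N} = maxs M - {N \<in> maxs M. pmul L \<subseteq> N}" by blast
      then have "card {N \<in> maxs M. \<not> pmul L \<subseteq> N} = card (maxs M) - card {N \<in> maxs M. pmul L \<subseteq> N}"
        using finite_maxs[OF good_maxs[OF assms M]] by (simp add: card_Diff_subset)
      then show ?thesis
        using eq False card_maxs_elem[OF assms M] card_maxs_good[OF good_maxs[OF assms M]] by simp
    qed
  qed
  then show "card (subs2 a L) * mult2 a = br p n * (if a then br p (n - 1) else br p n - br p (n - 1))"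
    using card_maxs_good[OF assms] by simp
qed

text \<open>Among the subgroups covering \<open>M\<close>, those meeting \<open>L\<close> in more than \<open>N\<close> are the sums of \<open>M\<close>
  with a subgroup lying between \<open>N\<close> and \<open>L\<close>.\<close>

lemma covers_meeting:
  assumes N: "sbgp N" and L: "sbgp L" and NL: "N \<subseteq> L"
    and M: "M \<in> covers N" "\<not> M \<subseteq> L"
  shows "bij_betw (gsum M) (mids L N) {K \<in> covers M. L \<inter> K \<noteq> N}"
    and "{K \<in> covers M. L \<inter> K \<noteq> N} \<subseteq> {K \<in> covers M. K \<subseteq> pinv N}"
proof -
  have M': "sbgp M" "N \<subseteq> M" "idx M N = p" using M by (auto simp: covers_def)
  have LM: "L \<inter> M = N" using Int_covers[OF N L NL M] .
  have int: "L \<inter> gsum M X = X" if "X \<in> mids L N" for X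
  proof
    have X: "sbgp X" "N \<subseteq> X" "X \<subseteq> L" using that by (auto simp: mids_def)
    show "L \<inter> gsum M X \<subseteq> X"
    proof
      fix x assume x: "x \<in> L \<inter> gsum M X"
      then obtain a b where ab: "a \<in> M" "b \<in> X" "x = a + b" unfolding gsum_def by blast
      then have "a = x - b" by simp
      then have "a \<in> L" using x ab X sbgp_diff[OF L] by blast
      then have "a \<in> X" using LM ab X by blast
      then show "x \<in> X" using ab sbgp_add[OF X(1)] by simp
    qed
    show "X \<subseteq> L \<inter> gsum M X" using gsum_upper2[OF M'(1)] X by blast
  qed
  have fwd: "gsum M X \<in> {K \<in> covers M. L \<inter> K \<noteq> N}" if X: "X \<in> mids L N" for X
  proof -
    have X': "sbgp X" "N \<subseteq> X" "X \<subseteq> L" "idx X N = p" using X by (auto simp: mids_def)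
    have "M \<inter> X = N" using LM X' M' by blast
    then have "idx (gsum M X) M = p" using idx_gsum[OF M'(1) X'(1)] X' by simp
    moreover have "X \<noteq> N" using cover_not_sub[OF N X'(1,2,4)] by blast
    ultimately show ?thesis
      using int[OF X] sbgp_gsum[OF M'(1) X'(1)] gsum_upper1[OF X'(1)] by (simp add: covers_def)
  qed
  have bwd: "L \<inter> K \<in> mids L N \<and> gsum M (L \<inter> K) = K" if K: "K \<in> {K \<in> covers M. L \<inter> K \<noteq> N}" for K
  proof -
    have K': "sbgp K" "M \<subseteq> K" "idx K M = p" "L \<inter> K \<noteq> N" using K by (auto simp: covers_def)
    define X where "X = L \<inter> K"
    have X: "sbgp X" "N \<subseteq> X" "X \<subseteq> K" "X \<subseteq> L" "X \<noteq> N"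
      using sbgp_Int[OF L K'(1)] K'(2,4) M'(2) NL by (auto simp: X_def)
    have "idx K N = p ^ 2" using idx_mult[OF N M'(1) K'(1) M'(2) K'(2)] M' K' by (simp add: power2_eq_square)
    then have "idx K X * idx X N = p ^ 2" using idx_mult[OF N X(1) K'(1) X(2,3)] by simp
    moreover have "X \<noteq> K" using M K' X by blast
    ultimately have i: "idx X N = p"
      using idx_p2_cases idx_eq_1_imp[OF N X(1,2)] idx_eq_1_imp[OF X(1) K'(1) X(3)] X(5) by metis
    \<comment> \<open>M + X lies between M and K, where the index is p. It cannot be M, since then X
      would lie in L \<inter> M = N.\<close>
    have "gsum M X = M \<or> gsum M X = K"
      by (rule prime_idx_intermediate[OF p K'(3) M'(1) sbgp_gsum[OF M'(1) X(1)] K'(1)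
            gsum_upper1[OF X(1)] gsum_least[OF K'(1,2) X(3)]])
    moreover have "gsum M X \<noteq> M"
    proof
      assume "gsum M X = M"
      then have "X \<subseteq> M" using gsum_upper2[OF M'(1), of X] by simp
      then show False using LM X by blast
    qed
    ultimately have "gsum M X = K" by blast
    then show ?thesis using i X by (auto simp: mids_def X_def)
  qed
  show "bij_betw (gsum M) (mids L N) {K \<in> covers M. L \<inter> K \<noteq> N}"
    by (rule bij_betw_byWitness[where f' = "\<lambda>K. L \<inter> K"]) (use int fwd bwd in blast)+
  show "{K \<in> covers M. L \<inter> K \<noteq> N} \<subseteq> {K \<in> covers M. K \<subseteq> pinv N}"
  proof
    fix K assume K: "K \<in> {K \<in> covers M. L \<inter> K \<noteq> N}"
    have X: "sbgp (L \<inter> K)" "N \<subseteq> L \<inter> K" "idx (L \<inter> K) N = p"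
      using bwd[OF K] by (auto simp: mids_def)
    have "gsum M (L \<inter> K) \<subseteq> pinv N"
      by (intro gsum_least sbgp_pinv N sub_pinv_of_idx M' X)
    then show "K \<in> {K \<in> covers M. K \<subseteq> pinv N}" using bwd[OF K] K by simp
  qed
qed

text \<open>Again chains N \<subseteq> M \<subseteq> K are counted, starting with those covers M of
  N that lie outside L. Of the covers of M, the ones meeting L in more than N must be excluded; by
  \<open>covers_meeting\<close> there are \<open>mult2 a\<close> of them, all inside p^-1 N. Hence
  this correction affects the elementary abelian count only.\<close>

lemma card_complements:
  fixes a b :: bool
  assumes gN: "good N" and L: "sbgp L" and NL: "N \<subseteq> L" and i: "idx L N = p ^ 2"
    and a: "pmul L \<subseteq> N \<longleftrightarrow> a"
  defines "C \<equiv> {K. sbgp K \<and> N \<subseteq> K \<and> idx K N = p ^ 2 \<and> L \<inter> K = N \<and> (pmul K \<subseteq> N \<longleftrightarrow> b)}"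
  shows "finite C"
    and "card C * mult2 b = (br p n - mult2 a) *
      (if b then br p (n - 1) - mult2 a else br p n - br p (n - 1))"
proof -
  have N: "sbgp N" using gN good_sbgp by simp
  define V where "V = {M \<in> covers N. \<not> M \<subseteq> L}"
  have finV: "finite V" unfolding V_def using finite_covers[OF gN] by simp
  have cV: "card V = br p n - mult2 a"
  proof -
    have "V = covers N - mids L N" unfolding V_def covers_def mids_def by blast
    moreover have "mids L N \<subseteq> covers N" unfolding covers_def mids_def by blast
    ultimately show ?thesis
      using card_mids[OF N L NL i] a card_covers_good[OF gN] by (simp add: card_Diff_subset)
  qed
  have mids: "{M \<in> V. M \<subseteq> K} = mids K N" if "K \<in> C" for K
  proof (intro subset_antisym subsetI)
    fix M assume M: "M \<in> mids K N"
    then have M': "sbgp M" "N \<subseteq> M" "M \<subseteq> K" "idx M N = p" by (auto simp: mids_def)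
    have "\<not> M \<subseteq> L" using cover_not_sub[OF N M'(1,2,4)] that M' by (auto simp: C_def)
    then show "M \<in> {M \<in> V. M \<subseteq> K}" using M' by (simp add: V_def covers_def)
  qed (auto simp: V_def covers_def mids_def)
  have cm: "card (mids K N) = mult2 b" if "K \<in> C" for K
    using card_mids[of N K] that N by (simp add: C_def)
  have idx: "idx K N = p ^ 2 \<longleftrightarrow> idx K M = p" if "M \<in> V" "sbgp K" "M \<subseteq> K" for K M
    using idx_mult[of N M K] that N p0 by (auto simp: V_def covers_def power2_eq_square)
  have "C \<subseteq> (\<Union>M\<in>V. covers M)"
  proof
    fix K assume K: "K \<in> C"
    then have "card {M \<in> V. M \<subseteq> K} > 0" using cm mids by (simp add: mult2_def)
    then obtain M where M: "M \<in> V" "M \<subseteq> K" by (metis (mono_tags, lifting) card_gt_0_iff equals0I mem_Collect_eq)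
    then show "K \<in> (\<Union>M\<in>V. covers M)" using idx[of M K] K by (auto simp: covers_def C_def)
  qed
  moreover have "finite (\<Union>M\<in>V. covers M)"
    using finV finite_covers good_covers[OF gN] by (auto simp: V_def)
  ultimately show fin: "finite C" by (rule finite_subset)
  have "card V * (if b then br p (n - 1) - mult2 a else br p n - br p (n - 1)) = card C * mult2 b"
  proof (rule double_count[OF finV fin, where R = "\<lambda>M K. M \<subseteq> K"])
    fix K assume "K \<in> C"
    then show "card {M \<in> V. M \<subseteq> K} = mult2 b" using mids cm by simp
  next
    fix M assume M: "M \<in> V"
    then have M': "M \<in> covers N" "\<not> M \<subseteq> L" by (auto simp: V_def)
    have NM: "N \<subseteq> M" using M' by (simp add: covers_def)
    have gM: "good M" using good_covers[OF gN M'(1)] .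
    let ?X = "{K \<in> covers M. L \<inter> K \<noteq> N}" and ?E = "{K \<in> covers M. K \<subseteq> pinv N}"
    note cX = covers_meeting[OF N L NL M']
    have cardX: "card ?X = mult2 a"
      using bij_betw_same_card[OF cX(1)] card_mids[OF N L NL i] a by simp
    have finE: "finite ?E" using finite_covers[OF gM] by simp
    have cardE: "card ?E = br p (n - 1)" using card_covers_elem[OF gN M'(1)] .
    show "card {K \<in> C. M \<subseteq> K} = (if b then br p (n - 1) - mult2 a else br p n - br p (n - 1))"
    proof (cases b)
      case True
      have "{K \<in> C. M \<subseteq> K} = ?E - ?X"
        unfolding C_def covers_def pmul_subset_iff using True idx[OF M] NM by auto
      then show ?thesis
        using True card_Diff_subset[OF finite_subset[OF cX(2) finE] cX(2)] cardX cardE by simp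
    next
      case False
      have "{K \<in> C. M \<subseteq> K} = {K \<in> covers M. L \<inter> K = N \<and> \<not> K \<subseteq> pinv N}"
        unfolding C_def covers_def pmul_subset_iff using False idx[OF M] NM by auto
      \<comment> \<open>A cover of M that is not contained in p^-1 N meets L in N alone, so one
        condition implies the other.\<close>
      also have "\<dots> = covers M - ?E" using cX(2) by blast
      finally show ?thesis
        using False card_Diff_subset[OF finE, of "covers M"] cardE card_covers_good[OF gM] by auto
    qed
  qed
  then show "card C * mult2 b = (br p n - mult2 a) *
      (if b then br p (n - 1) - mult2 a else br p n - br p (n - 1))"
    using cV by simp
qed

text \<open>The lattices K are sorted by N = L \<inter> K. Over each N of type \<open>a\<close> the
  fibre is the set counted in \<open>card_complements\<close>, whose size does not depend on
  N.\<close>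

lemma card_ty2:
  assumes "good L"
  shows "finite {K. sbgp K \<and> ty2 a b L K}"
    and "card {K. sbgp K \<and> ty2 a b L K} * (mult2 a * mult2 b) =
      br p n * (if a then br p (n - 1) else br p n - br p (n - 1)) *
      ((br p n - mult2 a) * (if b then br p (n - 1) - mult2 a else br p n - br p (n - 1)))"
proof -
  let ?B = "{K. sbgp K \<and> ty2 a b L K}"
  let ?c = "(br p n - mult2 a) * (if b then br p (n - 1) - mult2 a else br p n - br p (n - 1))"
  have L: "sbgp L" using assms good_sbgp by simp
  define C where "C N = {K. sbgp K \<and> N \<subseteq> K \<and> idx K N = p ^ 2 \<and> L \<inter> K = N \<and> (pmul K \<subseteq> N \<longleftrightarrow> b)}" for N
  have fib: "{K \<in> ?B. L \<inter> K = N} = C N" if "N \<in> subs2 a L" for N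
    using that unfolding C_def ty2_def subs2_def by auto
  have C: "finite (C N)" "card (C N) * mult2 b = ?c" if "N \<in> subs2 a L" for N
  proof -
    note * = card_complements[OF good_subs2[OF assms that] L, of a b, folded C_def]
    show "finite (C N)" "card (C N) * mult2 b = ?c"
      using * that by (auto simp: subs2_def)
  qed
  have m: "mult2 b > 0" by (simp add: mult2_def)
  have C': "card (C N) = ?c div mult2 b" if "N \<in> subs2 a L" for N
    using C(2)[OF that] m by (metis nonzero_mult_div_cancel_right less_irrefl)
  have sub: "(\<lambda>K. L \<inter> K) ` ?B \<subseteq> subs2 a L" unfolding ty2_def subs2_def using L sbgp_Int by auto
  note * = card_fibres[OF card_subs2(1)[OF assms] sub, of "?c div mult2 b"]
  show "finite ?B" by (rule *(1)) (simp_all only: fib C C')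
  have eq: "card ?B = card (subs2 a L) * (?c div mult2 b)" by (rule *(2)) (simp_all only: fib C C')
  show "card ?B * (mult2 a * mult2 b) =
      br p n * (if a then br p (n - 1) else br p n - br p (n - 1)) * ?c"
  \<comment> \<open>The quotient by \<open>mult2 b\<close> is known to be exact only when some fibre
    exists; with no N at all, \<open>card_subs2\<close> makes the right-hand side vanish.\<close>
  proof (cases "subs2 a L = {}")
    case True
    then show ?thesis using eq card_subs2(2)[OF assms, of a] by auto
  next
    case False
    then have c: "?c div mult2 b * mult2 b = ?c" using C C' by (metis ex_in_conv)
    have "card ?B * (mult2 a * mult2 b) = (card (subs2 a L) * mult2 a) * (?c div mult2 b * mult2 b)"
      unfolding eq by (simp only: ac_simps)
    then show ?thesis unfolding c card_subs2(2)[OF assms] .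
  qed
qed

text \<open>The sum of L \<inter> M and M \<inter> K lies between the first of them and M, where the
  index is p. So either the two intersections coincide (index 1 over X), or together they span M
  (index p over X). The remaining indices follow by multiplicativity.\<close>

lemma adj_IntD:
  assumes L: "sbgp L" "sbgp M" "sbgp K" and LM: "adj L M" and MK: "adj M K"
  defines "X \<equiv> L \<inter> M \<inter> K"
  shows "sbgp X" "idx (L \<inter> M) X = idx (M \<inter> K) X" "idx (L \<inter> M) X \<in> {1, p}"
    and "idx L X = p * idx (L \<inter> M) X" "idx K X = p * idx (L \<inter> M) X" "idx M X = p * idx (L \<inter> M) X"
    and "idx (L \<inter> M) X = p \<Longrightarrow> gsum (L \<inter> M) (M \<inter> K) = M"
proof -
  define A B where "A = L \<inter> M" and "B = M \<inter> K"
  have s: "sbgp A" "sbgp B" "sbgp X" using L by (auto simp: A_def B_def X_def intro: sbgp_Int)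
  have i: "idx L A = p" "idx M A = p" "idx M B = p" "idx K B = p"
    using LM MK by (auto simp: adj_def A_def B_def Int_commute)
  have sub: "X \<subseteq> A" "X \<subseteq> B" "A \<subseteq> L" "A \<subseteq> M" "B \<subseteq> M" "B \<subseteq> K" by (auto simp: A_def B_def X_def)
  have X: "A \<inter> B = X" by (auto simp: A_def B_def X_def)
  have "p * idx A X = p * idx B X"
    using idx_mult[OF s(3,1) L(2) sub(1,4)] idx_mult[OF s(3,2) L(2) sub(2,5)] i by metis
  then have AB: "idx A X = idx B X" using p0 by (metis nat_mult_eq_cancel1)
  define S where "S = gsum A B"
  have S: "sbgp S" "A \<subseteq> S" "S \<subseteq> M"
    using sbgp_gsum[OF s(1,2)] gsum_upper1[OF s(2), of A] gsum_least[OF L(2) sub(4,5)]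
    by (simp_all add: S_def)
  have iS: "idx S A = idx B X" unfolding S_def using idx_gsum[OF s(1,2)] X by simp
  have m: "idx M S * idx S A = p" using idx_mult[OF s(1) S(1) L(2) S(2,3)] i by simp
  then have "idx S A dvd p" by (metis dvd_triv_right)
  then have "idx S A = 1 \<or> idx S A = p" using p by (simp add: prime_nat_iff)
  then show "idx (L \<inter> M) X \<in> {1, p}" unfolding A_def[symmetric] AB iS by blast
  show "sbgp X" "idx (L \<inter> M) X = idx (M \<inter> K) X" using s AB by (auto simp: A_def B_def)
  show "idx L X = p * idx (L \<inter> M) X" "idx K X = p * idx (L \<inter> M) X" "idx M X = p * idx (L \<inter> M) X"
    using idx_mult[OF s(3,1) L(1) sub(1,3)] idx_mult[OF s(3,2) L(3) sub(2,6)]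
      idx_mult[OF s(3,1) L(2) sub(1,4)] i AB unfolding A_def[symmetric] by simp_all
  assume "idx (L \<inter> M) X = p"
  then have "idx M S = 1" using m iS AB p0 unfolding A_def[symmetric] by simp
  then show "gsum (L \<inter> M) (M \<inter> K) = M"
    using idx_eq_1_imp[OF S(1) L(2) S(3)] by (simp add: S_def A_def B_def)
qed

section \<open>Common neighbours of two lattices\<close>

definition common :: "'a set \<Rightarrow> 'a set \<Rightarrow> 'a set set" where
  "common L K = {M. sbgp M \<and> adj L M \<and> adj M K}"

text \<open>Since X \<subseteq> N, the indices of N in L and in K both equal p t divided by the
  index of X in N. They therefore agree and divide p^2, and the exponents 0, 1 and 2 give the three
  cases.\<close>

lemma two_step_cases:
  assumes L: "sbgp L" "sbgp K" and M: "M \<in> common L K"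
  shows "K = L \<or> adj L K \<or> (\<exists>a b. ty2 a b L K)"
proof -
  define X N where "X = L \<inter> M \<inter> K" and "N = L \<inter> K"
  define t where "t = idx (L \<inter> M) X"
  have M': "sbgp M" "adj L M" "adj M K" using M by (auto simp: common_def)
  note * = adj_IntD[OF L(1) M'(1) L(2) M'(2,3), folded X_def t_def]
  have N: "sbgp N" "X \<subseteq> N" "N \<subseteq> L" "N \<subseteq> K" unfolding N_def X_def using L sbgp_Int by auto
  have e: "idx L N * idx N X = p * t" "idx K N * idx N X = p * t"
    using idx_mult[OF *(1) N(1) L(1) N(2,3)] idx_mult[OF *(1) N(1) L(2) N(2,4)] *(4,5) by metis+
  have t: "t = 1 \<or> t = p" using *(3) by simp
  have "p * t > 0" using p0 t by auto
  then have "idx N X > 0" using e(1) by (metis mult_0_right gr0I less_irrefl)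
  then have LK: "idx L N = idx K N" using e by (metis mult_cancel2 less_irrefl)
  have "idx L N dvd p ^ 2"
  proof -
    have "p * t dvd p ^ 2" using t by (auto simp: power2_eq_square)
    then show ?thesis using e(1) by (metis dvd_mult_left)
  qed
  then obtain i where i: "i \<le> 2" "idx L N = p ^ i" using divides_primepow_nat[OF p] by blast
  then consider "i = 0" | "i = 1" | "i = 2" by linarith
  then show ?thesis
  proof cases
    case 1
    then have "L = N" "K = N"
      using i LK idx_eq_1_imp[OF N(1) L(1) N(3)] idx_eq_1_imp[OF N(1) L(2) N(4)] by auto
    then show ?thesis by simp
  next
    case 2
    then have "idx L N = p" "idx K N = p" using i LK by auto
    then show ?thesis unfolding adj_def N_def[symmetric] by blast
  next
    case 3
    then show ?thesis using i LK by (auto simp: ty2_def N_def)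
  qed
qed

lemma common_refl: "common L L = {M. sbgp M \<and> adj L M}"
  unfolding common_def using adj_sym by blast

text \<open>Common neighbours are the sums A + B of a group A halfway between N and L and a group B
  halfway between N and K, chosen independently. The inverse map intersects M with L and with
  K.\<close>

lemma card_common_ty2:
  assumes L: "sbgp L" "sbgp K" and ty: "ty2 a b L K"
  shows "card (common L K) = mult2 a * mult2 b"
proof -
  define N where "N = L \<inter> K"
  have N: "sbgp N" "N \<subseteq> L" "N \<subseteq> K" "idx L N = p ^ 2" "idx K N = p ^ 2"
    using L ty sbgp_Int by (auto simp: N_def ty2_def)
  have NX: "N \<subseteq> C" if "C \<in> mids Z N" for C Z using that by (auto simp: mids_def)
  have int: "gsum A B \<inter> L = A" "gsum A B \<inter> K = B" "A \<inter> B = N"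
    if "A \<in> mids L N" "B \<in> mids K N" for A B
  proof -
    have A: "sbgp A" "N \<subseteq> A" "A \<subseteq> L" and B: "sbgp B" "N \<subseteq> B" "B \<subseteq> K"
      using that by (auto simp: mids_def)
    show "A \<inter> B = N" using A B by (auto simp: N_def)
    have "x \<in> A" if x: "x \<in> gsum A B" "x \<in> L" for x
    proof -
      obtain y z where yz: "y \<in> A" "z \<in> B" "x = y + z" using x(1) unfolding gsum_def by blast
      then have "z = x - y" by simp
      then have "z \<in> N" using yz A B sbgp_diff[OF L(1) x(2), of y] by (auto simp: N_def)
      then show "x \<in> A" using yz A sbgp_add[OF A(1)] by blast
    qed
    then show "gsum A B \<inter> L = A" using gsum_upper1[OF B(1), of A] A by blast
    have "x \<in> B" if x: "x \<in> gsum A B" "x \<in> K" for x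
    proof -
      obtain y z where yz: "y \<in> A" "z \<in> B" "x = y + z" using x(1) unfolding gsum_def by blast
      then have "y = x - z" by simp
      then have "y \<in> N" using yz A B sbgp_diff[OF L(2) x(2), of z] by (auto simp: N_def)
      then show "x \<in> B" using yz B sbgp_add[OF B(1)] by blast
    qed
    then show "gsum A B \<inter> K = B" using gsum_upper2[OF A(1), of B] B by blast
  qed
  have fwd: "gsum A B \<in> common L K" if AB: "A \<in> mids L N" "B \<in> mids K N" for A B
  proof -
    have A: "sbgp A" "N \<subseteq> A" "A \<subseteq> L" "idx A N = p" "idx L A = p"
      and B: "sbgp B" "N \<subseteq> B" "B \<subseteq> K" "idx B N = p" "idx K B = p"
      using AB mids_alt[OF N(1) L(1) N(2,4)] mids_alt[OF N(1) L(2) N(3,5)] by (auto simp: mids_def)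
    have i: "idx (gsum A B) A = p" using idx_gsum[OF A(1) B(1)] int(3)[OF AB] B by simp
    have "idx (gsum B A) B = p" using idx_gsum[OF B(1) A(1)] int(3)[OF AB] A by (simp add: Int_commute)
    then have "idx (gsum A B) B = p" by (simp add: gsum_comm)
    then show ?thesis
      unfolding common_def adj_def using i int[OF AB] A B sbgp_gsum by (auto simp: Int_commute)
  qed
  have bwd: "L \<inter> M \<in> mids L N" "M \<inter> K \<in> mids K N" "gsum (L \<inter> M) (M \<inter> K) = M"
    if M: "M \<in> common L K" for M
  proof -
    define X where "X = L \<inter> M \<inter> K"
    define t where "t = idx (L \<inter> M) X"
    have M': "sbgp M" "adj L M" "adj M K" using M by (auto simp: common_def)
    note * = adj_IntD[OF L(1) M'(1) L(2) M'(2,3), folded X_def t_def]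
    have X: "X \<subseteq> N" unfolding X_def N_def by blast
    have e: "p ^ 2 * idx N X = p * t" using idx_mult[OF *(1) N(1) L(1) X N(2)] N *(4) by simp
    then have e': "p * idx N X = t" using p0 by (simp add: power2_eq_square)
    \<comment> \<open>Of the two possible values of \<open>t\<close> only p is a multiple of p. It
      follows that X = N, that is, M contains L \<inter> K.\<close>
    have "t \<noteq> 1" using e' p1 by (metis nat_mult_eq_1_iff less_irrefl)
    then have t: "t = p" using *(3) by simp
    then have "idx N X = 1" using e' p0 by simp
    then have NX: "N = X" using idx_eq_1_imp[OF *(1) N(1) X] by simp
    show "gsum (L \<inter> M) (M \<inter> K) = M" using *(7) t by simp
    have i: "idx (L \<inter> M) N = p" "idx (M \<inter> K) N = p"
      using *(2) t t_def NX by metis+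
    have "N \<subseteq> M" using NX X_def by blast
    then show "L \<inter> M \<in> mids L N" "M \<inter> K \<in> mids K N"
      using i N(2,3) sbgp_Int[OF L(1) M'(1)] sbgp_Int[OF M'(1) L(2)] by (auto simp: mids_def)
  qed
  have "bij_betw (\<lambda>(A, B). gsum A B) (mids L N \<times> mids K N) (common L K)"
    by (rule bij_betw_byWitness[where f' = "\<lambda>M. (L \<inter> M, M \<inter> K)"])
      (use int fwd bwd in \<open>auto simp: Int_commute\<close>)
  then have "card (common L K) = card (mids L N) * card (mids K N)"
    using bij_betw_same_card card_cartesian_product by metis
  moreover have "card (mids L N) = mult2 a" "card (mids K N) = mult2 b"
    using card_mids[OF N(1) L(1) N(2,4)] card_mids[OF N(1) L(2) N(3,5)] ty
    by (simp_all add: ty2_def N_def)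
  ultimately show ?thesis by simp
qed

text \<open>A common neighbour of adjacent \<open>L\<close> and \<open>K\<close> contains \<open>L \<inter> K\<close> or is contained in \<open>L + K\<close>.\<close>

lemma card_common_adj:
  assumes g: "good L" and L: "sbgp K" and LK: "adj L K"
  shows "card (common L K) + (p + 3) = 2 * br p n"
proof -
  define N S where "N = L \<inter> K" and "S = gsum L K"
  have L': "sbgp L" using g good_sbgp by simp
  have N: "sbgp N" "N \<subseteq> L" "N \<subseteq> K" "idx L N = p" "idx K N = p" "L \<noteq> K" "L \<in> covers N" "K \<in> covers N"
    using adjD[OF L' L LK] LK by (auto simp: N_def adj_def)
  have S: "sbgp S" "L \<subseteq> S" "K \<subseteq> S" "idx S L = p" "idx S K = p"
  proof -
    show "sbgp S" "L \<subseteq> S" "K \<subseteq> S"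
      unfolding S_def using sbgp_gsum[OF L' L] gsum_upper1[OF L] gsum_upper2[OF L'] by simp_all
    show "idx S L = p" unfolding S_def using idx_gsum[OF L' L] N(5) by (simp add: N_def)
    show "idx S K = p" unfolding S_def gsum_comm[of L K]
      using idx_gsum[OF L L'] N(4) by (simp add: N_def Int_commute)
  qed
  have gN: "good N" using good_iff[OF N(1) L' N(2)] g N p0 by simp
  have gS: "good S" using good_iff[OF L' S(1,2)] g S p0 by simp
  have SN: "idx S N = p ^ 2" using idx_mult[OF N(1) L' S(1) N(2) S(2)] S N by (simp add: power2_eq_square)
  have Lm: "L \<in> maxs S" "K \<in> maxs S" using L L' S by (auto simp: maxs_def)
  \<comment> \<open>\<open>U\<close> collects the neighbours above L \<inter> K and \<open>W\<close>
    those inside L + K, in both cases without L and K themselves.\<close>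
  define U W where "U = covers N - {L, K}" and "W = maxs S - {L, K}"
  have fin: "finite U" "finite W" unfolding U_def W_def using finite_covers[OF gN] finite_maxs[OF gS] by auto
  have cU: "card U + 2 = br p n"
  proof -
    have "card (covers N) = card {L, K} + card U"
      unfolding U_def using N finite_covers[OF gN] card_mono[of "covers N" "{L, K}"] by (simp add: card_Diff_subset)
    then show ?thesis using N card_covers_good[OF gN] by simp
  qed
  have cW: "card W + 2 = br p n"
  proof -
    have "card (maxs S) = card {L, K} + card W"
      unfolding W_def using Lm N finite_maxs[OF gS] card_mono[of "maxs S" "{L, K}"] by (simp add: card_Diff_subset)
    then show ?thesis using N card_maxs_good[OF gS] by simp
  qed
  have "U \<inter> W = mids S N - {L, K}"
    unfolding U_def W_def using mids_alt[OF N(1) S(1) _ SN] N(2) S(2)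
    by (auto simp: covers_def maxs_def mids_def)
  moreover have "{L, K} \<subseteq> mids S N" using L L' N S by (auto simp: mids_def)
  \<comment> \<open>L and K both lie in p^-1 N, hence so does L + K, and the quotient of order p^2
    is elementary abelian.\<close>
  moreover have "card (mids S N) = p + 1"
  proof -
    have "S \<subseteq> pinv N" unfolding S_def
      by (intro gsum_least sbgp_pinv N sub_pinv_of_idx L L')
    then show ?thesis using card_mids(1)[OF N(1) S(1) _ SN] N S by (auto simp: mult2_def pmul_subset_iff)
  qed
  moreover have "finite (mids S N)" using card_mids(2)[OF N(1) S(1) _ SN] N S by blast
  ultimately have cUW: "card (U \<inter> W) = p - 1" using N(6) by (simp add: card_Diff_subset)
  have "common L K = U \<union> W"
  proof (intro subset_antisym subsetI)
    fix M assume M: "M \<in> U \<union> W"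
    show "M \<in> common L K"
    proof (cases "M \<in> U")
      case True
      then have "M \<in> covers N" "M \<noteq> L" "M \<noteq> K" by (auto simp: U_def)
      then show ?thesis using adj_covers[OF N(1)] N(7,8) by (auto simp: common_def covers_def)
    next
      case False
      then have M': "M \<in> maxs S" "M \<noteq> L" "M \<noteq> K" using M by (auto simp: W_def)
      have adj: "adj Z M" if Z: "Z \<in> maxs S" "M \<noteq> Z" for Z
      proof -
        have ZM: "sbgp Z" "sbgp M" "Z \<subseteq> S" "M \<subseteq> S" "idx S Z = p" "idx S M = p"
          using Z M' by (auto simp: maxs_def)
        have 1: "Z \<subseteq> gsum Z M" "gsum Z M \<subseteq> S" "sbgp (gsum Z M)" "M \<subseteq> gsum Z M"
          using gsum_upper1[OF ZM(2), of Z] gsum_upper2[OF ZM(1), of M] gsum_least[OF S(1) ZM(3,4)]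
            sbgp_gsum[OF ZM(1,2)] by simp_all
        have "gsum Z M = Z \<or> gsum Z M = S" using prime_idx_intermediate[OF p ZM(5,1) 1(3) S(1) 1(1,2)] .
        moreover have "gsum Z M = M \<or> gsum Z M = S" using prime_idx_intermediate[OF p ZM(6,2) 1(3) S(1) 1(4,2)] .
        ultimately have "gsum Z M = S" using Z(2) by blast
        then show "adj Z M" unfolding adj_def
          using idx_gsum[OF ZM(1,2)] idx_gsum[OF ZM(2,1)] ZM by (simp add: Int_commute gsum_comm)
      qed
      show ?thesis unfolding common_def using adj[OF Lm(1)] adj[OF Lm(2)] M' adj_sym by (auto simp: maxs_def)
    qed
  next
    fix M assume M: "M \<in> common L K"
    then have M': "sbgp M" "adj L M" "adj M K" by (auto simp: common_def)
    define X where "X = L \<inter> M \<inter> K"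
    define t where "t = idx (L \<inter> M) X"
    note * = adj_IntD[OF L' M'(1) L M'(2,3), folded X_def t_def]
    have ne: "M \<noteq> L" "M \<noteq> K" using M' not_adj_refl by auto
    show "M \<in> U \<union> W"
    proof (cases "N \<subseteq> M")
      case True
      have "idx L N = idx L (L \<inter> M)" using M' N by (simp add: adj_def)
      then have "L \<inter> M = N"
        using idx_eq_imp_eq[OF N(1) sbgp_Int[OF L' M'(1)] L'] True N p0 by auto
      then have "M \<in> covers N" using M' True by (auto simp: adj_def covers_def)
      then show ?thesis using ne by (simp add: U_def)
    next
      case False
      \<comment> \<open>With t = 1 the group M \<inter> K would lie in N and have the same index in
        K, so N = M \<inter> K would be contained in M.\<close>
      have "t \<noteq> 1"
      proof
        assume t: "t = 1"
        then have "M \<inter> K = X"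
          using *(2) idx_eq_1_imp[OF *(1) sbgp_Int[OF M'(1) L]] by (auto simp: X_def)
        then have sub: "M \<inter> K \<subseteq> N" by (auto simp: X_def N_def)
        have "idx K (M \<inter> K) = idx K N" using M' N by (simp add: adj_def)
        then have "N = M \<inter> K"
          using idx_eq_imp_eq[OF sbgp_Int[OF M'(1) L] N(1) L sub N(3)] N p0 by simp
        then show False using False by blast
      qed
      then have t: "t = p" using *(3) by simp
      then have "gsum (L \<inter> M) (M \<inter> K) = M" using *(7) by simp
      moreover have "gsum (L \<inter> M) (M \<inter> K) \<subseteq> S" using S by (intro gsum_least) auto
      ultimately have MS: "M \<subseteq> S" by simp
      have XM: "X \<subseteq> M" "X \<subseteq> L" unfolding X_def by auto
      have "idx S M * idx M X = idx S L * idx L X"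
        using idx_mult[OF *(1) M'(1) S(1) XM(1) MS] idx_mult[OF *(1) L' S(1) XM(2) S(2)] by simp
      then have "idx S M = p" using *(4,6) t S p0 by simp
      then show ?thesis using M' MS ne by (simp add: W_def maxs_def)
    qed
  qed
  \<comment> \<open>Inclusion-exclusion: 2 (\<open>br p n\<close> - 2) - (p - 1), which is where p +
    3 comes from.\<close>
  then have "card (common L K) + card (U \<inter> W) = card U + card W"
    using card_Un_Int[OF fin] by simp
  then show ?thesis using cU cW cUW p1 by linarith
qed

end

section \<open>Smith normal form\<close>

definition unim :: "nat \<Rightarrow> int mat \<Rightarrow> bool" where
  "unim n P \<longleftrightarrow> P \<in> carrier_mat n n \<and> \<bar>det P\<bar> = 1"

lemma unim_carrier: "unim n P \<Longrightarrow> P \<in> carrier_mat n n"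
  by (simp add: unim_def)

lemma unim_mult: "unim n P \<Longrightarrow> unim n Q \<Longrightarrow> unim n (P * Q)"
  by (auto simp: unim_def det_mult[of _ n] abs_mult)

lemma unim_one: "unim n (1\<^sub>m n)"
  by (simp add: unim_def)

lemma unim_transpose: "unim n P \<Longrightarrow> unim n (transpose_mat P)"
  by (auto simp: unim_def det_transpose[of _ n])

text \<open>The determinant is 1 or -1, hence its own inverse, and multiplying the adjugate by it
  gives an integral inverse.\<close>

lemma unim_inverse:
  assumes "unim n P"
  obtains P' where "unim n P'" "P * P' = 1\<^sub>m n" "P' * P = 1\<^sub>m n"
proof -
  have P: "P \<in> carrier_mat n n" and d: "det P * det P = 1"
    using assms by (auto simp: unim_def abs_if split: if_splits)
  define P' where "P' = det P \<cdot>\<^sub>m adj_mat P"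
  note a = adj_mat[OF P]
  have P': "P' \<in> carrier_mat n n" unfolding P'_def using a by simp
  have "det P \<cdot>\<^sub>m (det P \<cdot>\<^sub>m 1\<^sub>m n) = 1\<^sub>m n" by (rule eq_matI) (auto simp: d)
  then have 1: "P * P' = 1\<^sub>m n" "P' * P = 1\<^sub>m n"
    unfolding P'_def using P a
    by (simp_all add: mult_smult_distrib[OF P a(1)] mult_smult_assoc_mat[OF a(1) P])
  have "det P * det P' = 1" using det_mult[OF P P'] 1 by simp
  then have "\<bar>det P\<bar> * \<bar>det P'\<bar> = 1" by (simp flip: abs_mult)
  then have "unim n P'" using P' assms by (simp add: unim_def)
  then show ?thesis using that 1 by blast
qed

definition eqv_mat :: "nat \<Rightarrow> int mat \<Rightarrow> int mat \<Rightarrow> bool" where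
  "eqv_mat n A B \<longleftrightarrow> B \<in> carrier_mat n n \<and> (\<exists>P Q. unim n P \<and> unim n Q \<and> A = P * B * Q)"

lemma eqv_mat_carrier: "eqv_mat n A B \<Longrightarrow> A \<in> carrier_mat n n \<and> B \<in> carrier_mat n n"
  by (auto simp: eqv_mat_def unim_def)

lemma eqv_mat_refl: "A \<in> carrier_mat n n \<Longrightarrow> eqv_mat n A A"
  unfolding eqv_mat_def using unim_one[of n] by (auto intro!: exI[of _ "1\<^sub>m n"])

lemma eqv_mat_trans:
  assumes "eqv_mat n A B" "eqv_mat n B C"
  shows "eqv_mat n A C"
proof -
  obtain P Q P' Q' where *: "unim n P" "unim n Q" "A = P * B * Q" "unim n P'" "unim n Q'" "B = P' * C * Q'"
    and C: "C \<in> carrier_mat n n"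
    using assms by (auto simp: eqv_mat_def)
  have c: "P \<in> carrier_mat n n" "Q \<in> carrier_mat n n" "P' \<in> carrier_mat n n" "Q' \<in> carrier_mat n n"
    using * unim_carrier by auto
  have "A = (P * P') * C * (Q' * Q)"
    unfolding *(3,6) using c C by (simp add: assoc_mult_mat[of _ n n _ n _ n])
  then show ?thesis
    unfolding eqv_mat_def using C unim_mult * by blast
qed

lemma eqv_mat_left:
  assumes "A \<in> carrier_mat n n" "unim n P"
  shows "eqv_mat n (P * A) A"
proof -
  have "P * A = P * A * 1\<^sub>m n" using assms unim_carrier by simp
  then show ?thesis unfolding eqv_mat_def using assms unim_one by blast
qed

lemma eqv_mat_sym:
  assumes "eqv_mat n A B"
  shows "eqv_mat n B A"
proof -
  obtain P Q where *: "unim n P" "unim n Q" "A = P * B * Q" and B: "B \<in> carrier_mat n n"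
    using assms by (auto simp: eqv_mat_def)
  obtain P' where P': "unim n P'" "P' * P = 1\<^sub>m n" using unim_inverse[OF *(1)] by metis
  obtain Q' where Q': "unim n Q'" "Q * Q' = 1\<^sub>m n" using unim_inverse[OF *(2)] by metis
  have c: "P \<in> carrier_mat n n" "Q \<in> carrier_mat n n" "P' \<in> carrier_mat n n" "Q' \<in> carrier_mat n n"
    using * P' Q' unim_carrier by auto
  have "P' * A * Q' = (P' * P) * B * (Q * Q')"
    unfolding * using c B by (simp add: assoc_mult_mat[of _ n n _ n _ n])
  also have "\<dots> = B" using P' Q' B by simp
  finally show ?thesis
    unfolding eqv_mat_def using P' Q' eqv_mat_carrier[OF assms] by metis
qed

text \<open>Elementary operations are provided for rows; moving or reducing entries along columns
  becomes a row operation on the transpose.\<close>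

lemma eqv_mat_transpose:
  assumes "eqv_mat n A B"
  shows "eqv_mat n (transpose_mat A) (transpose_mat B)"
proof -
  obtain P Q where *: "unim n P" "unim n Q" "A = P * B * Q" and B: "B \<in> carrier_mat n n"
    using assms by (auto simp: eqv_mat_def)
  have c: "P \<in> carrier_mat n n" "Q \<in> carrier_mat n n" using * unim_carrier by auto
  have "transpose_mat A = transpose_mat Q * transpose_mat B * transpose_mat P"
    unfolding * using c B
    by (simp add: transpose_mult[of _ n n _ n] assoc_mult_mat[of _ n n _ n _ n])
  then show ?thesis unfolding eqv_mat_def using unim_transpose * B by auto
qed

lemma eqv_mat_addrow:
  assumes "A \<in> carrier_mat n n" "k \<noteq> l" "l < n"
  shows "eqv_mat n A (addrow a k l A)"
proof -
  have "unim n (addrow_mat n a k l)" using assms by (simp add: unim_def det_addrow_mat)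
  then show ?thesis
    using eqv_mat_left[OF assms(1)] addrow_mat[OF assms(1,3)] eqv_mat_sym by metis
qed

lemma eqv_mat_swaprows:
  assumes "A \<in> carrier_mat n n" "k < n" "l < n" "k \<noteq> l"
  shows "eqv_mat n A (swaprows k l A)"
proof -
  have "unim n (swaprows_mat n k l)" using assms by (simp add: unim_def det_swaprows_mat)
  then show ?thesis
    using eqv_mat_left[OF assms(1)] swaprows_mat[OF assms(1-3)] eqv_mat_sym by metis
qed

lemma eqv_mat_move_row:
  assumes "A \<in> carrier_mat n n" "i < n" "j < n"
  obtains B where "eqv_mat n A B" "B $$ (0, j) = A $$ (i, j)"
proof (cases "i = 0")
  case True
  then show ?thesis using that eqv_mat_refl assms by blast
next
  case False
  have "eqv_mat n A (swaprows 0 i A)" using assms False by (intro eqv_mat_swaprows) auto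
  moreover have "swaprows 0 i A $$ (0, j) = A $$ (i, j)" using assms by auto
  ultimately show ?thesis using that by blast
qed

lemma eqv_mat_move_corner:
  assumes "A \<in> carrier_mat n n" "i < n" "j < n"
  obtains B where "eqv_mat n A B" "B $$ (0, 0) = A $$ (i, j)"
proof -
  obtain B where B: "eqv_mat n A B" "B $$ (0, j) = A $$ (i, j)"
    using eqv_mat_move_row[OF assms] by blast
  then have Bc: "B \<in> carrier_mat n n" using eqv_mat_carrier by blast
  obtain C where C: "eqv_mat n (transpose_mat B) C" "C $$ (0, 0) = transpose_mat B $$ (j, 0)"
    using eqv_mat_move_row[of "transpose_mat B" n j 0] Bc assms by auto
  have "eqv_mat n B (transpose_mat C)" using eqv_mat_transpose[OF C(1)] by simp
  then have "eqv_mat n A (transpose_mat C)" using B eqv_mat_trans by blast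
  moreover have "transpose_mat C $$ (0, 0) = A $$ (i, j)"
    using C B Bc eqv_mat_carrier[OF C(1)] assms by auto
  ultimately show ?thesis using that by blast
qed

text \<open>One step of the Euclidean algorithm: the remainder is produced in row i and then swapped
  into the corner.\<close>

lemma eqv_mat_reduce:
  assumes "B \<in> carrier_mat n n" "i < n" "B $$ (0, 0) \<noteq> 0" "\<not> B $$ (0, 0) dvd B $$ (i, 0)"
  obtains C where "eqv_mat n B C" "C $$ (0, 0) \<noteq> 0" "\<bar>C $$ (0, 0)\<bar> < \<bar>B $$ (0, 0)\<bar>"
proof -
  define d r where "d = B $$ (0, 0)" and "r = B $$ (i, 0) mod B $$ (0, 0)"
  have i: "i \<noteq> 0" using assms by (metis dvd_refl)
  define C where "C = addrow (- (B $$ (i, 0) div d)) i 0 B"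
  have C: "eqv_mat n B C" unfolding C_def using assms i by (intro eqv_mat_addrow) auto
  have "C $$ (i, 0) = r"
    unfolding C_def r_def d_def using assms i by (simp add: minus_div_mult_eq_mod algebra_simps)
  moreover obtain E where "eqv_mat n C E" "E $$ (0, 0) = C $$ (i, 0)"
    using eqv_mat_move_row[of C n i 0] eqv_mat_carrier[OF C] assms(2) by auto
  moreover have "r \<noteq> 0" unfolding r_def using assms(4) by (simp add: dvd_eq_mod_eq_0)
  moreover have "\<bar>r\<bar> < \<bar>d\<bar>" unfolding r_def d_def using assms(3) by (rule abs_mod_less)
  ultimately show ?thesis using that eqv_mat_trans[OF C] d_def by metis
qed

lemma unim_block_lower:
  assumes "c \<in> carrier_mat n 1" "unim n X"
  shows "unim (Suc n) (four_block_mat (1\<^sub>m 1) (0\<^sub>m 1 n) c X)"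
proof -
  have X: "X \<in> carrier_mat n n" using assms unim_carrier by simp
  have "det (four_block_mat (1\<^sub>m 1) (0\<^sub>m 1 n) c X) = det (1\<^sub>m 1) * det X"
    by (rule det_four_block_mat_upper_right_zero[OF _ refl assms(1) X]) simp
  then show ?thesis
    using assms four_block_carrier_mat[of "1\<^sub>m 1" 1 1 X n n] X by (simp add: unim_def)
qed

lemma unim_block_upper:
  assumes "r \<in> carrier_mat 1 n" "unim n X"
  shows "unim (Suc n) (four_block_mat (1\<^sub>m 1) r (0\<^sub>m n 1) X)"
proof -
  have X: "X \<in> carrier_mat n n" using assms unim_carrier by simp
  have "det (four_block_mat (1\<^sub>m 1) r (0\<^sub>m n 1) X) = det (1\<^sub>m 1) * det X"
    by (rule det_four_block_mat_lower_left_zero[OF _ assms(1) refl X]) simp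
  then show ?thesis
    using assms four_block_carrier_mat[of "1\<^sub>m 1" 1 1 X n n] X by (simp add: unim_def)
qed

text \<open>The whole first row and column are cleared at once by a block factorization. The
  quotients by the corner form the unimodular factors \<open>P\<close> and \<open>Q\<close>, and
  \<open>M\<close> is the Schur complement, integral by the divisibility assumptions.\<close>

lemma eqv_mat_clear:
  assumes Bc: "B \<in> carrier_mat (Suc n) (Suc n)"
    and row: "\<And>i. i < Suc n \<Longrightarrow> B $$ (0, 0) dvd B $$ (i, 0)"
    and col: "\<And>j. j < Suc n \<Longrightarrow> B $$ (0, 0) dvd B $$ (0, j)"
  shows "\<exists>M. M \<in> carrier_mat n n \<and>
    eqv_mat (Suc n) B (four_block_mat (mat 1 1 (\<lambda>_. B $$ (0, 0))) (0\<^sub>m 1 n) (0\<^sub>m n 1) M)"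
proof -
  define d where "d = B $$ (0, 0)"
  define c where "c = mat n 1 (\<lambda>(i, _). B $$ (Suc i, 0) div d)"
  define r where "r = mat 1 n (\<lambda>(_, j). B $$ (0, Suc j) div d)"
  define D where "D = mat 1 1 (\<lambda>_. d)"
  define M where "M = mat n n (\<lambda>(i, j). B $$ (Suc i, Suc j) - B $$ (Suc i, 0) div d * B $$ (0, Suc j))"
  define P where "P = four_block_mat (1\<^sub>m 1) (0\<^sub>m 1 n) c (1\<^sub>m n)"
  define Q where "Q = four_block_mat (1\<^sub>m 1) r (0\<^sub>m n 1) (1\<^sub>m n)"
  have cc: "c \<in> carrier_mat n 1" "r \<in> carrier_mat 1 n" "D \<in> carrier_mat 1 1" "M \<in> carrier_mat n n"
    by (auto simp: c_def r_def D_def M_def)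
  have uP: "unim (Suc n) P" unfolding P_def using cc unim_one by (intro unim_block_lower)
  have uQ: "unim (Suc n) Q" unfolding Q_def using cc unim_one by (intro unim_block_upper)
  have 1: "P * four_block_mat D (0\<^sub>m 1 n) (0\<^sub>m n 1) M = four_block_mat D (0\<^sub>m 1 n) (c * D) M"
    unfolding P_def using cc by (subst mult_four_block_mat[of _ 1 1 _ n _ n]) auto
  have "P * four_block_mat D (0\<^sub>m 1 n) (0\<^sub>m n 1) M * Q = four_block_mat D (D * r) (c * D) (c * D * r + M)"
    unfolding 1 Q_def using cc by (subst mult_four_block_mat[of _ 1 1 _ n _ n]) auto
  also have "\<dots> = B"
  proof (rule eq_matI)
    fix i j assume "i < dim_row B" "j < dim_col B"
    then have ij: "i < Suc n" "j < Suc n" using Bc by auto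
    have "B $$ (i, 0) div d * d = B $$ (i, 0)" "d * (B $$ (0, j) div d) = B $$ (0, j)"
      "B $$ (i, 0) * (B $$ (0, j) div d) = B $$ (i, 0) div d * B $$ (0, j)"
      using row[OF ij(1)] col[OF ij(2)] by (auto simp: d_def dvd_div_mult div_mult_swap)
    then show "four_block_mat D (D * r) (c * D) (c * D * r + M) $$ (i, j) = B $$ (i, j)"
      using ij cc
      by (cases i; cases j) (auto simp: c_def r_def D_def M_def d_def scalar_prod_def mult.assoc)
  qed (use Bc cc in auto)
  finally have B1: "B = P * four_block_mat D (0\<^sub>m 1 n) (0\<^sub>m n 1) M * Q" by simp
  have "four_block_mat D (0\<^sub>m 1 n) (0\<^sub>m n 1) M \<in> carrier_mat (Suc n) (Suc n)"
    using four_block_carrier_mat[of D 1 1 M n n] cc by simp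
  then have "eqv_mat (Suc n) B (four_block_mat D (0\<^sub>m 1 n) (0\<^sub>m n 1) M)"
    unfolding eqv_mat_def using B1 uP uQ by blast
  then show ?thesis using cc unfolding D_def d_def by blast
qed

lemma eqv_mat_block:
  assumes D: "D \<in> carrier_mat 1 1" and MN: "eqv_mat n M N"
  shows "eqv_mat (Suc n) (four_block_mat D (0\<^sub>m 1 n) (0\<^sub>m n 1) M) (four_block_mat D (0\<^sub>m 1 n) (0\<^sub>m n 1) N)"
proof -
  obtain P Q where PQ: "unim n P" "unim n Q" "M = P * N * Q" and N: "N \<in> carrier_mat n n"
    using MN by (auto simp: eqv_mat_def)
  have PQc: "P \<in> carrier_mat n n" "Q \<in> carrier_mat n n" "P * N \<in> carrier_mat n n"
    using PQ(1,2)[THEN unim_carrier] N by auto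
  let ?e = "\<lambda>X. four_block_mat (1\<^sub>m 1) (0\<^sub>m 1 n) (0\<^sub>m n 1) X"
  have 1: "?e P * four_block_mat D (0\<^sub>m 1 n) (0\<^sub>m n 1) N = four_block_mat D (0\<^sub>m 1 n) (0\<^sub>m n 1) (P * N)"
    using D N PQc by (subst mult_four_block_mat[of _ 1 1 _ n _ n]) auto
  have 2: "four_block_mat D (0\<^sub>m 1 n) (0\<^sub>m n 1) M = ?e P * four_block_mat D (0\<^sub>m 1 n) (0\<^sub>m n 1) N * ?e Q"
    unfolding 1 PQ(3) using D N PQc by (subst mult_four_block_mat[of _ 1 1 _ n _ n]) auto
  have "unim (Suc n) (?e P)" "unim (Suc n) (?e Q)"
    using unim_block_lower[OF _ PQ(1)] unim_block_lower[OF _ PQ(2)] by simp_all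
  moreover have "four_block_mat D (0\<^sub>m 1 n) (0\<^sub>m n 1) N \<in> carrier_mat (Suc n) (Suc n)"
    using four_block_carrier_mat[of D 1 1 N n n] D N by simp
  ultimately show ?thesis unfolding eqv_mat_def using 2 by blast
qed

text \<open>Among all equivalent matrices with nonzero corner one with least absolute value is
  taken. By minimality the corner divides its row and column, which can then be cleared. The
  diagonal carries no order or divisibility chain: later it enters through sums and multisets of
  exponents.\<close>

lemma smith_normal_form:
  assumes "A \<in> carrier_mat n n"
  shows "\<exists>d. eqv_mat n A (mat_diag n d)"
  using assms
proof (induction n arbitrary: A)
  case 0
  have "A = mat_diag 0 (\<lambda>_. 0)" using 0 by (intro eq_matI) (auto simp: mat_diag_def)
  then show ?case using eqv_mat_refl[OF 0] by metis
next
  case (Suc n)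
  show ?case
  proof (cases "\<exists>i<Suc n. \<exists>j<Suc n. A $$ (i, j) \<noteq> 0")
    case False
    then have "A = mat_diag (Suc n) (\<lambda>_. 0)" using Suc.prems by (intro eq_matI) (auto simp: mat_diag_def)
    then show ?thesis using eqv_mat_refl[OF Suc.prems] by metis
  next
    case True
    define S where "S = {B. eqv_mat (Suc n) A B \<and> B $$ (0, 0) \<noteq> 0}"
    have "S \<noteq> {}" unfolding S_def using True eqv_mat_move_corner[OF Suc.prems] by (metis (mono_tags, lifting) empty_Collect_eq)
    then obtain B where B: "B \<in> S" and min: "\<And>C. C \<in> S \<Longrightarrow> nat \<bar>B $$ (0, 0)\<bar> \<le> nat \<bar>C $$ (0, 0)\<bar>"
      using ex_has_least_nat[of "\<lambda>B. B \<in> S" _ "\<lambda>B. nat \<bar>B $$ (0, 0)\<bar>"] by blast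
    define d where "d = B $$ (0, 0)"
    have AB: "eqv_mat (Suc n) A B" and d: "d \<noteq> 0" using B by (auto simp: S_def d_def)
    have Bc: "B \<in> carrier_mat (Suc n) (Suc n)" using eqv_mat_carrier[OF AB] by simp
    have row: "d dvd B $$ (i, 0)" if i: "i < Suc n" for i
    proof (rule ccontr)
      assume "\<not> d dvd B $$ (i, 0)"
      then obtain C where "eqv_mat (Suc n) B C" "C $$ (0, 0) \<noteq> 0" "\<bar>C $$ (0, 0)\<bar> < \<bar>d\<bar>"
        using eqv_mat_reduce[OF Bc i] d unfolding d_def by metis
      then show False using min[of C] eqv_mat_trans[OF AB] by (auto simp: S_def d_def)
    qed
    have col: "d dvd B $$ (0, j)" if j: "j < Suc n" for j
    proof (rule ccontr)
      let ?B = "transpose_mat B"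
      have Bt: "?B \<in> carrier_mat (Suc n) (Suc n)" using Bc by simp
      assume "\<not> d dvd B $$ (0, j)"
      then have "\<not> ?B $$ (0, 0) dvd ?B $$ (j, 0)" using Bc j by (simp add: d_def)
      moreover have "?B $$ (0, 0) \<noteq> 0" using Bc d by (simp add: d_def)
      ultimately obtain C where C: "eqv_mat (Suc n) ?B C" "C $$ (0, 0) \<noteq> 0" "\<bar>C $$ (0, 0)\<bar> < \<bar>?B $$ (0, 0)\<bar>"
        using eqv_mat_reduce[OF Bt j] by metis
      have "eqv_mat (Suc n) B (transpose_mat C)" using eqv_mat_transpose[OF C(1)] by simp
      then have "eqv_mat (Suc n) A (transpose_mat C)" using eqv_mat_trans[OF AB] by blast
      moreover have "transpose_mat C $$ (0, 0) = C $$ (0, 0)" using eqv_mat_carrier[OF C(1)] by auto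
      ultimately show False using min[of "transpose_mat C"] C(2,3) Bc by (auto simp: S_def d_def)
    qed
    obtain D M where D: "D = mat 1 1 (\<lambda>_. d)" and M: "M \<in> carrier_mat n n"
      and BM: "eqv_mat (Suc n) B (four_block_mat D (0\<^sub>m 1 n) (0\<^sub>m n 1) M)"
      using eqv_mat_clear[OF Bc, folded d_def] row col by metis
    have Dc: "D \<in> carrier_mat 1 1" by (simp add: D)
    obtain m where m: "eqv_mat n M (mat_diag n m)" using Suc.IH[OF M] by blast
    note 3 = eqv_mat_block[OF Dc m]
    define m' where "m' k = (case k of 0 \<Rightarrow> d | Suc i \<Rightarrow> m i)" for k
    have 4: "four_block_mat D (0\<^sub>m 1 n) (0\<^sub>m n 1) (mat_diag n m) = mat_diag (Suc n) m'"
      by (rule eq_matI) (auto simp: mat_diag_def D m'_def split: nat.splits)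
    show ?thesis using 3 BM AB eqv_mat_trans unfolding 4 by metis
  qed
qed

section \<open>Lattices and cosets of matrices\<close>

text \<open>Vectors are functions vanishing from index n on. Thus they live in the ring of
  functions, where the lattice counting of \<open>p_lattices\<close> applies.\<close>

definition VV :: "nat \<Rightarrow> (nat \<Rightarrow> rat) set" where
  "VV n = {x. \<forall>i\<ge>n. x i = 0}"

definition ZZ :: "nat \<Rightarrow> (nat \<Rightarrow> rat) set" where
  "ZZ n = {x \<in> VV n. \<forall>i<n. x i \<in> \<int>}"

text \<open>The product of a row vector with a matrix, set to 0 beyond n so that the result is again
  in \<open>VV n\<close>.\<close>

definition rowv :: "nat \<Rightarrow> (nat \<Rightarrow> rat) \<Rightarrow> rat mat \<Rightarrow> nat \<Rightarrow> rat" where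
  "rowv n x A = (\<lambda>j. if j < n then \<Sum>i<n. x i * A $$ (i, j) else 0)"

definition lat :: "nat \<Rightarrow> rat mat \<Rightarrow> (nat \<Rightarrow> rat) set" where
  "lat n g = (\<lambda>x. rowv n x g) ` ZZ n"

definition imat :: "nat \<Rightarrow> rat mat set" where
  "imat n = {A \<in> carrier_mat n n. \<forall>i<n. \<forall>j<n. A $$ (i, j) \<in> \<int>}"

definition unitv :: "nat \<Rightarrow> nat \<Rightarrow> rat" where
  "unitv i = (\<lambda>j. if j = i then 1 else 0)"

lemma of_int_fun_apply [simp]: "(of_int q :: 'a \<Rightarrow> 'b::ring_1) x = of_int q"
  by (cases q rule: int_diff_cases) simp

lemma sum_fun_apply: "(\<Sum>i\<in>I. f i) x = (\<Sum>i\<in>I. f i x)"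
  by (induction I rule: infinite_finite_induct) auto

lemma sbgp_of_int_mult:
  fixes H :: "'a::ring_1 set"
  assumes "sbgp H" "x \<in> H"
  shows "of_int k * x \<in> H"
proof (cases k rule: int_diff_cases)
  case (diff a b)
  have "of_int k * x = of_nat a * x - of_nat b * x" unfolding diff by (simp add: left_diff_distrib)
  then show ?thesis using sbgp_diff[OF assms(1)] sbgp_of_nat_mult[OF assms] by metis
qed

lemma rowv_VV: "rowv n x A \<in> VV n"
  by (simp add: VV_def rowv_def)

lemma rowv_mult:
  assumes "A \<in> carrier_mat n n" "B \<in> carrier_mat n n"
  shows "rowv n (rowv n x A) B = rowv n x (A * B)"
proof
  fix j
  show "rowv n (rowv n x A) B j = rowv n x (A * B) j"
  proof (cases "j < n")
    case True
    have "(\<Sum>k<n. (\<Sum>i<n. x i * A $$ (i, k)) * B $$ (k, j)) = (\<Sum>k<n. \<Sum>i<n. x i * (A $$ (i, k) * B $$ (k, j)))"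
      by (simp add: sum_distrib_right mult.assoc)
    also have "\<dots> = (\<Sum>i<n. \<Sum>k<n. x i * (A $$ (i, k) * B $$ (k, j)))"
      by (rule sum.swap)
    also have "\<dots> = (\<Sum>i<n. x i * (A * B) $$ (i, j))"
      using assms True by (intro sum.cong) (auto simp: sum_distrib_left scalar_prod_def atLeast0LessThan)
    finally show ?thesis using True by (simp add: rowv_def)
  qed (simp add: rowv_def)
qed

lemma rowv_diag:
  "rowv n x (mat_diag n d) = (\<lambda>j. if j < n then x j * d j else 0)"
proof
  fix j
  have "(\<Sum>i<n. x i * mat_diag n d $$ (i, j)) = (\<Sum>i<n. if i = j then x i * d j else 0)" if "j < n"
    using that by (intro sum.cong) (auto simp: mat_diag_def)
  then show "rowv n x (mat_diag n d) j = (if j < n then x j * d j else 0)"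
    by (auto simp: rowv_def)
qed

lemma rowv_one: "x \<in> VV n \<Longrightarrow> rowv n x (1\<^sub>m n) = x"
  using rowv_diag[of n x "\<lambda>_. 1"] by (auto simp: VV_def fun_eq_iff)

lemma rowv_diff: "rowv n (x - y) A = rowv n x A - rowv n y A"
  by (auto simp: rowv_def fun_eq_iff left_diff_distrib sum_subtractf)

lemma rowv_unitv: "i < n \<Longrightarrow> rowv n (unitv i) A = (\<lambda>j. if j < n then A $$ (i, j) else 0)"
proof -
  assume i: "i < n"
  have "(\<Sum>k<n. unitv i k * A $$ (k, j)) = (\<Sum>k<n. if k = i then A $$ (k, j) else 0)" for j
    by (intro sum.cong) (auto simp: unitv_def)
  then show ?thesis using i by (auto simp: rowv_def fun_eq_iff)
qed

lemma sbgp_VV: "sbgp (VV n)" by (auto simp: sbgp_def VV_def)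

lemma sbgp_ZZ: "sbgp (ZZ n)" by (auto simp: sbgp_def ZZ_def VV_def)

lemma unitv_ZZ: "i < n \<Longrightarrow> unitv i \<in> ZZ n"
  by (auto simp: unitv_def ZZ_def VV_def)

lemma ZZ_VV: "x \<in> ZZ n \<Longrightarrow> x \<in> VV n" by (simp add: ZZ_def)

lemma sbgp_image:
  assumes "sbgp L" "\<And>x y. f (x - y) = f x - f y"
  shows "sbgp (f ` L)"
  unfolding sbgp_def
proof (intro conjI ballI)
  have "f 0 = 0" using assms(2)[of 0 0] by simp
  then show "0 \<in> f ` L" using sbgp_zero[OF assms(1)] by (metis imageI)
  fix x y assume "x \<in> f ` L" "y \<in> f ` L"
  then show "x - y \<in> f ` L" using sbgp_diff[OF assms(1)] assms(2) by (auto simp flip: assms(2))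
qed

lemma sbgp_lat: "sbgp (lat n g)"
  unfolding lat_def by (intro sbgp_image sbgp_ZZ rowv_diff)

lemma lat_VV: "lat n g \<subseteq> VV n"
  unfolding lat_def using rowv_VV by blast

lemma rowv_ZZ: "x \<in> ZZ n \<Longrightarrow> A \<in> imat n \<Longrightarrow> rowv n x A \<in> ZZ n"
  by (auto simp: ZZ_def imat_def rowv_def VV_def intro!: Ints_sum Ints_mult)

lemma lat_mult:
  assumes "g \<in> carrier_mat n n" "Q \<in> carrier_mat n n"
  shows "lat n (g * Q) = (\<lambda>x. rowv n x Q) ` lat n g"
  unfolding lat_def by (simp add: image_image rowv_mult[OF assms])

text \<open>The rows of g are the images of the unit vectors. If they lie in the lattice of h, their
  coefficient vectors are the rows of A.\<close>

lemma lat_subset_iff: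
  assumes "g \<in> carrier_mat n n" "h \<in> carrier_mat n n"
  shows "lat n g \<subseteq> lat n h \<longleftrightarrow> (\<exists>A\<in>imat n. g = A * h)"
proof
  assume sub: "lat n g \<subseteq> lat n h"
  have "\<exists>x\<in>ZZ n. rowv n (unitv i) g = rowv n x h" if "i < n" for i
  proof -
    have "rowv n (unitv i) g \<in> lat n g" unfolding lat_def using unitv_ZZ[OF that] by (rule imageI)
    then show ?thesis using sub unfolding lat_def by blast
  qed
  then obtain x where x: "\<And>i. i < n \<Longrightarrow> x i \<in> ZZ n" "\<And>i. i < n \<Longrightarrow> rowv n (unitv i) g = rowv n (x i) h"
    by metis
  define A where "A = mat n n (\<lambda>(i, j). x i j)"
  have A: "A \<in> imat n" using x(1) by (auto simp: imat_def A_def ZZ_def)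
  have "g = A * h"
  proof (rule eq_matI)
    fix i j assume "i < dim_row (A * h)" "j < dim_col (A * h)"
    then have ij: "i < n" "j < n" using assms by (auto simp: A_def)
    have "g $$ (i, j) = rowv n (unitv i) g j" using ij by (simp add: rowv_unitv)
    also have "\<dots> = rowv n (x i) h j" using x(2) ij by simp
    also have "\<dots> = (A * h) $$ (i, j)"
      using ij assms by (simp add: rowv_def A_def scalar_prod_def atLeast0LessThan)
    finally show "g $$ (i, j) = (A * h) $$ (i, j)" .
  qed (use assms in \<open>auto simp: A_def\<close>)
  then show "\<exists>A\<in>imat n. g = A * h" using A by blast
next
  assume "\<exists>A\<in>imat n. g = A * h"
  then obtain A where A: "A \<in> imat n" "g = A * h" by blast
  then have Ac: "A \<in> carrier_mat n n" by (simp add: imat_def)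
  show "lat n g \<subseteq> lat n h"
  proof
    fix y assume "y \<in> lat n g"
    then obtain x where "x \<in> ZZ n" "y = rowv n (rowv n x A) h"
      unfolding A(2) lat_def rowv_mult[OF Ac assms(2)] by blast
    then show "y \<in> lat n h" unfolding lat_def using rowv_ZZ[OF _ A(1)] by blast
  qed
qed

lemma GL_carrier:
  "g \<in> carrier (GL TYPE('a::comm_ring_1) n) \<longleftrightarrow>
    g \<in> carrier_mat n n \<and> (\<exists>h\<in>carrier_mat n n. h * g = 1\<^sub>m n \<and> g * h = 1\<^sub>m n)"
  by (auto simp: GL_def units_of_def Units_def ring_mat_simps)

lemma GL_mult [simp]: "x \<otimes>\<^bsub>GL ty n\<^esub> y = x * y"
  by (simp add: GL_def units_of_def ring_mat_simps)

lemma GL_one [simp]: "\<one>\<^bsub>GL ty n\<^esub> = 1\<^sub>m n"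
  by (simp add: GL_def units_of_def ring_mat_simps)

lemma group_GL: "group (GL TYPE('a::comm_ring_1) n)"
proof -
  interpret ring "ring_mat TYPE('a) n ()" by (rule ring_mat)
  show ?thesis unfolding GL_def by (rule units_group)
qed

lemma imat_eq: "imat n = rat_mat ` carrier_mat n n"
proof (intro subset_antisym subsetI)
  fix A assume A: "A \<in> imat n"
  define B where "B = map_mat floor A"
  have "A = rat_mat B"
    using A by (intro eq_matI) (auto simp: imat_def B_def)
  moreover have "B \<in> carrier_mat n n" using A by (auto simp: B_def imat_def)
  ultimately show "A \<in> rat_mat ` carrier_mat n n" by blast
qed (auto simp: imat_def)

lemma rat_mat_mult: "A \<in> carrier_mat n n \<Longrightarrow> B \<in> carrier_mat n n \<Longrightarrow> rat_mat (A * B) = rat_mat A * rat_mat B"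
  by (rule of_int_hom.mat_hom_mult)

lemma rat_mat_one: "rat_mat (1\<^sub>m n) = 1\<^sub>m n"
  by (rule of_int_hom.mat_hom_one)

lemma rat_mat_inj: "rat_mat A = rat_mat B \<Longrightarrow> A = B"
  by (rule of_int_hom.mat_hom_inj)

lemma unim_of_inverse:
  assumes "A \<in> carrier_mat n n" "B \<in> carrier_mat n n" "A * B = 1\<^sub>m n"
  shows "unim n A"
proof -
  have "det A * det B = 1" using det_mult[OF assms(1,2)] assms(3) by simp
  then have "\<bar>det A\<bar> = 1" using abs_zmult_eq_1[of "det A" "det B"] by simp
  then show ?thesis using assms(1) by (simp add: unim_def)
qed

lemma Lam_eq: "Lam n = rat_mat ` {P. unim n P}"
proof -
  have "carrier (GL TYPE(int) n) = {P. unim n P}"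
  proof (intro subset_antisym subsetI)
    fix P assume "P \<in> carrier (GL TYPE(int) n)"
    then show "P \<in> {P. unim n P}" using unim_of_inverse by (auto simp: GL_carrier)
  next
    fix P assume "P \<in> {P. unim n P}"
    then show "P \<in> carrier (GL TYPE(int) n)"
      unfolding GL_carrier using unim_inverse[of n P] unim_carrier by (metis mem_Collect_eq)
  qed
  then show ?thesis by (simp add: Lam_def)
qed

lemma Lam_inverse:
  assumes "P \<in> Lam n"
  obtains P' where "P' \<in> Lam n" "P * P' = 1\<^sub>m n" "P' * P = 1\<^sub>m n"
proof -
  obtain A where A: "unim n A" "P = rat_mat A" using assms by (auto simp: Lam_eq)
  obtain B where B: "unim n B" "A * B = 1\<^sub>m n" "B * A = 1\<^sub>m n" using unim_inverse[OF A(1)] by metis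
  have "rat_mat A * rat_mat B = 1\<^sub>m n" "rat_mat B * rat_mat A = 1\<^sub>m n"
    using A B unim_carrier by (metis rat_mat_mult rat_mat_one)+
  then show ?thesis using that B A by (auto simp: Lam_eq)
qed

lemma Lam_imat: "P \<in> Lam n \<Longrightarrow> P \<in> imat n"
  by (auto simp: Lam_eq imat_eq unim_carrier)

lemma Lam_carrier: "P \<in> Lam n \<Longrightarrow> P \<in> carrier_mat n n"
  using Lam_imat by (auto simp: imat_def)

lemma imat_inverse_Lam:
  assumes "A \<in> imat n" "B \<in> imat n" "A * B = 1\<^sub>m n"
  shows "A \<in> Lam n"
proof -
  obtain A0 B0 where *: "A0 \<in> carrier_mat n n" "B0 \<in> carrier_mat n n" "A = rat_mat A0" "B = rat_mat B0"
    using assms by (auto simp: imat_eq)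
  have "rat_mat (A0 * B0) = rat_mat (1\<^sub>m n)"
    using * assms(3) by (simp add: rat_mat_mult rat_mat_one)
  then have "A0 * B0 = 1\<^sub>m n" by (rule rat_mat_inj)
  then show ?thesis using unim_of_inverse * by (auto simp: Lam_eq)
qed

lemma Lam_mult: "P \<in> Lam n \<Longrightarrow> Q \<in> Lam n \<Longrightarrow> P * Q \<in> Lam n"
proof -
  assume "P \<in> Lam n" "Q \<in> Lam n"
  then obtain A B where *: "unim n A" "unim n B" "P = rat_mat A" "Q = rat_mat B" by (auto simp: Lam_eq)
  then have "P * Q = rat_mat (A * B)" using rat_mat_mult unim_carrier by metis
  then show ?thesis unfolding Lam_eq using unim_mult[OF *(1,2)] by blast
qed

lemma Lam_one: "1\<^sub>m n \<in> Lam n"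
  unfolding Lam_eq using unim_one[of n] rat_mat_one[of n] by (metis imageI mem_Collect_eq)

lemma Lam_GL: "P \<in> Lam n \<Longrightarrow> P \<in> carrier (GLQ n)"
  unfolding GL_carrier using Lam_inverse[of P n] Lam_carrier by metis

lemma GLQ_carrier: "g \<in> carrier (GLQ n) \<Longrightarrow> g \<in> carrier_mat n n"
  by (simp add: GL_carrier)

lemma GLQ_mult: "g \<in> carrier (GLQ n) \<Longrightarrow> h \<in> carrier (GLQ n) \<Longrightarrow> g * h \<in> carrier (GLQ n)"
  using monoid.m_closed[OF group.is_monoid[OF group_GL], of g n h] by simp

lemma right_coset_eq: "right_coset n g = {P * g | P. P \<in> Lam n}"
  by (auto simp: right_coset_def r_coset_def)

lemma double_coset_eq: "double_coset n g = {P * g * Q | P Q. P \<in> Lam n \<and> Q \<in> Lam n}"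
  by (auto simp: double_coset_def set_mult_def right_coset_eq[unfolded right_coset_def])

text \<open>The two inclusions give integral matrices with g = A B g; cancelling the invertible g
  makes A and B inverse to each other, so A is in \<open>Lam n\<close>.\<close>

lemma lat_eq_iff:
  assumes g: "g \<in> carrier (GLQ n)" and h: "h \<in> carrier (GLQ n)"
  shows "lat n g = lat n h \<longleftrightarrow> (\<exists>P\<in>Lam n. g = P * h)"
proof
  assume eq: "lat n g = lat n h"
  obtain g' h' where g': "g' \<in> carrier_mat n n" "g * g' = 1\<^sub>m n" and h': "h' \<in> carrier_mat n n" "h * h' = 1\<^sub>m n"
    using g h by (auto simp: GL_carrier)
  have c: "g \<in> carrier_mat n n" "h \<in> carrier_mat n n" using g h GLQ_carrier by auto
  obtain A where A: "A \<in> imat n" "g = A * h" using lat_subset_iff[OF c] eq by blast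
  obtain B where B: "B \<in> imat n" "h = B * g" using lat_subset_iff[OF c(2,1)] eq by blast
  have cA: "A \<in> carrier_mat n n" "B \<in> carrier_mat n n" using A B by (auto simp: imat_def)
  have "g = A * (B * g)" using A(2) unfolding B(2)[symmetric] .
  then have gAB: "A * (B * g) = g" by (rule sym)
  have "A * (B * g) * g' = A * B * (g * g')"
    using cA c g'(1) by (simp add: assoc_mult_mat[of _ n n _ n _ n])
  then have "g * g' = A * B * (g * g')" unfolding gAB .
  then have "A * B = 1\<^sub>m n" using g' cA by simp
  then have "A \<in> Lam n" using imat_inverse_Lam A B by blast
  then show "\<exists>P\<in>Lam n. g = P * h" using A by blast
next
  assume "\<exists>P\<in>Lam n. g = P * h"
  then obtain P where P: "P \<in> Lam n" "g = P * h" by blast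
  obtain P' where P': "P' \<in> Lam n" "P' * P = 1\<^sub>m n" using Lam_inverse[OF P(1)] by metis
  have c: "g \<in> carrier_mat n n" "h \<in> carrier_mat n n" using g h GLQ_carrier by auto
  have "P' * (P * h) = P' * P * h"
    using c Lam_carrier[OF P(1)] Lam_carrier[OF P'(1)] by (simp add: assoc_mult_mat[of _ n n _ n _ n])
  then have "h = P' * g" using P P' c by simp
  then show "lat n g = lat n h"
    using lat_subset_iff[OF c] lat_subset_iff[OF c(2,1)] P P' Lam_imat by (metis subset_antisym)
qed

lemma right_coset_eq_iff:
  assumes g: "g \<in> carrier (GLQ n)" and h: "h \<in> carrier (GLQ n)"
  shows "right_coset n g = right_coset n h \<longleftrightarrow> lat n g = lat n h"
proof
  assume "right_coset n g = right_coset n h"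
  moreover have "g \<in> right_coset n g"
  proof -
    have "g = 1\<^sub>m n * g" using GLQ_carrier[OF g] by simp
    then show ?thesis unfolding right_coset_eq using Lam_one by blast
  qed
  ultimately show "lat n g = lat n h" unfolding lat_eq_iff[OF g h] right_coset_eq by blast
next
  have sub: "right_coset n a \<subseteq> right_coset n b" if ab: "a = P * b" "P \<in> Lam n" "b \<in> carrier_mat n n" for a b P
  proof
    fix x assume "x \<in> right_coset n a"
    then obtain R where R: "R \<in> Lam n" "x = R * (P * b)" using ab by (auto simp: right_coset_eq)
    then have "x = (R * P) * b"
      using ab(3) Lam_carrier[OF R(1)] Lam_carrier[OF ab(2)] by (simp add: assoc_mult_mat[of _ n n _ n _ n])
    then show "x \<in> right_coset n b" using Lam_mult[OF R(1) ab(2)] by (auto simp: right_coset_eq)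
  qed
  assume eq: "lat n g = lat n h"
  show "right_coset n g = right_coset n h"
  proof
    show "right_coset n g \<subseteq> right_coset n h"
      using lat_eq_iff[OF g h] eq sub[OF _ _ GLQ_carrier[OF h]] by blast
    show "right_coset n h \<subseteq> right_coset n g"
      using lat_eq_iff[OF h g] eq sub[OF _ _ GLQ_carrier[OF g]] by blast
  qed
qed

lemma double_coset_GL: "g \<in> carrier (GLQ n) \<Longrightarrow> h \<in> double_coset n g \<Longrightarrow> h \<in> carrier (GLQ n)"
  using GLQ_mult Lam_GL by (auto simp: double_coset_eq)

text \<open>A left factor from \<open>Lam n\<close> does not change the lattice and a right factor
  moves it, so double cosets are orbits of lattices under \<open>Lam n\<close>.\<close>

lemma mem_double_coset_iff:
  assumes g: "g \<in> carrier (GLQ n)" and h: "h \<in> carrier (GLQ n)"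
  shows "h \<in> double_coset n g \<longleftrightarrow> (\<exists>Q\<in>Lam n. lat n h = (\<lambda>x. rowv n x Q) ` lat n g)"
proof -
  have *: "(\<exists>P\<in>Lam n. h = P * g * Q) \<longleftrightarrow> lat n h = (\<lambda>x. rowv n x Q) ` lat n g" if Q: "Q \<in> Lam n" for Q
  proof -
    have gQ: "g * Q \<in> carrier (GLQ n)" using GLQ_mult g Lam_GL Q by blast
    have c: "g \<in> carrier_mat n n" "Q \<in> carrier_mat n n" using GLQ_carrier[OF g] Lam_carrier[OF Q] by auto
    have "(\<exists>P\<in>Lam n. h = P * g * Q) \<longleftrightarrow> (\<exists>P\<in>Lam n. h = P * (g * Q))"
      using c Lam_carrier by (metis assoc_mult_mat)
    then show ?thesis using lat_eq_iff[OF h gQ] lat_mult[OF c] by simp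
  qed
  have "h \<in> double_coset n g \<longleftrightarrow> (\<exists>Q\<in>Lam n. \<exists>P\<in>Lam n. h = P * g * Q)"
    unfolding double_coset_eq by auto
  also have "\<dots> \<longleftrightarrow> (\<exists>Q\<in>Lam n. lat n h = (\<lambda>x. rowv n x Q) ` lat n g)"
    by (rule bex_cong[OF refl]) (rule *)
  finally show ?thesis .
qed

lemma double_coset_refl: "g \<in> carrier (GLQ n) \<Longrightarrow> g \<in> double_coset n g"
proof -
  assume "g \<in> carrier (GLQ n)"
  then have "g = 1\<^sub>m n * g * 1\<^sub>m n" using GLQ_carrier[of g n] by simp
  then show ?thesis unfolding double_coset_eq using Lam_one[of n] by blast
qed

lemma double_coset_subset:
  assumes g: "g \<in> carrier (GLQ n)" and h: "h \<in> double_coset n g"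
  shows "double_coset n h \<subseteq> double_coset n g"
proof
  fix x assume "x \<in> double_coset n h"
  then obtain P Q where PQ: "P \<in> Lam n" "Q \<in> Lam n" "x = P * h * Q" by (auto simp: double_coset_eq)
  obtain R S where RS: "R \<in> Lam n" "S \<in> Lam n" "h = R * g * S" using h by (auto simp: double_coset_eq)
  have c: "P \<in> carrier_mat n n" "Q \<in> carrier_mat n n" "R \<in> carrier_mat n n" "S \<in> carrier_mat n n" "g \<in> carrier_mat n n"
    using PQ RS Lam_carrier GLQ_carrier[OF g] by auto
  have "x = (P * R) * g * (S * Q)"
    unfolding PQ RS using c by (simp add: assoc_mult_mat[of _ n n _ n _ n])
  then show "x \<in> double_coset n g" using Lam_mult PQ RS unfolding double_coset_eq by blast
qed

lemma double_coset_sym: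
  assumes g: "g \<in> carrier (GLQ n)" and h: "h \<in> double_coset n g"
  shows "g \<in> double_coset n h"
proof -
  obtain R S where RS: "R \<in> Lam n" "S \<in> Lam n" "h = R * g * S" using h by (auto simp: double_coset_eq)
  obtain R' where R': "R' \<in> Lam n" "R' * R = 1\<^sub>m n" using Lam_inverse[OF RS(1)] by metis
  obtain S' where S': "S' \<in> Lam n" "S * S' = 1\<^sub>m n" using Lam_inverse[OF RS(2)] by metis
  have c: "R' \<in> carrier_mat n n" "S' \<in> carrier_mat n n" "R \<in> carrier_mat n n" "S \<in> carrier_mat n n" "g \<in> carrier_mat n n"
    using R' S' RS Lam_carrier GLQ_carrier[OF g] by auto
  have "R' * h * S' = (R' * R) * g * (S * S')"
    unfolding RS using c by (simp add: assoc_mult_mat[of _ n n _ n _ n])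
  also have "\<dots> = g" using R' S' c by simp
  finally show ?thesis using R' S' unfolding double_coset_eq by blast
qed

lemma double_coset_eqI:
  assumes g: "g \<in> carrier (GLQ n)" and h: "h \<in> double_coset n g"
  shows "double_coset n h = double_coset n g"
  using double_coset_subset[OF assms] double_coset_subset[OF double_coset_GL[OF assms] double_coset_sym[OF assms]]
  by blast

section \<open>Hermite normal form\<close>

text \<open>Because K contains M times the standard lattice, some vector of K starts at each
  position t. A vector with least positive leading entry is chosen there and then reduced by those
  starting later. The rows generate K by elimination from the left.\<close>

lemma hnf_exists:
  assumes K: "sbgp K" "K \<subseteq> ZZ n" and M: "(M::nat) > 0" "\<And>x. x \<in> ZZ n \<Longrightarrow> of_nat M * x \<in> K"
  shows "\<exists>C\<in>carrier_mat n n. upper_triangular C \<and> (\<forall>i<n. C $$ (i, i) > 0) \<and>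
    (\<forall>i j. i < j \<and> j < n \<longrightarrow> 0 \<le> C $$ (i, j) \<and> C $$ (i, j) < C $$ (j, j)) \<and> lat n (rat_mat C) = K"
proof -
  define S where "S t = {x \<in> K. \<forall>j<t. x j = 0}" for t
  define d where "d t = (LEAST d::nat. d > 0 \<and> (\<exists>x\<in>S t. x t = of_nat d))" for t
  \<comment> \<open>\<open>d t\<close> generates the ideal of leading coefficients of \<open>S t\<close>; it is the \<open>t\<close>-th diagonal entry.\<close>
  have sS: "sbgp (S t)" for t using K(1) by (auto simp: S_def sbgp_def)
  have int: "\<exists>z. x t = of_int z" if "x \<in> K" for x t
  proof (cases "t < n")
    case True
    then have "x t \<in> \<int>" using that K(2) by (auto simp: ZZ_def)
    then show ?thesis by (auto elim: Ints_cases)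
  next
    case False
    then have "x t = of_int 0" using that K(2) by (auto simp: ZZ_def VV_def)
    then show ?thesis by blast
  qed
  have "d t > 0 \<and> (\<exists>x\<in>S t. x t = of_nat (d t))" if t: "t < n" for t
    unfolding d_def
  proof (rule LeastI)
    have "of_nat M * unitv t \<in> S t" using M(2)[OF unitv_ZZ[OF t]] by (simp add: S_def unitv_def)
    then show "M > 0 \<and> (\<exists>x\<in>S t. x t = of_nat M)" using M(1) by (intro conjI bexI) (auto simp: unitv_def)
  qed
  then obtain b where dpos: "\<And>t. t < n \<Longrightarrow> d t > 0"
    and b: "\<And>t. t < n \<Longrightarrow> b t \<in> S t" "\<And>t. t < n \<Longrightarrow> b t t = of_nat (d t)"
    by metis
  \<comment> \<open>Division with remainder: a nonzero remainder would be a smaller positive leading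
    coefficient than \<open>d t\<close>.\<close>
  have divisible: "\<exists>q. x t = of_int q * of_nat (d t)" if t: "t < n" and x: "x \<in> S t" for x t
  proof -
    obtain z where z: "x t = of_int z" using int[of x t] x by (auto simp: S_def)
    define y where "y = x - of_int (z div int (d t)) * b t"
    have y: "y \<in> S t" unfolding y_def by (intro sbgp_diff[OF sS] x sbgp_of_int_mult[OF sS] b t)
    have "y t = of_int (z - z div int (d t) * int (d t))"
      unfolding y_def using z b(2)[OF t] by simp
    then have "y t = of_int (z mod int (d t))" by (simp only: minus_div_mult_eq_mod)
    then have yt: "y t = of_nat (nat (z mod int (d t)))" using dpos[OF t] by simp
    have "z mod int (d t) = 0"
    proof (rule ccontr)
      assume ne: "z mod int (d t) \<noteq> 0"
      have ge: "0 \<le> z mod int (d t)" using dpos[OF t] by simp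
      then have "nat (z mod int (d t)) > 0" using ne by linarith
      then have "d t \<le> nat (z mod int (d t))"
        unfolding d_def[of t] using y yt by (intro Least_le) (auto simp: d_def)
      moreover have "z mod int (d t) < int (d t)" using dpos[OF t] by simp
      ultimately show False using ge by (simp add: le_nat_iff)
    qed
    then have "z = z div int (d t) * int (d t)" by (metis div_mult_mod_eq add.right_neutral)
    then have "x t = of_int (z div int (d t)) * of_nat (d t)"
      using z by (metis of_int_mult of_int_of_nat_eq)
    then show ?thesis by blast
  qed
  \<comment> \<open>Entries are reduced from left to right. Subtracting a multiple of
    \<open>b m\<close> does not touch the columns before m, so earlier reductions survive.\<close>
  have "\<exists>c\<in>S t. c t = of_nat (d t) \<and> (\<forall>j. t < j \<and> j < m \<longrightarrow> 0 \<le> c j \<and> c j < of_nat (d j))"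
    if t: "t < n" "m \<le> n" for t m
    using t(2)
  proof (induction m)
    case 0
    then show ?case using b t(1) by auto
  next
    case (Suc m)
    then obtain c where c: "c \<in> S t" "c t = of_nat (d t)"
      "\<And>j. t < j \<Longrightarrow> j < m \<Longrightarrow> 0 \<le> c j \<and> c j < of_nat (d j)" by auto
    show ?case
    proof (cases "t < m")
      case False
      then show ?thesis using c by (intro bexI[of _ c]) auto
    next
      case True
      have m: "m < n" using Suc.prems by simp
      obtain z where z: "c m = of_int z" using int[of c m] c(1) by (auto simp: S_def)
      define c' where "c' = c - of_int (z div int (d m)) * b m"
      have "S m \<subseteq> S t" using True by (auto simp: S_def)
      then have c': "c' \<in> S t"
        unfolding c'_def using b(1)[OF m] by (intro sbgp_diff[OF sS] c sbgp_of_int_mult[OF sS]) auto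
      have same: "c' j = c j" if "j < m" for j
        unfolding c'_def using b(1)[OF m] that by (simp add: S_def)
      have "c' m = of_int (z - z div int (d m) * int (d m))"
        unfolding c'_def using z b(2)[OF m] by simp
      then have "c' m = of_int (z mod int (d m))" by (simp only: minus_div_mult_eq_mod)
      moreover have "0 \<le> z mod int (d m)" "z mod int (d m) < int (d m)" using dpos[OF m] by auto
      ultimately have "0 \<le> c' m \<and> c' m < of_nat (d m)" by (metis of_int_0_le_iff of_int_less_iff of_int_of_nat_eq)
      then show ?thesis using c' c(2,3) same True by (intro bexI[of _ c']) (auto simp: less_Suc_eq)
    qed
  qed
  then have "\<exists>c\<in>S t. c t = of_nat (d t) \<and> (\<forall>j. t < j \<and> j < n \<longrightarrow> 0 \<le> c j \<and> c j < of_nat (d j))"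
    if "t < n" for t using that by blast
  then have "\<forall>t. \<exists>c. t < n \<longrightarrow> c \<in> S t \<and> c t = of_nat (d t) \<and>
      (\<forall>j. t < j \<and> j < n \<longrightarrow> 0 \<le> c j \<and> c j < of_nat (d j))" by blast
  from choice[OF this] obtain c where c': "\<forall>t<n. c t \<in> S t \<and> c t t = of_nat (d t) \<and>
      (\<forall>j. t < j \<and> j < n \<longrightarrow> 0 \<le> c t j \<and> c t j < of_nat (d j))" by blast
  have c: "\<And>t. t < n \<Longrightarrow> c t \<in> S t" "\<And>t. t < n \<Longrightarrow> c t t = of_nat (d t)"
    "\<And>t j. t < j \<Longrightarrow> j < n \<Longrightarrow> 0 \<le> c t j \<and> c t j < of_nat (d j)"
    using c' by auto
  define C where "C = mat n n (\<lambda>(i, j). \<lfloor>c i j\<rfloor>)"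
  have Cc: "C \<in> carrier_mat n n" by (simp add: C_def)
  have cK: "c i \<in> K" if "i < n" for i using c(1)[OF that] by (simp add: S_def)
  have ent: "rat_of_int (C $$ (i, j)) = c i j" if ij: "i < n" "j < n" for i j
  proof -
    obtain z where "c i j = of_int z" using int cK[OF ij(1)] by blast
    then show ?thesis using ij by (simp add: C_def)
  qed
  have row: "rowv n (unitv i) (rat_mat C) = c i" if i: "i < n" for i
  proof
    fix j
    show "rowv n (unitv i) (rat_mat C) j = c i j"
      using ent[OF i] i Cc cK[OF i] K(2) by (auto simp: rowv_unitv ZZ_def VV_def)
  qed
  have "lat n (rat_mat C) = K"
  proof
    show "lat n (rat_mat C) \<subseteq> K"
    proof
      fix y assume "y \<in> lat n (rat_mat C)"
      then obtain x where x: "x \<in> ZZ n" "y = rowv n x (rat_mat C)" by (auto simp: lat_def)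
      have "\<forall>i. \<exists>z. i < n \<longrightarrow> x i = of_int z" using x(1) by (auto simp: ZZ_def elim: Ints_cases)
      then obtain z where z: "\<And>i. i < n \<Longrightarrow> x i = of_int (z i)" by metis
      have "y = (\<Sum>i<n. of_int (z i) * c i)"
      proof
        fix j
        have "y j = (\<Sum>i<n. of_int (z i) * c i j)"
        proof (cases "j < n")
          case True
          then show ?thesis unfolding x(2) rowv_def using z ent Cc by (auto intro!: sum.cong)
        next
          case False
          then have "c i j = 0" if "i < n" for i using cK[OF that] K(2) by (auto simp: ZZ_def VV_def)
          then show ?thesis unfolding x(2) rowv_def using False by simp
        qed
        then show "y j = (\<Sum>i<n. of_int (z i) * c i) j" by (simp add: sum_fun_apply)
      qed
      then show "y \<in> K" using K(1) cK by (auto intro!: sbgp_sum sbgp_of_int_mult)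
    qed
    \<comment> \<open>Subtracting the right multiple of row t moves x into the next
      \<open>S\<close>; at t = n only the zero vector remains.\<close>
    have "x \<in> S t \<Longrightarrow> x \<in> lat n (rat_mat C)" if "t \<le> n" for x t
      using that
    proof (induction "n - t" arbitrary: t x)
      case 0
      then have "t = n" by simp
      have "x \<in> ZZ n" using 0(2) K(2) by (auto simp: S_def)
      then have "x j = 0" for j
        using 0(2) \<open>t = n\<close> by (cases "j < n") (auto simp: S_def ZZ_def VV_def)
      then have "x = 0" by (simp add: fun_eq_iff)
      then show ?case using sbgp_zero[OF sbgp_lat] by metis
    next
      case (Suc k)
      then have t: "t < n" by simp
      obtain q where q: "x t = of_int q * of_nat (d t)" using divisible[OF t Suc.prems(1)] by blast
      define y where "y = x - of_int q * c t"
      have y: "y \<in> S t" unfolding y_def by (intro sbgp_diff[OF sS] Suc.prems sbgp_of_int_mult[OF sS] c t)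
      have "y t = 0" unfolding y_def using q c(2)[OF t] by simp
      then have "y \<in> S (Suc t)" using y by (auto simp: S_def less_Suc_eq)
      then have "y \<in> lat n (rat_mat C)" using Suc.hyps(1)[of "Suc t" y] Suc.hyps(2) t by simp
      moreover have "c t \<in> lat n (rat_mat C)"
        unfolding lat_def using row[OF t] unitv_ZZ[OF t] by (metis imageI)
      ultimately have "y + of_int q * c t \<in> lat n (rat_mat C)"
        using sbgp_add sbgp_of_int_mult sbgp_lat by blast
      then show ?case by (simp add: y_def)
    qed
    then have "x \<in> S 0 \<Longrightarrow> x \<in> lat n (rat_mat C)" for x by blast
    then show "K \<subseteq> lat n (rat_mat C)" by (auto simp: S_def)
  qed
  moreover have "upper_triangular C"
  proof
    fix i j assume "j < i" "i < dim_row C"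
    then have ij: "j < i" "i < n" using Cc by auto
    then have "c i j = 0" using c(1)[OF ij(2)] by (simp add: S_def)
    then show "C $$ (i, j) = 0" using ij by (simp add: C_def)
  qed
  moreover have "\<forall>i<n. C $$ (i, i) > 0"
    using c(2) dpos by (simp add: C_def)
  moreover have "\<forall>i j. i < j \<and> j < n \<longrightarrow> 0 \<le> C $$ (i, j) \<and> C $$ (i, j) < C $$ (j, j)"
  proof (intro allI impI)
    fix i j assume ij: "i < j \<and> j < n"
    then have "0 \<le> c i j" "c i j < c j j" using c(2,3) by auto
    then have "0 \<le> rat_of_int (C $$ (i, j))" "rat_of_int (C $$ (i, j)) < rat_of_int (C $$ (j, j))"
      using ent ij by auto
    then show "0 \<le> C $$ (i, j) \<and> C $$ (i, j) < C $$ (j, j)" by simp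
  qed
  ultimately show ?thesis using Cc by blast
qed

text \<open>Leading entries determine the diagonal up to mutual divisibility, hence exactly. Two
  rows with the same index are then compared from left to right: at the first possible difference
  the entries are congruent modulo the diagonal entry of that column and both reduced, so they
  agree.\<close>

lemma hnf_unique:
  assumes C: "C \<in> carrier_mat n n" "upper_triangular C" "\<And>i. i < n \<Longrightarrow> C $$ (i, i) > 0"
      "\<And>i j. i < j \<Longrightarrow> j < n \<Longrightarrow> 0 \<le> C $$ (i, j) \<and> C $$ (i, j) < C $$ (j, j)"
    and E: "E \<in> carrier_mat n n" "upper_triangular E" "\<And>i. i < n \<Longrightarrow> E $$ (i, i) > 0"
      "\<And>i j. i < j \<Longrightarrow> j < n \<Longrightarrow> 0 \<le> E $$ (i, j) \<and> E $$ (i, j) < E $$ (j, j)"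
    and eq: "lat n (rat_mat C) = lat n (rat_mat E)"
  shows "C = E"
proof -
  \<comment> \<open>Triangularity: if the first t entries of a lattice vector vanish, so do its
    first t coefficients, and the entry at t comes from row t alone.\<close>
  have lead: "\<exists>q::int. x t = of_int q * of_int (E $$ (t, t))"
    if x: "x \<in> lat n (rat_mat E)" "\<And>j. j < t \<Longrightarrow> x j = 0" and t: "t < n"
      and E: "E \<in> carrier_mat n n" "upper_triangular E" "\<And>i. i < n \<Longrightarrow> E $$ (i, i) > 0"
    for E :: "int mat" and x t
  proof -
    obtain y where y: "y \<in> ZZ n" "x = rowv n y (rat_mat E)" using x(1) by (auto simp: lat_def)
    have low: "x s = (\<Sum>i<n. if i = s then y s * of_int (E $$ (s, s)) else 0)"
      if s: "s < n" and ys: "\<And>i. i < s \<Longrightarrow> y i = 0" for s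
    proof -
      have "y i * rat_mat E $$ (i, s) = (if i = s then y s * of_int (E $$ (s, s)) else 0)" if i: "i < n" for i
      proof (cases i s rule: linorder_cases)
        case greater
        then have "E $$ (i, s) = 0" using upper_triangularD[OF E(2)] E(1) i by auto
        then show ?thesis using greater i \<open>s < n\<close> E(1) by simp
      qed (use i s ys E(1) in auto)
      then show ?thesis unfolding y(2) rowv_def using \<open>s < n\<close> by simp
    qed
    have "y s = 0" if "s < t" for s
      using that
    proof (induction s rule: less_induct)
      case (less s)
      then have "x s = y s * of_int (E $$ (s, s))" using low[of s] t by simp
      then show ?case using x(2)[OF less.prems] E(3)[of s] less.prems t by auto
    qed
    then have "x t = y t * of_int (E $$ (t, t))" using low[OF t] t by simp
    moreover have "y t \<in> \<int>" using y(1) t by (simp add: ZZ_def)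
    ultimately show ?thesis by (auto elim: Ints_cases)
  qed
  have rows: "(\<lambda>j. if j < n then rat_of_int (E $$ (i, j)) else 0) \<in> lat n (rat_mat E)"
    if "i < n" and E: "E \<in> carrier_mat n n" for i and E :: "int mat"
  proof -
    have "rowv n (unitv i) (rat_mat E) = (\<lambda>j. if j < n then rat_of_int (E $$ (i, j)) else 0)"
      using that by (auto simp: rowv_unitv fun_eq_iff)
    then show ?thesis unfolding lat_def using unitv_ZZ[OF that(1)] by (metis imageI)
  qed
  have dvd: "E $$ (t, t) dvd C $$ (t, t)"
    if t: "t < n" and C: "C \<in> carrier_mat n n" "upper_triangular C"
      and E: "E \<in> carrier_mat n n" "upper_triangular E" "\<And>i. i < n \<Longrightarrow> E $$ (i, i) > 0"
      and eq: "lat n (rat_mat C) = lat n (rat_mat E)"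
    for C E :: "int mat" and t
  proof -
    have "\<exists>q::int. (\<lambda>j. if j < n then rat_of_int (C $$ (t, j)) else 0) t = of_int q * of_int (E $$ (t, t))"
      using lead[OF _ _ t E, of "\<lambda>j. if j < n then rat_of_int (C $$ (t, j)) else 0"]
        rows[OF t C(1)] eq upper_triangularD[OF C(2)] C(1) t by auto
    then obtain q :: int where "rat_of_int (C $$ (t, t)) = of_int (q * E $$ (t, t))" using t by auto
    then have "C $$ (t, t) = q * E $$ (t, t)" by (simp only: of_int_eq_iff)
    then show ?thesis by simp
  qed
  have diag: "C $$ (t, t) = E $$ (t, t)" if t: "t < n" for t
    using dvd[OF t C(1,2) E(1,2) E(3) eq] dvd[OF t E(1,2) C(1,2) C(3) eq[symmetric]] C(3)[OF t] E(3)[OF t]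
    by (simp add: zdvd_antisym_nonneg)
  have rowdiff: "C $$ (i, j) = E $$ (i, j)" if i: "i < n" and j: "j < n" for i j
    using j
  proof (induction j rule: less_induct)
    case (less j)
    consider "j < i" | "j = i" | "i < j" by linarith
    then show ?case
    proof cases
      case 1
      then show ?thesis using upper_triangularD[OF C(2)] upper_triangularD[OF E(2)] C(1) E(1) i by auto
    next
      case 2
      then show ?thesis using diag i by simp
    next
      case 3
      define x where "x = (\<lambda>j. if j < n then rat_of_int (C $$ (i, j)) else 0)
        - (\<lambda>j. if j < n then rat_of_int (E $$ (i, j)) else 0)"
      have "x \<in> lat n (rat_mat E)"
        unfolding x_def using rows[OF i C(1)] rows[OF i E(1)] eq by (intro sbgp_diff[OF sbgp_lat]) auto
      moreover have "x k = 0" if "k < j" for k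
        using less.IH[OF that] that less.prems by (simp add: x_def)
      ultimately obtain q :: int where "x j = of_int q * of_int (E $$ (j, j))"
        using lead[OF _ _ less.prems E(1-3)] by blast
      then have "rat_of_int (C $$ (i, j) - E $$ (i, j)) = of_int (q * E $$ (j, j))"
        using less.prems by (simp add: x_def)
      then have q: "C $$ (i, j) - E $$ (i, j) = q * E $$ (j, j)" by (simp only: of_int_eq_iff)
      have "C $$ (i, j) mod E $$ (j, j) = E $$ (i, j) mod E $$ (j, j)"
        using q by (metis dvd_triv_right mod_eq_dvd_iff)
      then show ?thesis
        using C(4)[OF 3 less.prems] E(4)[OF 3 less.prems] diag[OF less.prems] by (metis mod_pos_pos_trivial)
    qed
  qed
  show ?thesis by (rule eq_matI) (use rowdiff C E in auto)
qed

section \<open>Diagonal lattices\<close>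

definition box :: "nat \<Rightarrow> (nat \<Rightarrow> nat) \<Rightarrow> (nat \<Rightarrow> rat) set" where
  "box n d = {x \<in> VV n. \<forall>i<n. x i / of_nat (d i) \<in> \<int>}"

lemma lat_diag_int:
  assumes "\<And>i. i < n \<Longrightarrow> z i \<noteq> 0"
  shows "lat n (mat_diag n (\<lambda>i. of_int (z i))) = box n (\<lambda>i. nat \<bar>z i\<bar>)"
proof (intro subset_antisym subsetI)
  fix y assume "y \<in> lat n (mat_diag n (\<lambda>i. of_int (z i)))"
  then obtain x where x: "x \<in> ZZ n" "y = (\<lambda>j. if j < n then x j * of_int (z j) else 0)"
    by (auto simp: lat_def rowv_diag)
  have "y i / of_nat (nat \<bar>z i\<bar>) = x i * of_int (sgn (z i))" if "i < n" for i
    using assms[OF that] that unfolding x(2) by (auto simp: sgn_if abs_if field_simps)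
  then show "y \<in> box n (\<lambda>i. nat \<bar>z i\<bar>)"
    using x by (auto simp: box_def VV_def ZZ_def intro!: Ints_mult)
next
  fix y assume y: "y \<in> box n (\<lambda>i. nat \<bar>z i\<bar>)"
  define x where "x = (\<lambda>j. if j < n then y j / of_int (z j) else 0)"
  have "x i \<in> \<int>" if "i < n" for i
  proof -
    have "x i = y i / of_nat (nat \<bar>z i\<bar>) * of_int (sgn (z i))"
      using assms[OF that] that by (auto simp: x_def sgn_if abs_if field_simps)
    moreover have "y i / of_nat (nat \<bar>z i\<bar>) \<in> \<int>" using y that by (simp add: box_def)
    ultimately show ?thesis by (metis Ints_mult Ints_of_int)
  qed
  then have "x \<in> ZZ n" by (auto simp: ZZ_def VV_def x_def)
  moreover have "y = rowv n x (mat_diag n (\<lambda>i. of_int (z i)))"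
    using y assms by (auto simp: rowv_diag fun_eq_iff x_def box_def VV_def)
  ultimately show "y \<in> lat n (mat_diag n (\<lambda>i. of_int (z i)))" by (auto simp: lat_def)
qed

lemma lat_diag_nat:
  assumes "\<And>i. i < n \<Longrightarrow> d i > 0"
  shows "lat n (mat_diag n (\<lambda>i. of_nat (d i))) = box n d"
  using lat_diag_int[of n "\<lambda>i. int (d i)"] assms by force

lemma sbgp_box: "sbgp (box n d)"
  by (auto simp: sbgp_def box_def VV_def diff_divide_distrib)

text \<open>The quotient is a product of cyclic groups of orders \<open>m i\<close>. Residues are
  stored as extensional functions on {..<n}, so that they are counted as a dependent
  product.\<close>

lemma idx_box:
  assumes "\<And>i. i < n \<Longrightarrow> d i > 0" "\<And>i. i < n \<Longrightarrow> m i > 0"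
  shows "idx (box n d) (box n (\<lambda>i. d i * m i)) = (\<Prod>i<n. m i)"
proof -
  define f where "f x = (\<lambda>i\<in>{..<n}. \<lfloor>x i / of_nat (d i)\<rfloor> mod int (m i))" for x :: "nat \<Rightarrow> rat"
  have "idx (box n d) (box n (\<lambda>i. d i * m i)) = card (f ` box n d)"
  proof (rule idx_eq_card[OF sbgp_box])
    fix x y assume xy: "x \<in> box n d" "y \<in> box n d"
    have "\<lfloor>x i / of_nat (d i)\<rfloor> mod int (m i) = \<lfloor>y i / of_nat (d i)\<rfloor> mod int (m i)
        \<longleftrightarrow> (x - y) i / of_nat (d i * m i) \<in> \<int>" if i: "i < n" for i
    proof -
      have "x i / of_nat (d i) \<in> \<int>" "y i / of_nat (d i) \<in> \<int>" using xy i by (auto simp: box_def)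
      then obtain a b where ab: "x i / of_nat (d i) = of_int a" "y i / of_nat (d i) = of_int b"
        by (auto elim!: Ints_cases)
      have "(x - y) i / of_nat (d i * m i) = (x i / of_nat (d i) - y i / of_nat (d i)) / of_nat (m i)"
        by (simp add: diff_divide_distrib)
      also have "\<dots> = of_int (a - b) / of_int (int (m i))" unfolding ab by simp
      finally have e: "(x - y) i / of_nat (d i * m i) = of_int (a - b) / of_int (int (m i))" .
      have "of_int (a - b) / (of_int (int (m i)) :: rat) \<in> \<int> \<longleftrightarrow> int (m i) dvd a - b"
      proof
        assume "of_int (a - b) / (of_int (int (m i)) :: rat) \<in> \<int>"
        then obtain k where "of_int (a - b) / (of_int (int (m i)) :: rat) = of_int k" by (auto elim: Ints_cases)
        then have "(of_int (a - b) :: rat) = of_int (k * int (m i))"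
          using assms(2)[OF i] by (simp add: field_simps)
        then have "a - b = k * int (m i)" by (simp only: of_int_eq_iff)
        then show "int (m i) dvd a - b" by simp
      next
        assume "int (m i) dvd a - b"
        then obtain k where "a - b = int (m i) * k" by (elim dvdE)
        then have "of_int (a - b) / (of_int (int (m i)) :: rat) = of_int k"
          using assms(2)[OF i] by (simp add: field_simps)
        then show "of_int (a - b) / (of_int (int (m i)) :: rat) \<in> \<int>" by simp
      qed
      then show ?thesis unfolding e ab by (simp add: mod_eq_dvd_iff)
    qed
    then have "f x = f y \<longleftrightarrow> (\<forall>i<n. (x - y) i / of_nat (d i * m i) \<in> \<int>)"
      unfolding f_def by (auto simp: fun_eq_iff restrict_def)
    also have "\<dots> \<longleftrightarrow> x - y \<in> box n (\<lambda>i. d i * m i)"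
      using sbgp_diff[OF sbgp_VV] xy by (auto simp: box_def)
    finally show "f x = f y \<longleftrightarrow> x - y \<in> box n (\<lambda>i. d i * m i)" .
  qed
  also have "f ` box n d = (\<Pi>\<^sub>E i\<in>{..<n}. {0..<int (m i)})"
  proof (intro subset_antisym subsetI)
    fix c assume c: "c \<in> (\<Pi>\<^sub>E i\<in>{..<n}. {0..<int (m i)})"
    define x where "x = (\<lambda>i. if i < n then of_int (c i) * rat_of_nat (d i) else 0)"
    have "x \<in> box n d" using assms(1) by (auto simp: box_def VV_def x_def)
    moreover have "f x = c"
    proof
      fix i
      show "f x i = c i"
      proof (cases "i < n")
        case True
        have "c i \<in> {0..<int (m i)}" using c True by (auto simp: PiE_iff)
        then show ?thesis using assms(1)[OF True] True by (simp add: f_def x_def)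
      next
        case False
        then show ?thesis using c by (auto simp: f_def PiE_iff extensional_def)
      qed
    qed
    ultimately show "c \<in> f ` box n d" by blast
  qed (use assms in \<open>auto simp: f_def split: if_splits\<close>)
  also have "card \<dots> = (\<Prod>i<n. m i)" by (simp add: card_PiE)
  finally show ?thesis .
qed

lemma lat_Lam: "P \<in> Lam n \<Longrightarrow> lat n P = ZZ n"
proof
  assume P: "P \<in> Lam n"
  obtain P' where P': "P' \<in> Lam n" "P' * P = 1\<^sub>m n" using Lam_inverse[OF P] by metis
  show "lat n P \<subseteq> ZZ n" using rowv_ZZ[OF _ Lam_imat[OF P]] by (auto simp: lat_def)
  show "ZZ n \<subseteq> lat n P"
  proof
    fix x assume x: "x \<in> ZZ n"
    have "rowv n (rowv n x P') P = x"
      using rowv_mult[OF Lam_carrier[OF P'(1)] Lam_carrier[OF P]] P'(2) rowv_one ZZ_VV[OF x] by simp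
    then show "x \<in> lat n P" unfolding lat_def using rowv_ZZ[OF x Lam_imat[OF P'(1)]] by (metis imageI)
  qed
qed

lemma lat_Lam_mult:
  assumes "P \<in> Lam n" "g \<in> carrier_mat n n"
  shows "lat n (P * g) = lat n g"
  using lat_mult[OF Lam_carrier[OF assms(1)] assms(2)] lat_Lam[OF assms(1)] by (simp add: lat_def)

text \<open>Of the two unimodular factors the left one leaves the lattice unchanged; the right one
  is the witness.\<close>

lemma lat_eqv:
  assumes "eqv_mat n C (mat_diag n d)"
  shows "\<exists>Q\<in>Lam n. lat n (rat_mat C) = (\<lambda>x. rowv n x Q) ` lat n (mat_diag n (\<lambda>i. of_int (d i)))"
proof -
  obtain P Q where PQ: "unim n P" "unim n Q" "C = P * mat_diag n d * Q"
    using assms by (auto simp: eqv_mat_def)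
  have c: "P \<in> carrier_mat n n" "Q \<in> carrier_mat n n" using PQ unim_carrier by auto
  have PQ': "rat_mat P \<in> Lam n" "rat_mat Q \<in> Lam n" using PQ by (auto simp: Lam_eq)
  define D where "D = mat_diag n (\<lambda>i. rat_of_int (d i))"
  have D: "rat_mat (mat_diag n d) = D" by (rule eq_matI) (auto simp: D_def mat_diag_def)
  have Dc: "D \<in> carrier_mat n n" by (simp add: D_def)
  have "rat_mat C = rat_mat P * D * rat_mat Q"
    unfolding PQ(3) D[symmetric] using c by (simp add: rat_mat_mult[of _ n])
  then have "lat n (rat_mat C) = (\<lambda>x. rowv n x (rat_mat Q)) ` lat n D"
    using lat_mult[of "rat_mat P * D" n "rat_mat Q"] lat_Lam_mult[OF PQ'(1) Dc] c Dc by simp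
  then show ?thesis using PQ'(2) unfolding D_def by blast
qed

lemma rowv_of_nat_mult: "rowv n (of_nat k * x) A = of_nat k * rowv n x A"
  by (auto simp: rowv_def fun_eq_iff sum_distrib_left mult.assoc)

lemma GLQ_inverse:
  assumes "g \<in> carrier (GLQ n)"
  obtains h where "h \<in> carrier (GLQ n)" "g * h = 1\<^sub>m n" "h * g = 1\<^sub>m n"
  using assms by (auto simp: GL_carrier)

lemma inj_rowv:
  assumes "g \<in> carrier (GLQ n)"
  shows "inj_on (\<lambda>x. rowv n x g) (VV n)"
proof (rule inj_onI)
  obtain h where h: "h \<in> carrier (GLQ n)" "g * h = 1\<^sub>m n" using GLQ_inverse[OF assms] by metis
  fix x y assume xy: "x \<in> VV n" "y \<in> VV n" "rowv n x g = rowv n y g"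
  then have "rowv n (rowv n x g) h = rowv n (rowv n y g) h" by simp
  then show "x = y"
    unfolding rowv_mult[OF GLQ_carrier[OF assms] GLQ_carrier[OF h(1)]] h(2) using rowv_one xy by simp
qed

section \<open>Lattices near a multiple of the standard one\<close>

text \<open>A multiset of exponents is split into the entries above, below and equal to e, the first
  two being recorded by their positive distances from e.\<close>

lemma mset_around:
  fixes M :: "nat multiset"
  shows "M = image_mset ((+) e) (image_mset (\<lambda>x. x - e) {#x \<in># M. e < x#})
    + image_mset ((-) e) (image_mset (\<lambda>x. e - x) {#x \<in># M. x < e#}) + replicate_mset (count M e) e"
proof (induction M)
  case (add x M)
  then show ?case by (cases x e rule: linorder_cases) auto
qed simp

lemma sum_mset_filter_diff:
  fixes M :: "nat multiset"
  shows "(\<Sum>x\<in>#M. x - e) = sum_mset (image_mset (\<lambda>x. x - e) {#x \<in># M. e < x#})"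
    and "(\<Sum>x\<in>#M. e - x) = sum_mset (image_mset (\<lambda>x. e - x) {#x \<in># M. x < e#})"
  by (induction M) auto

lemma mset_sum_1:
  fixes U :: "nat multiset"
  assumes "0 \<notin># U" "sum_mset U = 1"
  shows "U = {#1#}"
proof -
  have "U \<noteq> {#}" using assms by auto
  then obtain x V where U: "U = add_mset x V" by (metis multiset_cases)
  then have "x + sum_mset V = 1" "x \<noteq> 0" "0 \<notin># V" using assms by auto
  then have "x = 1" "sum_mset V = 0" by linarith+
  then have "V = {#}" using \<open>0 \<notin># V\<close> by (cases V) auto
  then show ?thesis using U \<open>x = 1\<close> by simp
qed

text \<open>The two partitions 1 + 1 and 2. For exponents they correspond to an elementary abelian
  and a cyclic quotient of order p^2.\<close>

lemma mset_sum_2: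
  fixes U :: "nat multiset"
  assumes "0 \<notin># U" "sum_mset U = 2"
  shows "U = (if \<forall>x\<in>#U. x \<le> 1 then {#1, 1#} else {#2#})"
proof -
  have "U \<noteq> {#}" using assms by auto
  then obtain x V where U: "U = add_mset x V" by (metis multiset_cases)
  then have s: "x + sum_mset V = 2" "x \<noteq> 0" "0 \<notin># V" using assms by auto
  then consider "x = 1" "sum_mset V = 1" | "x = 2" "sum_mset V = 0" by linarith
  then show ?thesis
  proof cases
    case 1
    then show ?thesis using mset_sum_1[OF s(3)] U by simp
  next
    case 2
    then have "V = {#}" using s(3) by (cases V) auto
    then show ?thesis using U 2 by simp
  qed
qed

lemma power_fun_apply [simp]: "((f :: 'a \<Rightarrow> 'b::comm_semiring_1) ^ k) x = f x ^ k"
  by (induction k) auto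

lemma box_cong: "(\<And>i. i < n \<Longrightarrow> d i = d' i) \<Longrightarrow> box n d = box n d'"
  by (auto simp: box_def)

locale gl_hecke =
  fixes n p :: nat
  assumes n4: "n \<ge> 4" and prime_p: "Factorial_Ring.prime p"

text \<open>The number p is a constant function here, so multiplication by it is scaling of vectors,
  and its inverse is the constant function 1/p.\<close>

sublocale gl_hecke \<subseteq> p_lattices p n "\<lambda>_::nat. 1 / of_nat p :: rat"
proof
  have "p > 0" using prime_p by (rule prime_gt_0_nat)
  then show "(\<lambda>_::nat. 1 / of_nat p :: rat) * of_nat p = 1" by (auto simp: fun_eq_iff)
  show "n \<ge> 2" using n4 by simp
qed (rule prime_p)

context gl_hecke
begin

definition pbox :: "(nat \<Rightarrow> nat) \<Rightarrow> (nat \<Rightarrow> rat) set" where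
  "pbox f = box n (\<lambda>i. p ^ f i)"

abbreviation pe :: "nat \<Rightarrow> (nat \<Rightarrow> rat) set" where
  "pe e \<equiv> pbox (\<lambda>_. e)"

lemma mem_pbox: "x \<in> pbox f \<longleftrightarrow> x \<in> VV n \<and> (\<forall>i<n. x i / of_nat p ^ f i \<in> \<int>)"
  by (simp add: pbox_def box_def)

lemma pbox_VV: "pbox f \<subseteq> VV n" by (auto simp: mem_pbox)

lemma sbgp_pbox: "sbgp (pbox f)" by (simp add: pbox_def sbgp_box)

lemma div_p_power: "k \<le> l \<Longrightarrow> x / (of_nat p :: rat) ^ l \<in> \<int> \<Longrightarrow> x / of_nat p ^ k \<in> \<int>"
proof -
  assume kl: "k \<le> l" and x: "x / (of_nat p :: rat) ^ l \<in> \<int>"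
  have "(of_nat p :: rat) ^ l = of_nat p ^ k * of_nat p ^ (l - k)" using kl by (simp flip: power_add)
  then have "x / of_nat p ^ k = x / of_nat p ^ l * of_nat (p ^ (l - k))" using p0 by simp
  then show ?thesis using x by (metis Ints_mult Ints_of_nat)
qed

lemma pbox_mono: "(\<And>i. i < n \<Longrightarrow> f i \<le> g i) \<Longrightarrow> pbox g \<subseteq> pbox f"
  unfolding mem_pbox subset_iff using div_p_power by blast

lemma pbox_subset_iff: "pbox g \<subseteq> pbox f \<longleftrightarrow> (\<forall>i<n. f i \<le> g i)"
proof
  assume sub: "pbox g \<subseteq> pbox f"
  show "\<forall>i<n. f i \<le> g i"
  proof (intro allI impI)
    fix i assume i: "i < n"
    define x where "x = (\<lambda>j. if j = i then rat_of_nat p ^ g i else 0)"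
    have "x \<in> pbox g" using i p0 by (auto simp: mem_pbox VV_def x_def)
    then have "x \<in> pbox f" using sub by blast
    then have "x i / of_nat p ^ f i \<in> \<int>" using i by (simp add: mem_pbox)
    then have "rat_of_nat p ^ g i / of_nat p ^ f i \<in> \<int>" by (simp add: x_def)
    then obtain z where "rat_of_nat p ^ g i / of_nat p ^ f i = of_int z" by (auto elim: Ints_cases)
    then have "rat_of_nat p ^ g i = of_int z * of_nat p ^ f i" using p0 by (simp add: field_simps)
    then have "(of_int (int p ^ g i) :: rat) = of_int (z * int p ^ f i)" by simp
    then have "int p ^ g i = z * int p ^ f i" by (simp only: of_int_eq_iff)
    then have "int p ^ f i dvd int p ^ g i" by simp
    then have "p ^ f i dvd p ^ g i" by (metis of_nat_dvd_iff of_nat_power)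
    then show "f i \<le> g i" using p1 power_dvd_imp_le by blast
  qed
qed (use pbox_mono in blast)

lemma pbox_Int: "pbox f \<inter> pbox g = pbox (\<lambda>i. max (f i) (g i))"
proof
  show "pbox f \<inter> pbox g \<subseteq> pbox (\<lambda>i. max (f i) (g i))" by (auto simp: mem_pbox max_def)
  show "pbox (\<lambda>i. max (f i) (g i)) \<subseteq> pbox f \<inter> pbox g"
    using pbox_mono[of f "\<lambda>i. max (f i) (g i)"] pbox_mono[of g "\<lambda>i. max (f i) (g i)"] by auto
qed

lemma idx_pbox:
  assumes "\<And>i. i < n \<Longrightarrow> f i \<le> g i"
  shows "idx (pbox f) (pbox g) = p ^ (\<Sum>i<n. g i - f i)"
proof -
  have "pbox g = box n (\<lambda>i. p ^ f i * p ^ (g i - f i))"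
    unfolding pbox_def using assms by (intro box_cong) (simp flip: power_add)
  then show ?thesis
    unfolding pbox_def[of f] using p0 by (simp add: idx_box power_sum)
qed

lemma pmul_pbox: "pmul (pbox f) = pbox (\<lambda>i. f i + 1)"
  using p0 by (auto simp: mem_pmul mem_pbox VV_def field_simps)

text \<open>With natural numbers as exponents, p^-1 p^e is written p^(e-1), which is correct for
  positive e.\<close>

lemma good_pe: "e > 0 \<Longrightarrow> good (pe e)"
proof -
  assume e: "e > 0"
  have "pe e = pmul (pe (e - 1))" using e by (simp add: pmul_pbox)
  then have "pinv (pe e) = pe (e - 1)" by (simp add: pinv_pmul)
  then show ?thesis using e by (simp add: good_def sbgp_pbox idx_pbox)
qed

text \<open>Truncated subtraction separates the positive and the negative part of f - e; they
  measure the two quotients by the intersection.\<close>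

lemma idx_pe:
  "idx (pe e) (pe e \<inter> pbox f) = p ^ (\<Sum>i<n. f i - e)"
  "idx (pbox f) (pe e \<inter> pbox f) = p ^ (\<Sum>i<n. e - f i)"
proof -
  have "max e (f i) - e = f i - e" "max e (f i) - f i = e - f i" for i by auto
  then show "idx (pe e) (pe e \<inter> pbox f) = p ^ (\<Sum>i<n. f i - e)"
    "idx (pbox f) (pe e \<inter> pbox f) = p ^ (\<Sum>i<n. e - f i)"
    unfolding pbox_Int by (simp_all add: idx_pbox)
qed

lemma adj_pe: "adj (pe e) (pbox f) \<longleftrightarrow> (\<Sum>i<n. f i - e) = 1 \<and> (\<Sum>i<n. e - f i) = 1"
proof -
  have "p ^ k = p \<longleftrightarrow> k = 1" for k using power_inject_exp[OF p1, of k 1] by simp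
  then show ?thesis by (simp add: adj_def idx_pe)
qed

lemma ty2_pe: "ty2 a b (pe e) (pbox f) \<longleftrightarrow> (\<Sum>i<n. f i - e) = 2 \<and> (\<Sum>i<n. e - f i) = 2 \<and>
    ((\<forall>i<n. f i \<le> e + 1) \<longleftrightarrow> a) \<and> ((\<forall>i<n. e \<le> f i + 1) \<longleftrightarrow> b)"
proof -
  have "p ^ k = p ^ 2 \<longleftrightarrow> k = 2" for k using power_inject_exp[OF p1, of k 2] by simp
  moreover have "pmul (pe e) \<subseteq> pe e \<inter> pbox f \<longleftrightarrow> (\<forall>i<n. f i \<le> e + 1)"
    "pmul (pbox f) \<subseteq> pe e \<inter> pbox f \<longleftrightarrow> (\<forall>i<n. e \<le> f i + 1)"
    unfolding pbox_Int pmul_pbox pbox_subset_iff by auto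
  ultimately show ?thesis by (simp add: ty2_def idx_pe)
qed

lemma idx_rowv:
  assumes "g \<in> carrier (GLQ n)" "sbgp N" "sbgp L" "N \<subseteq> L" "L \<subseteq> VV n"
  shows "idx ((\<lambda>x. rowv n x g) ` L) ((\<lambda>x. rowv n x g) ` N) = idx L N"
proof (rule idx_image[OF assms(2) _ assms(4,3)])
  show "sbgp ((\<lambda>x. rowv n x g) ` N)" by (rule sbgp_image[OF assms(2)]) (rule rowv_diff)
  show "inj_on (\<lambda>x. rowv n x g) L" by (rule inj_on_subset[OF inj_rowv[OF assms(1)] assms(5)])
qed (rule rowv_diff)

lemma pmul_rowv: "pmul ((\<lambda>x. rowv n x g) ` L) = (\<lambda>x. rowv n x g) ` pmul L"
  by (simp add: pmul_def image_image rowv_of_nat_mult)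

text \<open>Right multiplication by g is injective on \<open>VV n\<close> and commutes with p. It is
  stated for all rational g, because in products of double cosets one also multiplies by
  representatives outside \<open>Lam n\<close>.\<close>

lemma rowv_invariant:
  assumes g: "g \<in> carrier (GLQ n)" and L: "sbgp L" "L \<subseteq> VV n" and K: "sbgp K" "K \<subseteq> VV n"
  defines "T \<equiv> (`) (\<lambda>x. rowv n x g)"
  shows "adj (T L) (T K) \<longleftrightarrow> adj L K" "ty2 a b (T L) (T K) \<longleftrightarrow> ty2 a b L K"
proof -
  have I: "T L \<inter> T K = T (L \<inter> K)"
    unfolding T_def using inj_on_image_Int[OF inj_rowv[OF g] L(2) K(2)] by simp
  have i: "idx (T L) (T (L \<inter> K)) = idx L (L \<inter> K)" "idx (T K) (T (L \<inter> K)) = idx K (L \<inter> K)"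
    unfolding T_def
    using idx_rowv[OF g sbgp_Int[OF L(1) K(1)] L(1) _ L(2)] idx_rowv[OF g sbgp_Int[OF L(1) K(1)] K(1) _ K(2)]
    by simp_all
  have pv: "pmul A \<subseteq> VV n" if "A \<subseteq> VV n" for A
    using that by (auto simp: pmul_def VV_def)
  have m: "rowv n t g \<in> (\<lambda>x. rowv n x g) ` (L \<inter> K) \<longleftrightarrow> t \<in> L \<inter> K" if "t \<in> VV n" for t
    using inj_on_image_mem_iff[OF inj_rowv[OF g] that, of "L \<inter> K"] L by blast
  have "pmul (T A) \<subseteq> T (L \<inter> K) \<longleftrightarrow> pmul A \<subseteq> L \<inter> K" if "A \<subseteq> VV n" for A
    unfolding T_def pmul_rowv image_subset_iff[of _ "pmul A"] using m pv[OF that] by blast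
  then show "adj (T L) (T K) \<longleftrightarrow> adj L K" "ty2 a b (T L) (T K) \<longleftrightarrow> ty2 a b L K"
    unfolding adj_def ty2_def I i using L K by auto
qed

lemma rowv_pe_sub: "Q \<in> imat n \<Longrightarrow> (\<lambda>x. rowv n x Q) ` pe e \<subseteq> pe e"
proof
  fix y assume Q: "Q \<in> imat n" and "y \<in> (\<lambda>x. rowv n x Q) ` pe e"
  then obtain x where x: "x \<in> pe e" "y = rowv n x Q" by blast
  have "y j / of_nat p ^ e \<in> \<int>" if "j < n" for j
  proof -
    have "y j / of_nat p ^ e = (\<Sum>i<n. x i / of_nat p ^ e * Q $$ (i, j))"
      using that by (simp add: x(2) rowv_def sum_divide_distrib)
    also have "\<dots> \<in> \<int>" using x(1) Q that by (intro Ints_sum Ints_mult) (auto simp: mem_pbox imat_def)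
    finally show ?thesis .
  qed
  then show "y \<in> pe e" using rowv_VV x by (simp add: mem_pbox)
qed

lemma rowv_pe: "Q \<in> Lam n \<Longrightarrow> (\<lambda>x. rowv n x Q) ` pe e = pe e"
proof
  assume Q: "Q \<in> Lam n"
  obtain Q' where Q': "Q' \<in> Lam n" "Q' * Q = 1\<^sub>m n" using Lam_inverse[OF Q] by metis
  show "(\<lambda>x. rowv n x Q) ` pe e \<subseteq> pe e" by (rule rowv_pe_sub[OF Lam_imat[OF Q]])
  show "pe e \<subseteq> (\<lambda>x. rowv n x Q) ` pe e"
  proof
    fix x assume x: "x \<in> pe e"
    have "x \<in> VV n" using pbox_VV x by blast
    then have "rowv n (rowv n x Q') Q = x"
      using rowv_mult[OF Lam_carrier[OF Q'(1)] Lam_carrier[OF Q]] Q'(2) rowv_one by simp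
    moreover have "rowv n x Q' \<in> pe e" using rowv_pe_sub[OF Lam_imat[OF Q'(1)]] x by blast
    ultimately show "x \<in> (\<lambda>x. rowv n x Q) ` pe e" by (metis imageI)
  qed
qed

text \<open>Multiplying by the index p^s sends K into p^e times the standard lattice, and conversely
  sends the latter into K. With s \<le> e the first fact makes K integral; the second bounds K from
  below. Both are the hypotheses of \<open>hnf_exists\<close>.\<close>

lemma lattice_between:
  assumes K: "sbgp K" and s: "s \<le> e"
    and i: "idx (pe e) (pe e \<inter> K) = p ^ s" "idx K (pe e \<inter> K) = p ^ s"
  shows "K \<subseteq> ZZ n" and "\<And>x. x \<in> ZZ n \<Longrightarrow> of_nat (p ^ (s + e)) * x \<in> K"
proof -
  have N: "sbgp (pe e \<inter> K)" using sbgp_Int[OF sbgp_pbox K] .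
  show "K \<subseteq> ZZ n"
  proof
    fix x assume "x \<in> K"
    then have "of_nat (p ^ s) * x \<in> pe e" using idx_mult_mem[OF N K _ _ \<open>x \<in> K\<close>] i p0 by auto
    then have x: "of_nat (p ^ s) * x \<in> VV n" "\<And>j. j < n \<Longrightarrow> of_nat p ^ s * x j / of_nat p ^ e \<in> \<int>"
      by (auto simp: mem_pbox)
    have "x j \<in> \<int>" if "j < n" for j
    proof -
      have "(of_nat p :: rat) ^ e = of_nat p ^ s * of_nat p ^ (e - s)" using s by (simp flip: power_add)
      then have "x j = of_nat p ^ s * x j / of_nat p ^ e * of_nat (p ^ (e - s))" using p0 by simp
      then show ?thesis using x(2)[OF that] by (metis Ints_mult Ints_of_nat)
    qed
    then show "x \<in> ZZ n" using x(1) p0 by (auto simp: ZZ_def VV_def)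
  qed
  show "of_nat (p ^ (s + e)) * x \<in> K" if x: "x \<in> ZZ n" for x
  proof -
    have "of_nat (p ^ e) * x \<in> pe e" using x p0 by (auto simp: mem_pbox ZZ_def VV_def)
    then have "of_nat (idx (pe e) (pe e \<inter> K)) * (of_nat (p ^ e) * x) \<in> pe e \<inter> K"
      using i(1) p0 by (intro idx_mult_mem[OF N sbgp_pbox]) simp_all
    then have "of_nat (p ^ s) * (of_nat (p ^ e) * x) \<in> K" unfolding i(1) by blast
    moreover have "of_nat (p ^ s) * (of_nat (p ^ e) * x) = of_nat (p ^ (s + e)) * x"
      by (simp add: fun_eq_iff power_add mult.assoc)
    ultimately show ?thesis by simp
  qed
qed

text \<open>A basis of K from the Hermite form is diagonalized by the Smith form. Every diagonal
  entry divides a power of p, so up to sign it is one, and the lattice has the form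
  \<open>pbox f\<close>.\<close>

lemma lattice_normal_form:
  assumes K: "sbgp K" and s: "s \<le> e"
    and i: "idx (pe e) (pe e \<inter> K) = p ^ s" "idx K (pe e \<inter> K) = p ^ s"
  shows "\<exists>f. \<exists>Q\<in>Lam n. K = (\<lambda>x. rowv n x Q) ` pbox f"
proof -
  note KZ = lattice_between(1)[OF assms] and pK = lattice_between(2)[OF assms]
  have pos: "p ^ (s + e) > 0" using p0 by simp
  obtain C where C: "C \<in> carrier_mat n n" "lat n (rat_mat C) = K"
    using hnf_exists[OF K KZ pos pK] by blast
  obtain d where d: "eqv_mat n C (mat_diag n d)" using smith_normal_form[OF C(1)] by blast
  define D where "D = mat_diag n (\<lambda>i. rat_of_int (d i))"
  obtain Q where Q: "Q \<in> Lam n" and KD: "K = (\<lambda>x. rowv n x Q) ` lat n D"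
    using lat_eqv[OF d] C(2) unfolding D_def by blast
  \<comment> \<open>The multiple of the i-th unit vector by p^(s+e) lies in the diagonal lattice,
    since its image under Q lies in K.\<close>
  have dvd: "d i dvd int p ^ (s + e)" if i: "i < n" for i
  proof -
    define y where "y = of_nat (p ^ (s + e)) * unitv i"
    have "rowv n y Q = of_nat (p ^ (s + e)) * rowv n (unitv i) Q"
      unfolding y_def by (rule rowv_of_nat_mult)
    also have "\<dots> \<in> K" by (intro pK rowv_ZZ unitv_ZZ i Lam_imat Q)
    finally have "rowv n y Q \<in> (\<lambda>x. rowv n x Q) ` lat n D" unfolding KD .
    moreover have "y \<in> VV n" using i by (auto simp: y_def VV_def unitv_def)
    ultimately have "y \<in> lat n D"
      using inj_on_image_mem_iff[OF inj_rowv[OF Lam_GL[OF Q]] _ lat_VV] by blast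
    then obtain x where x: "x \<in> ZZ n" "y = rowv n x D" by (auto simp: lat_def)
    obtain z where z: "x i = of_int z" using x(1) i by (auto simp: ZZ_def elim: Ints_cases)
    have "y i = x i * of_int (d i)" using x(2) i by (simp add: D_def rowv_diag)
    then have "(of_int (int p ^ (s + e)) :: rat) = of_int (z * d i)" using z by (simp add: y_def unitv_def)
    then have "int p ^ (s + e) = z * d i" by (simp only: of_int_eq_iff)
    then show ?thesis by simp
  qed
  have "\<exists>k. nat \<bar>d i\<bar> = p ^ k" if "i < n" for i
  proof -
    have "nat \<bar>d i\<bar> dvd p ^ (s + e)" using dvd[OF that] by (simp add: nat_abs_dvd_iff)
    then show ?thesis using divides_primepow_nat[OF prime_p] by blast
  qed
  then obtain f where f: "\<And>i. i < n \<Longrightarrow> nat \<bar>d i\<bar> = p ^ f i" by metis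
  have "d i \<noteq> 0" if "i < n" for i using f[OF that] p0 by auto
  then have "lat n D = box n (\<lambda>i. nat \<bar>d i\<bar>)" unfolding D_def by (rule lat_diag_int)
  also have "\<dots> = pbox f" unfolding pbox_def by (rule box_cong) (rule f)
  finally show ?thesis using KD Q by blast
qed

text \<open>Permutation matrices belong to \<open>Lam n\<close>, so the order of the exponents does
  not matter for the orbit.\<close>

lemma pbox_permute:
  assumes "mset (map f [0..<n]) = mset es"
  shows "\<exists>Q\<in>Lam n. (\<lambda>x. rowv n x Q) ` pbox f = pbox ((!) es)"
proof -
  have len: "length es = n" using arg_cong[OF assms, of size] by simp
  obtain s where s: "s permutes {..<n}" "permute_list s es = map f [0..<n]"
    using mset_eq_permutation[OF assms] len by metis
  have f: "f i = es ! s i" if "i < n" for i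
    using arg_cong[OF s(2), of "\<lambda>l. l ! i"] permute_list_nth[of s es i] s(1) that len by simp
  have sn: "s i < n" if "i < n" for i using s(1) that permutes_in_image by fastforce
  have inj: "s i = s j \<longleftrightarrow> i = j" for i j using permutes_inj[OF s(1)] by (simp add: inj_eq)
  have surj: "\<exists>i<n. s i = j" if "j < n" for j
    using permutes_image[OF s(1)] that by (metis imageE lessThan_iff)
  define Q where "Q = mat n n (\<lambda>(i, j). if j = s i then 1 else (0::rat))"
  define Q' where "Q' = mat n n (\<lambda>(i, j). if i = s j then 1 else (0::rat))"
  have "Q * Q' = 1\<^sub>m n"
  proof (rule eq_matI)
    fix i j assume "i < dim_row (1\<^sub>m n :: rat mat)" "j < dim_col (1\<^sub>m n :: rat mat)"
    then have ij: "i < n" "j < n" by auto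
    have "(Q * Q') $$ (i, j) = (\<Sum>k<n. (if k = s i then 1 else 0) * (if k = s j then 1 else 0))"
      using ij by (simp add: Q_def Q'_def scalar_prod_def atLeast0LessThan)
    also have "\<dots> = (\<Sum>k<n. if k = s i then (if i = j then 1 else 0) else 0)"
      by (intro sum.cong) (auto simp: inj)
    also have "\<dots> = 1\<^sub>m n $$ (i, j)" using ij sn[OF ij(1)] by simp
    finally show "(Q * Q') $$ (i, j) = 1\<^sub>m n $$ (i, j)" .
  qed (auto simp: Q_def Q'_def)
  then have "Q \<in> Lam n" by (intro imat_inverse_Lam[of _ n Q']) (auto simp: imat_def Q_def Q'_def)
  moreover have rowQ: "rowv n x Q (s i) = x i" if "i < n" for x i
  proof -
    have "rowv n x Q (s i) = (\<Sum>k<n. if k = i then x k else 0)"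
    proof -
      have "(\<Sum>k<n. x k * Q $$ (k, s i)) = (\<Sum>k<n. if k = i then x k else 0)"
        using that sn by (intro sum.cong) (auto simp: Q_def inj)
      then show ?thesis using that sn by (simp add: rowv_def)
    qed
    then show ?thesis using that by simp
  qed
  have "(\<lambda>x. rowv n x Q) ` pbox f = pbox ((!) es)"
  proof (intro subset_antisym subsetI)
    fix y assume "y \<in> (\<lambda>x. rowv n x Q) ` pbox f"
    then obtain x where x: "x \<in> pbox f" "y = rowv n x Q" by blast
    have "y j / of_nat p ^ (es ! j) \<in> \<int>" if j: "j < n" for j
    proof -
      obtain i where i: "i < n" "s i = j" using surj[OF j] by blast
      then have "y j = x i" "es ! j = f i" using rowQ[of i x] x(2) f by auto
      then show ?thesis using x(1) i by (simp add: mem_pbox)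
    qed
    then show "y \<in> pbox ((!) es)" using rowv_VV x(2) by (simp add: mem_pbox)
  next
    fix y assume y: "y \<in> pbox ((!) es)"
    define x where "x = (\<lambda>i. if i < n then y (s i) else 0)"
    have "x \<in> pbox f" using y f sn by (auto simp: mem_pbox VV_def x_def)
    moreover have "rowv n x Q = y"
    proof
      fix j
      show "rowv n x Q j = y j"
      proof (cases "j < n")
        case True
        then obtain i where "i < n" "s i = j" using surj by blast
        then show ?thesis using rowQ[of i x] by (auto simp: x_def)
      next
        case False
        then show ?thesis using y by (auto simp: rowv_def mem_pbox VV_def)
      qed
    qed
    ultimately show "y \<in> (\<lambda>x. rowv n x Q) ` pbox f" by blast
  qed
  ultimately show ?thesis by blast
qed

end

lemma mset_around_1:
  fixes M :: "nat multiset"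
  assumes "e > 0" "(\<Sum>x\<in>#M. x - e) = 1" "(\<Sum>x\<in>#M. e - x) = 1"
  shows "M = {#e + 1, e - 1#} + replicate_mset (size M - 2) e"
proof -
  define U W where "U = image_mset (\<lambda>x. x - e) {#x \<in># M. e < x#}"
    and "W = image_mset (\<lambda>x. e - x) {#x \<in># M. x < e#}"
  have "0 \<notin># U" "0 \<notin># W" by (auto simp: U_def W_def)
  moreover have "sum_mset U = 1" "sum_mset W = 1"
    using assms(2,3) sum_mset_filter_diff[where M = M and e = e] by (simp_all add: U_def W_def)
  ultimately have "U = {#1#}" "W = {#1#}" using mset_sum_1 by blast+
  then have "M = {#e + 1, e - 1#} + replicate_mset (count M e) e"
    using mset_around[of M e] unfolding U_def[symmetric] W_def[symmetric] by (simp add: add_mset_commute)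
  then obtain k where "M = {#e + 1, e - 1#} + replicate_mset k e" by blast
  then show ?thesis by simp
qed

text \<open>\<open>A\<close> holds the exponents above e and \<open>B\<close> those below, two
  deviations by 1 or one by 2 on each side. All the others equal e, and their number is forced by
  the size.\<close>

lemma mset_around_2:
  fixes M :: "nat multiset"
  assumes "e > 1" "(\<Sum>x\<in>#M. x - e) = 2" "(\<Sum>x\<in>#M. e - x) = 2"
  defines "A \<equiv> if \<forall>x\<in>#M. x \<le> e + 1 then {#e + 1, e + 1#} else {#e + 2#}"
    and "B \<equiv> if \<forall>x\<in>#M. e \<le> x + 1 then {#e - 1, e - 1#} else {#e - 2#}"
  shows "M = A + B + replicate_mset (size M - size A - size B) e"
proof -
  define U W where "U = image_mset (\<lambda>x. x - e) {#x \<in># M. e < x#}"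
    and "W = image_mset (\<lambda>x. e - x) {#x \<in># M. x < e#}"
  have z: "0 \<notin># U" "0 \<notin># W" by (auto simp: U_def W_def)
  have U1: "(\<forall>x\<in>#U. x \<le> 1) \<longleftrightarrow> (\<forall>x\<in>#M. x \<le> e + 1)"
    unfolding U_def by (auto simp: not_less)
  have W1: "(\<forall>x\<in>#W. x \<le> 1) \<longleftrightarrow> (\<forall>x\<in>#M. e \<le> x + 1)"
    unfolding W_def by (auto simp: not_less)
  have "sum_mset U = 2" "sum_mset W = 2"
    using assms(2,3) sum_mset_filter_diff[where M = M and e = e] by (simp_all add: U_def W_def)
  from mset_sum_2[OF z(1) this(1)] mset_sum_2[OF z(2) this(2)]
  have "image_mset ((+) e) U = A" "image_mset ((-) e) W = B"
    unfolding U1 W1 A_def B_def by (simp_all split: if_splits)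
  then have "M = A + B + replicate_mset (count M e) e"
    using mset_around[of M e] unfolding U_def[symmetric] W_def[symmetric] by simp
  then obtain k where M: "M = A + B + replicate_mset k e" by blast
  then have "size M = size A + size B + k" by simp
  then have "k = size M - size A - size B" by simp
  then show ?thesis using M by metis
qed

lemma mset_map_upt: "mset (map f [0..<n]) = image_mset f (mset_set {..<n})"
  by (simp add: atLeast0LessThan)

lemma sum_nth_list: "length es = n \<Longrightarrow> (\<Sum>i<n. h (es ! i)) = sum_list (map h es)"
  by (simp add: sum_list_sum_nth atLeast0LessThan)

lemma all_nth_list: "length es = n \<Longrightarrow> (\<forall>i<n. P (es ! i)) \<longleftrightarrow> (\<forall>x\<in>set es. P x)"
  by (auto simp: all_set_conv_all_nth)

section \<open>Double cosets as relative positions of lattices\<close>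

context gl_hecke
begin

definition fd :: "(nat \<Rightarrow> nat) \<Rightarrow> rat mat" where
  "fd f = mat_diag n (\<lambda>i. of_nat (p ^ f i))"

definition dd :: "nat list \<Rightarrow> rat mat" where
  "dd es = diag (map ((^) p) es)"

lemma fd_GL: "fd f \<in> carrier (GLQ n)"
  unfolding GL_carrier
proof (intro conjI bexI)
  show "mat_diag n (\<lambda>i. 1 / of_nat (p ^ f i)) * fd f = 1\<^sub>m n" "fd f * mat_diag n (\<lambda>i. 1 / of_nat (p ^ f i)) = 1\<^sub>m n"
    using p0 by (simp_all add: fd_def)
qed (simp_all add: fd_def)

lemma lat_fd: "lat n (fd f) = pbox f"
  unfolding fd_def pbox_def using p0 by (intro lat_diag_nat) simp

lemma dd_fd: "length es = n \<Longrightarrow> dd es = fd ((!) es)"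
  by (rule eq_matI) (auto simp: dd_def fd_def diag_def mat_diag_def)

lemma mem_dc_dd:
  assumes "length es = n" "g \<in> carrier (GLQ n)"
  shows "g \<in> double_coset n (dd es) \<longleftrightarrow> (\<exists>Q\<in>Lam n. lat n g = (\<lambda>x. rowv n x Q) ` pbox ((!) es))"
  using mem_double_coset_iff[OF fd_GL assms(2)] dd_fd[OF assms(1)] lat_fd by simp

lemma dc_GL: "length es = n \<Longrightarrow> g \<in> double_coset n (dd es) \<Longrightarrow> g \<in> carrier (GLQ n)"
  using double_coset_GL[OF fd_GL] dd_fd by metis

lemma rowv_comp:
  assumes "Q \<in> Lam n" "Q' \<in> Lam n"
  shows "(\<lambda>x. rowv n x Q) ` (\<lambda>x. rowv n x Q') ` L = (\<lambda>x. rowv n x (Q' * Q)) ` L"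
  by (simp add: image_image rowv_mult Lam_carrier assms)

text \<open>The common argument for \<open>adj\<close> and \<open>ty2\<close>: the relation R is
  invariant under \<open>Lam n\<close>, each lattice satisfying it can be made diagonal, and then R
  fixes the exponents up to order. Hence such lattices form a single orbit, and the right cosets in
  the double coset correspond to them.\<close>

lemma orbit_characterization:
  assumes len: "length es = n"
    and inv: "\<And>Q K. Q \<in> Lam n \<Longrightarrow> sbgp K \<Longrightarrow> K \<subseteq> VV n \<Longrightarrow> R ((\<lambda>x. rowv n x Q) ` K) \<longleftrightarrow> R K"
    and base: "R (pbox ((!) es))"
    and nf: "\<And>K. sbgp K \<Longrightarrow> R K \<Longrightarrow> \<exists>f. \<exists>Q\<in>Lam n. K = (\<lambda>x. rowv n x Q) ` pbox f"
    and det: "\<And>f. R (pbox f) \<Longrightarrow> mset (map f [0..<n]) = mset es"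
  shows "g \<in> carrier (GLQ n) \<Longrightarrow> g \<in> double_coset n (dd es) \<longleftrightarrow> R (lat n g)"
    and "lat n ` double_coset n (dd es) = {K. sbgp K \<and> R K}"
    and "deg n (dd es) = card {K. sbgp K \<and> R K}"
proof -
  show 1: "g \<in> double_coset n (dd es) \<longleftrightarrow> R (lat n g)" if g: "g \<in> carrier (GLQ n)" for g
  proof
    assume "g \<in> double_coset n (dd es)"
    then obtain Q where "Q \<in> Lam n" "lat n g = (\<lambda>x. rowv n x Q) ` pbox ((!) es)"
      using mem_dc_dd[OF len g] by blast
    then show "R (lat n g)" using inv[OF _ sbgp_pbox pbox_VV] base by simp
  next
    assume R: "R (lat n g)"
    then obtain f Q where Q: "Q \<in> Lam n" "lat n g = (\<lambda>x. rowv n x Q) ` pbox f" using nf[OF sbgp_lat] by blast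
    then have "R (pbox f)" using R inv[OF _ sbgp_pbox pbox_VV] by simp
    then obtain S where S: "S \<in> Lam n" "(\<lambda>x. rowv n x S) ` pbox f = pbox ((!) es)" using pbox_permute[OF det] by blast
    obtain S' where S': "S' \<in> Lam n" "S * S' = 1\<^sub>m n" using Lam_inverse[OF S(1)] by metis
    have "(\<lambda>x. rowv n x S') ` pbox ((!) es) = (\<lambda>x. rowv n x (1\<^sub>m n)) ` pbox f"
      unfolding S(2)[symmetric] rowv_comp[OF S'(1) S(1)] S'(2) by simp
    also have "\<dots> = (\<lambda>x. x) ` pbox f" using pbox_VV rowv_one by (intro image_cong) auto
    finally have "lat n g = (\<lambda>x. rowv n x (S' * Q)) ` pbox ((!) es)"
      using Q rowv_comp[OF Q(1) S'(1), of "pbox ((!) es)"] by simp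
    then show "g \<in> double_coset n (dd es)" using mem_dc_dd[OF len g] Lam_mult[OF S'(1) Q(1)] by blast
  qed
  show 2: "lat n ` double_coset n (dd es) = {K. sbgp K \<and> R K}"
  proof (intro subset_antisym subsetI)
    fix K assume "K \<in> lat n ` double_coset n (dd es)"
    then show "K \<in> {K. sbgp K \<and> R K}" using 1 dc_GL[OF len] sbgp_lat by auto
  next
    fix K assume K: "K \<in> {K. sbgp K \<and> R K}"
    then obtain f Q where Q: "Q \<in> Lam n" "K = (\<lambda>x. rowv n x Q) ` pbox f" using nf by blast
    have g: "fd f * Q \<in> carrier (GLQ n)" using GLQ_mult fd_GL Lam_GL Q by blast
    have "lat n (fd f * Q) = K"
      using lat_mult[OF GLQ_carrier[OF fd_GL] Lam_carrier[OF Q(1)]] lat_fd Q(2) by simp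
    then show "K \<in> lat n ` double_coset n (dd es)" using 1[OF g] K by blast
  qed
  have "deg n (dd es) = card (lat n ` double_coset n (dd es))"
    unfolding deg_def right_cosets_in_def
    by (rule card_image_same_kernel) (intro right_coset_eq_iff dc_GL[OF len])
  then show "deg n (dd es) = card {K. sbgp K \<and> R K}" using 2 by simp
qed

text \<open>Exponents of the diagonal matrices whose lattices are in relative position \<open>adj\<close> to \<open>p\<^sup>e \<int>\<^sup>n\<close>,
  or \<open>ty2 a b\<close> to \<open>p\<^sup>2 \<int>\<^sup>n\<close>.\<close>

definition es1 :: "nat \<Rightarrow> nat list" where
  "es1 e = (e - 1) # replicate (n - 2) e @ [e + 1]"

text \<open>Exponents above 2 describe L/(L \<inter> K) for L = \<open>pe 2\<close>, so
  \<open>a\<close> chooses between 3, 3 (elementary abelian) and 4 (cyclic). Exponents below 2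
  describe K/(L \<inter> K), and \<open>b\<close> chooses between 1, 1 and 0.\<close>

definition es2 :: "bool \<Rightarrow> bool \<Rightarrow> nat list" where
  "es2 a b = (if b then [1, 1] else [0]) @
    replicate (n - (if b then 2 else 1) - (if a then 2 else 1)) 2 @ (if a then [3, 3] else [4])"

lemma length_es1: "length (es1 e) = n" using n4 by (simp add: es1_def)
lemma length_es2: "length (es2 a b) = n" using n4 by (auto simp: es2_def)

lemma adj_orbit:
  assumes e: "e > 0"
  shows "g \<in> carrier (GLQ n) \<Longrightarrow> g \<in> double_coset n (dd (es1 e)) \<longleftrightarrow> adj (pe e) (lat n g)"
    and "lat n ` double_coset n (dd (es1 e)) = {K. sbgp K \<and> adj (pe e) K}"
    and "deg n (dd (es1 e)) = card {K. sbgp K \<and> adj (pe e) K}"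
proof -
  have inv: "adj (pe e) ((\<lambda>x. rowv n x Q) ` K) \<longleftrightarrow> adj (pe e) K"
    if "Q \<in> Lam n" "sbgp K" "K \<subseteq> VV n" for Q K
    using rowv_invariant(1)[OF Lam_GL[OF that(1)] sbgp_pbox pbox_VV that(2,3)] rowv_pe[OF that(1)] by metis
  have base: "adj (pe e) (pbox ((!) (es1 e)))"
    unfolding adj_pe sum_nth_list[OF length_es1, of "\<lambda>x. x - e"] sum_nth_list[OF length_es1, of "\<lambda>x. e - x"]
    using e by (simp add: es1_def sum_list_replicate)
  have nf: "\<exists>f. \<exists>Q\<in>Lam n. K = (\<lambda>x. rowv n x Q) ` pbox f" if "sbgp K" "adj (pe e) K" for K
    using lattice_normal_form[of K 1 e] that e by (simp add: adj_def)
  have det: "mset (map f [0..<n]) = mset (es1 e)" if f: "adj (pe e) (pbox f)" for f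
  proof -
    define M where "M = mset (map f [0..<n])"
    have "(\<Sum>x\<in>#M. x - e) = 1" "(\<Sum>x\<in>#M. e - x) = 1"
      using f unfolding adj_pe M_def mset_map_upt by (simp_all add: sum_unfold_sum_mset image_mset.compositionality comp_def)
    from mset_around_1[OF e this] have "M = {#e + 1, e - 1#} + replicate_mset (n - 2) e" by (simp add: M_def)
    then show ?thesis unfolding M_def[symmetric] by (simp add: es1_def)
  qed
  note * = orbit_characterization[OF length_es1, where R = "adj (pe e)", OF inv base nf det]
  show "g \<in> carrier (GLQ n) \<Longrightarrow> g \<in> double_coset n (dd (es1 e)) \<longleftrightarrow> adj (pe e) (lat n g)"
    "lat n ` double_coset n (dd (es1 e)) = {K. sbgp K \<and> adj (pe e) K}"
    "deg n (dd (es1 e)) = card {K. sbgp K \<and> adj (pe e) K}"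
    by (rule *; assumption)+
qed

lemma ty2_orbit:
  shows "g \<in> carrier (GLQ n) \<Longrightarrow> g \<in> double_coset n (dd (es2 a b)) \<longleftrightarrow> ty2 a b (pe 2) (lat n g)"
    and "lat n ` double_coset n (dd (es2 a b)) = {K. sbgp K \<and> ty2 a b (pe 2) K}"
    and "deg n (dd (es2 a b)) = card {K. sbgp K \<and> ty2 a b (pe 2) K}"
proof -
  have inv: "ty2 a b (pe 2) ((\<lambda>x. rowv n x Q) ` K) \<longleftrightarrow> ty2 a b (pe 2) K"
    if "Q \<in> Lam n" "sbgp K" "K \<subseteq> VV n" for Q K
    using rowv_invariant(2)[OF Lam_GL[OF that(1)] sbgp_pbox pbox_VV that(2,3)] rowv_pe[OF that(1)] by metis
  have base: "ty2 a b (pe 2) (pbox ((!) (es2 a b)))"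
    unfolding ty2_pe sum_nth_list[OF length_es2, of "\<lambda>x. x - 2"] sum_nth_list[OF length_es2, of "\<lambda>x. 2 - x"]
      all_nth_list[OF length_es2, of "\<lambda>x. x \<le> 2 + 1"] all_nth_list[OF length_es2, of "\<lambda>x. 2 \<le> x + 1"]
    by (auto simp: es2_def sum_list_replicate)
  have nf: "\<exists>f. \<exists>Q\<in>Lam n. K = (\<lambda>x. rowv n x Q) ` pbox f" if "sbgp K" "ty2 a b (pe 2) K" for K
    using lattice_normal_form[of K 2 2] that by (simp add: ty2_def)
  have det: "mset (map f [0..<n]) = mset (es2 a b)" if f: "ty2 a b (pe 2) (pbox f)" for f
  proof -
    define M where "M = mset (map f [0..<n])"
    have s: "(\<Sum>x\<in>#M. x - 2) = 2" "(\<Sum>x\<in>#M. 2 - x) = 2"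
      using f unfolding ty2_pe M_def mset_map_upt by (simp_all add: sum_unfold_sum_mset image_mset.compositionality comp_def)
    have fl: "(\<forall>x\<in>#M. x \<le> 2 + 1) = a" "(\<forall>x\<in>#M. 2 \<le> x + 1) = b"
      using f unfolding ty2_pe M_def by auto
    have "size M = n" by (simp add: M_def)
    moreover have "1 < (2::nat)" by simp
    note mset_around_2[OF this s, unfolded fl]
    ultimately have "M = mset (es2 a b)" by (cases a; cases b) (simp_all add: es2_def numeral_eq_Suc)
    then show ?thesis unfolding M_def .
  qed
  note * = orbit_characterization[OF length_es2, where R = "ty2 a b (pe 2)", OF inv base nf det]
  show "g \<in> carrier (GLQ n) \<Longrightarrow> g \<in> double_coset n (dd (es2 a b)) \<longleftrightarrow> ty2 a b (pe 2) (lat n g)"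
    "lat n ` double_coset n (dd (es2 a b)) = {K. sbgp K \<and> ty2 a b (pe 2) K}"
    "deg n (dd (es2 a b)) = card {K. sbgp K \<and> ty2 a b (pe 2) K}"
    by (rule *; assumption)+
qed

text \<open>A multiple of the standard lattice is fixed by \<open>Lam n\<close>, so its orbit is a
  point.\<close>

lemma scalar_orbit:
  assumes "g \<in> carrier (GLQ n)"
  shows "g \<in> double_coset n (dd (replicate n e)) \<longleftrightarrow> lat n g = pe e"
proof -
  have "pbox ((!) (replicate n e)) = pe e" unfolding pbox_def by (rule box_cong) simp
  then have "g \<in> double_coset n (dd (replicate n e)) \<longleftrightarrow> (\<exists>Q\<in>Lam n. lat n g = (\<lambda>x. rowv n x Q) ` pe e)"
    using mem_dc_dd[OF _ assms, of "replicate n e"] by simp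
  also have "\<dots> \<longleftrightarrow> (\<exists>Q\<in>Lam n. lat n g = pe e)" by (rule bex_cong[OF refl]) (simp only: rowv_pe)
  finally show ?thesis using Lam_one by blast
qed

lemma deg_adj: "e > 0 \<Longrightarrow> deg n (dd (es1 e)) = br p n * (br p n - 1)"
  using adj_orbit(3) card_adj(2)[OF good_pe] by simp

lemma deg_ty2: "deg n (dd (es2 a b)) * (mult2 a * mult2 b) =
      br p n * (if a then br p (n - 1) else br p n - br p (n - 1)) *
      ((br p n - mult2 a) * (if b then br p (n - 1) - mult2 a else br p n - br p (n - 1)))"
  using ty2_orbit(3) card_ty2(2)[OF good_pe] by simp

end

section \<open>The product in the Hecke algebra\<close>

lemma complete_reps_exists: "\<exists>A. complete_reps n D A"
proof -
  obtain U where "U \<subseteq> D" "inj_on (right_coset n) U" "right_coset n ` D = right_coset n ` U"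
    using subset_image_inj[of "right_coset n ` D" "right_coset n" D] by auto
  then show ?thesis unfolding complete_reps_def right_cosets_in_def bij_betw_def by metis
qed

lemma coset_reps: "complete_reps n D (coset_reps n D)"
  unfolding coset_reps_def using complete_reps_exists by (rule someI_ex)

lemma mem_right_coset_iff:
  assumes "g \<in> carrier (GLQ n)" "h \<in> carrier (GLQ n)"
  shows "g \<in> right_coset n h \<longleftrightarrow> lat n g = lat n h"
  unfolding lat_eq_iff[OF assms] right_coset_eq by blast

context gl_hecke
begin

lemma adj_pmul:
  assumes "sbgp L" "sbgp K"
  shows "adj (pmul L) (pmul K) \<longleftrightarrow> adj L K"
proof -
  have "pmul L \<inter> pmul K = pmul (L \<inter> K)" by (auto simp: mem_pmul)
  then show ?thesis
    using idx_pmul[OF sbgp_Int[OF assms] assms(1)] idx_pmul[OF sbgp_Int[OF assms] assms(2)] by (simp add: adj_def)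
qed

lemma pmul_pe: "pmul (pe e) = pe (e + 1)" by (simp add: pmul_pbox)

lemma pe_0: "pe 0 = ZZ n" by (auto simp: mem_pbox ZZ_def)

lemma rowv_pe_1: "(\<lambda>x. rowv n x g) ` pe 1 = pmul (lat n g)"
  using pmul_pe[of 0] pe_0 pmul_rowv[of g "ZZ n"] by (simp add: lat_def)

abbreviation DD :: "rat mat set" where "DD \<equiv> double_coset n (dd (es1 1))"

lemma DD_GL: "g \<in> DD \<Longrightarrow> g \<in> carrier (GLQ n)"
  by (rule dc_GL[OF length_es1])

lemma DD_iff: "g \<in> carrier (GLQ n) \<Longrightarrow> g \<in> DD \<longleftrightarrow> adj (pe 1) (lat n g)"
  by (rule adj_orbit(1)) simp_all

text \<open>If \<open>h = ab\<close> then \<open>p \<int>\<^sup>n b\<close> is adjacent to both \<open>p\<^sup>2 \<int>\<^sup>n\<close> and \<open>\<int>\<^sup>n h\<close>.\<close>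

lemma product_common:
  assumes "a \<in> DD" "b \<in> DD" "lat n (a * b) = K"
  shows "pmul (lat n b) \<in> common (pe 2) K"
proof -
  have g: "a \<in> carrier (GLQ n)" "b \<in> carrier (GLQ n)" using assms DD_GL by auto
  have "adj (pe 1) (lat n a)" "adj (pe 1) (lat n b)" using assms(1,2) DD_iff g by auto
  then have "adj (pmul (lat n b)) ((\<lambda>x. rowv n x b) ` lat n a)" "adj (pmul (pe 1)) (pmul (lat n b))"
    using rowv_invariant(1)[OF g(2) sbgp_pbox pbox_VV sbgp_lat lat_VV, of "\<lambda>_. 1" a] rowv_pe_1[of b]
      adj_pmul[OF sbgp_pbox sbgp_lat] by simp_all
  moreover have "(\<lambda>x. rowv n x b) ` lat n a = K"
    using lat_mult[OF GLQ_carrier[OF g(1)] GLQ_carrier[OF g(2)]] assms(3) by simp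
  moreover have "pmul (pe 1) = pe 2" using pmul_pe[of 1] by (simp add: numeral_2_eq_2)
  ultimately show ?thesis unfolding common_def using sbgp_pmul[OF sbgp_lat] by simp
qed

text \<open>The converse of \<open>product_common\<close>: every common neighbour M arises from a
  pair of representatives. Replacing a matrix by the representative of its right coset keeps its
  lattice, also after multiplication from the right.\<close>

lemma common_product:
  assumes h: "h \<in> carrier (GLQ n)" and M: "M \<in> common (pe 2) (lat n h)"
    and A: "complete_reps n DD A"
  shows "\<exists>a\<in>A. \<exists>b\<in>A. pmul (lat n b) = M \<and> lat n (a * b) = lat n h"
proof -
  have M': "sbgp M" "adj (pe 2) M" "adj M (lat n h)" using M by (auto simp: common_def)
  have A': "A \<subseteq> DD" "right_coset n ` A = right_coset n ` DD"
    using A by (auto simp: complete_reps_def right_cosets_in_def bij_betw_def)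
  have rep: "\<exists>a\<in>A. lat n a = lat n c" if "c \<in> DD" for c
  proof -
    obtain a where "a \<in> A" "right_coset n a = right_coset n c" using A'(2) \<open>c \<in> DD\<close> by (metis imageE imageI)
    then show ?thesis using right_coset_eq_iff[OF DD_GL DD_GL[OF \<open>c \<in> DD\<close>], of a] A' by auto
  qed
  have "adj (pe 1) (pinv M)"
    using adj_pmul[OF sbgp_pbox sbgp_pinv[OF M'(1)], of "\<lambda>_. 1"] M'(2) pmul_pe[of 1]
    by (simp add: pmul_pinv numeral_2_eq_2)
  then have "pinv M \<in> lat n ` DD"
    using adj_orbit(2)[of 1] sbgp_pinv[OF M'(1)] by simp
  then obtain d where d: "d \<in> DD" "pinv M = lat n d" by blast
  then obtain b where b: "b \<in> A" "lat n b = pinv M" using rep[OF d(1)] by auto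
  have bG: "b \<in> carrier (GLQ n)" using b A' DD_GL by blast
  obtain b' where b': "b' \<in> carrier (GLQ n)" "b * b' = 1\<^sub>m n" "b' * b = 1\<^sub>m n" using GLQ_inverse[OF bG] by metis
  \<comment> \<open>Multiplication by b takes p times the standard lattice to M and the lattice of c
    = h b^-1 to that of h. The adjacency of M and h thus pulls back to membership of c in
    \<open>DD\<close>.\<close>
  define c where "c = h * b'"
  have c: "c \<in> carrier (GLQ n)" unfolding c_def using GLQ_mult h b' by blast
  have "c * b = h"
    unfolding c_def using GLQ_carrier[OF h] GLQ_carrier[OF b'(1)] GLQ_carrier[OF bG] b'(3)
    by (simp add: assoc_mult_mat[of _ n n _ n _ n])
  then have cb: "(\<lambda>x. rowv n x b) ` lat n c = lat n h"
    using lat_mult[OF GLQ_carrier[OF c] GLQ_carrier[OF bG]] by simp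
  have "adj ((\<lambda>x. rowv n x b) ` pe 1) ((\<lambda>x. rowv n x b) ` lat n c)"
    unfolding cb rowv_pe_1 b(2) pmul_pinv by (rule M'(3))
  then have "c \<in> DD"
    using rowv_invariant(1)[OF bG sbgp_pbox pbox_VV sbgp_lat lat_VV] DD_iff[OF c] by simp
  then obtain a where a: "a \<in> A" "lat n a = lat n c" using rep by blast
  have "a \<in> carrier (GLQ n)" using a A' DD_GL by blast
  then have "lat n (a * b) = lat n h"
    using lat_mult[OF GLQ_carrier GLQ_carrier[OF bG], of a] a(2) cb by simp
  then show ?thesis using a b pmul_pinv by metis
qed

text \<open>A pair (a, b) is recovered from M = p lat b: first b, since representatives have
  distinct lattices, then a, whose lattice is that of h moved back by b. The hypothesis
  \<open>hD\<close> matches the representative chosen in \<open>hecke_coeff\<close>.\<close>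

lemma hecke_coeff_common:
  assumes h: "h \<in> carrier (GLQ n)" and hD: "h = (SOME h. h \<in> D)"
  shows "hecke_coeff n DD DD D = card (common (pe 2) (lat n h))"
proof -
  define A where "A = coset_reps n DD"
  have A: "complete_reps n DD A" unfolding A_def by (rule coset_reps)
  then have A': "A \<subseteq> DD" "inj_on (right_coset n) A" by (auto simp: complete_reps_def bij_betw_def)
  have AG: "a \<in> carrier (GLQ n)" if "a \<in> A" for a using A' DD_GL that by blast
  have lat_inj: "a = b" if "a \<in> A" "b \<in> A" "lat n a = lat n b" for a b
    using inj_onD[OF A'(2)] right_coset_eq_iff[OF AG AG] that by blast
  define S where "S = {(a, b). a \<in> A \<and> b \<in> A \<and> lat n (a * b) = lat n h}"
  have "{(a, b). a \<in> A \<and> b \<in> A \<and> a \<otimes>\<^bsub>GLQ n\<^esub> b \<in> right_coset n h} = S"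
    unfolding S_def using mem_right_coset_iff[OF GLQ_mult[OF AG AG] h] by auto
  then have hc: "hecke_coeff n DD DD D = card S"
    unfolding hecke_coeff_def hD[symmetric] A_def[symmetric] by simp
  have "bij_betw (\<lambda>(a, b). pmul (lat n b)) S (common (pe 2) (lat n h))"
    unfolding bij_betw_def
  proof
    show "inj_on (\<lambda>(a, b). pmul (lat n b)) S"
    proof (rule inj_onI, clarify)
      fix a b a' b'
      assume S: "(a, b) \<in> S" "(a', b') \<in> S" "pmul (lat n b) = pmul (lat n b')"
      then have "lat n b = lat n b'" by (metis pinv_pmul)
      then have b: "b = b'" using S lat_inj by (auto simp: S_def)
      have m: "a \<in> A" "a' \<in> A" "b \<in> A" "lat n (a * b) = lat n (a' * b)" using S b by (auto simp: S_def)
      then have "(\<lambda>x. rowv n x b) ` lat n a = (\<lambda>x. rowv n x b) ` lat n a'"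
        using lat_mult[OF GLQ_carrier[OF AG] GLQ_carrier[OF AG[OF m(3)]]] by metis
      then have "lat n a = lat n a'"
        using inj_on_image_eq_iff[OF inj_rowv[OF AG[OF m(3)]] lat_VV lat_VV] by blast
      then show "a = a' \<and> b = b'" using lat_inj m b by blast
    qed
    show "(\<lambda>(a, b). pmul (lat n b)) ` S = common (pe 2) (lat n h)"
    proof (intro subset_antisym subsetI)
      fix M assume "M \<in> (\<lambda>(a, b). pmul (lat n b)) ` S"
      then obtain a b where "a \<in> A" "b \<in> A" "lat n (a * b) = lat n h" "M = pmul (lat n b)"
        by (auto simp: S_def)
      then show "M \<in> common (pe 2) (lat n h)" using product_common[of a b] A'(1) by blast
    next
      fix M assume "M \<in> common (pe 2) (lat n h)"
      then obtain a b where "a \<in> A" "b \<in> A" "pmul (lat n b) = M" "lat n (a * b) = lat n h"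
        using common_product[OF h _ A] by blast
      then show "M \<in> (\<lambda>(a, b). pmul (lat n b)) ` S" by (auto simp: S_def intro!: image_eqI[of _ _ "(a, b)"])
    qed
  qed
  then show ?thesis unfolding hc by (rule bij_betw_same_card)
qed

text \<open>Representatives reproduce h only up to a left factor P from \<open>Lam n\<close>; this
  factor is absorbed into the first element, since P a stays in \<open>DD\<close>.\<close>

lemma mem_product_iff:
  assumes h: "h \<in> carrier (GLQ n)"
  shows "h \<in> DD <#>\<^bsub>GLQ n\<^esub> DD \<longleftrightarrow> common (pe 2) (lat n h) \<noteq> {}"
proof
  assume "h \<in> DD <#>\<^bsub>GLQ n\<^esub> DD"
  then obtain a b where "a \<in> DD" "b \<in> DD" "h = a * b" by (auto simp: set_mult_def)
  then show "common (pe 2) (lat n h) \<noteq> {}" using product_common by blast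
next
  assume "common (pe 2) (lat n h) \<noteq> {}"
  then obtain M where "M \<in> common (pe 2) (lat n h)" by blast
  then obtain a b where ab: "a \<in> DD" "b \<in> DD" "lat n (a * b) = lat n h"
    using common_product[OF h _ coset_reps] coset_reps[of n DD] by (meson complete_reps_def subsetD)
  have abG: "a * b \<in> carrier (GLQ n)" using GLQ_mult DD_GL ab by blast
  obtain P where P: "P \<in> Lam n" "h = P * (a * b)" using lat_eq_iff[OF h abG] ab(3) by auto
  have c: "P \<in> carrier_mat n n" "a \<in> carrier_mat n n" "b \<in> carrier_mat n n"
    using P Lam_carrier ab DD_GL GLQ_carrier by auto
  have "h = (P * a) * b" unfolding P using c by (simp add: assoc_mult_mat[of _ n n _ n _ n])
  moreover have "P * a \<in> DD"
  proof -
    have "P * a = P * a * 1\<^sub>m n" using c by simp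
    then have "P * a \<in> double_coset n a" unfolding double_coset_eq using P Lam_one by blast
    then show ?thesis using double_coset_subset[OF fd_GL, of a "(!) (es1 1)"] ab(1) dd_fd[OF length_es1] by auto
  qed
  ultimately show "h \<in> DD <#>\<^bsub>GLQ n\<^esub> DD" using ab(2) by (auto simp: set_mult_def)
qed

text \<open>The index is the exponent of the intersection index with p^2 times the standard lattice:
  adjacent, equal, and index p^2 with the two flags.\<close>

definition E1 where "E1 = double_coset n (dd (es1 2))"
definition E0 where "E0 = double_coset n (dd (replicate n 2))"
definition E2 where "E2 a b = double_coset n (dd (es2 a b))"

lemma E_GL: "h \<in> E1 \<Longrightarrow> h \<in> carrier (GLQ n)" "h \<in> E0 \<Longrightarrow> h \<in> carrier (GLQ n)"
  "h \<in> E2 a b \<Longrightarrow> h \<in> carrier (GLQ n)"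
  unfolding E1_def E0_def E2_def using dc_GL[OF length_es1] dc_GL[OF length_es2] dc_GL[of "replicate n 2"] by auto

lemma E_iff:
  assumes "h \<in> carrier (GLQ n)"
  shows "h \<in> E1 \<longleftrightarrow> adj (pe 2) (lat n h)" "h \<in> E0 \<longleftrightarrow> lat n h = pe 2"
    "h \<in> E2 a b \<longleftrightarrow> ty2 a b (pe 2) (lat n h)"
  unfolding E1_def E0_def E2_def
  using adj_orbit(1)[OF _ assms] scalar_orbit[OF assms] ty2_orbit(1)[OF assms] by auto

lemma dd_mem: "length es = n \<Longrightarrow> dd es \<in> double_coset n (dd es)"
  using double_coset_refl[OF fd_GL] dd_fd by metis

lemma E_ne: "\<exists>h. h \<in> E1" "\<exists>h. h \<in> E0" "\<exists>h. h \<in> E2 a b"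
  unfolding E1_def E0_def E2_def
  using dd_mem[OF length_es1] dd_mem[OF length_es2] dd_mem[of "replicate n 2"] by auto

lemma card_common_E:
  shows "h \<in> E1 \<Longrightarrow> card (common (pe 2) (lat n h)) + (p + 3) = 2 * br p n"
    and "h \<in> E0 \<Longrightarrow> card (common (pe 2) (lat n h)) = br p n * (br p n - 1)"
    and "h \<in> E2 a b \<Longrightarrow> card (common (pe 2) (lat n h)) = mult2 a * mult2 b"
proof -
  show "card (common (pe 2) (lat n h)) + (p + 3) = 2 * br p n" if "h \<in> E1"
    using card_common_adj[OF good_pe sbgp_lat] E_iff(1)[OF E_GL(1)[OF that]] that by simp
  show "card (common (pe 2) (lat n h)) = br p n * (br p n - 1)" if "h \<in> E0"
    using card_adj(2)[OF good_pe, of 2] E_iff(2)[OF E_GL(2)[OF that]] that common_refl by simp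
  show "card (common (pe 2) (lat n h)) = mult2 a * mult2 b" if "h \<in> E2 a b"
    using card_common_ty2[OF sbgp_pbox sbgp_lat] E_iff(3)[OF E_GL(3)[OF that]] that by simp
qed

text \<open>Ensures that 2 \<open>br p n\<close> - (p + 3) and \<open>br p n\<close> - 1 are
  positive, so that the adjacent and the scalar double coset do occur in the product.\<close>

lemma br_lower: "br p n \<ge> p + 3" "br p n > 1"
proof -
  define k where "k = n - 3"
  have k: "n = Suc (Suc (Suc k))" unfolding k_def using n4 by arith
  have "p * (p * br p (Suc k)) \<ge> 2 * (2 * 1)"
    using p1 br_pos[of "Suc k" p] by (intro mult_le_mono) auto
  then show "br p n \<ge> p + 3" "br p n > 1"
    unfolding k br_Suc[of p "Suc (Suc k)"] br_Suc[of p "Suc k"] using p1 by (auto simp: add_mult_distrib2)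
qed

lemma E_sub: "E1 \<subseteq> DD <#>\<^bsub>GLQ n\<^esub> DD" "E0 \<subseteq> DD <#>\<^bsub>GLQ n\<^esub> DD" "E2 a b \<subseteq> DD <#>\<^bsub>GLQ n\<^esub> DD"
proof -
  have *: "h \<in> DD <#>\<^bsub>GLQ n\<^esub> DD" if "h \<in> carrier (GLQ n)" "card (common (pe 2) (lat n h)) > 0" for h
    using that mem_product_iff[OF that(1)] by auto
  show "E1 \<subseteq> DD <#>\<^bsub>GLQ n\<^esub> DD"
  proof
    fix h assume h: "h \<in> E1"
    show "h \<in> DD <#>\<^bsub>GLQ n\<^esub> DD"
      using card_common_E(1)[OF h] br_lower p1 by (intro *[OF E_GL(1)[OF h]]) linarith
  qed
  show "E0 \<subseteq> DD <#>\<^bsub>GLQ n\<^esub> DD"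
  proof
    fix h assume h: "h \<in> E0"
    show "h \<in> DD <#>\<^bsub>GLQ n\<^esub> DD"
      using card_common_E(2)[OF h] br_lower by (intro *[OF E_GL(2)[OF h]]) simp
  qed
  show "E2 a b \<subseteq> DD <#>\<^bsub>GLQ n\<^esub> DD"
  proof
    fix h assume h: "h \<in> E2 a b"
    show "h \<in> DD <#>\<^bsub>GLQ n\<^esub> DD"
      using card_common_E(3)[OF h] by (intro *[OF E_GL(3)[OF h]]) (simp add: mult2_def)
  qed
qed

text \<open>An element of the product has a common neighbour with p^2 times the standard lattice, so
  \<open>two_step_cases\<close> lists all possibilities; \<open>E_sub\<close> shows that each of
  them occurs.\<close>

lemma product_double_cosets:
  "{D \<in> double_cosets n. D \<subseteq> DD <#>\<^bsub>GLQ n\<^esub> DD} =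
    {E1, E0, E2 False False, E2 True False, E2 False True, E2 True True}"
proof (intro subset_antisym subsetI)
  fix D assume "D \<in> {D \<in> double_cosets n. D \<subseteq> DD <#>\<^bsub>GLQ n\<^esub> DD}"
  then obtain h where h: "h \<in> carrier (GLQ n)" "D = double_coset n h" "D \<subseteq> DD <#>\<^bsub>GLQ n\<^esub> DD"
    by (auto simp: double_cosets_def)
  then have "h \<in> DD <#>\<^bsub>GLQ n\<^esub> DD" using double_coset_refl by blast
  then obtain M where "M \<in> common (pe 2) (lat n h)" using mem_product_iff[OF h(1)] by blast
  then have "lat n h = pe 2 \<or> adj (pe 2) (lat n h) \<or> (\<exists>a b. ty2 a b (pe 2) (lat n h))"
    using two_step_cases[OF sbgp_pbox sbgp_lat] by blast
  then consider "h \<in> E1" | "h \<in> E0" | a b where "h \<in> E2 a b" using E_iff[OF h(1)] by blast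
  then have "D = E1 \<or> D = E0 \<or> (\<exists>a b. D = E2 a b)"
    unfolding h(2) E1_def E0_def E2_def
    using double_coset_eqI[OF fd_GL] dd_fd[OF length_es1] dd_fd[OF length_es2] dd_fd[of "replicate n 2"]
    by cases (metis length_replicate)+
  then show "D \<in> {E1, E0, E2 False False, E2 True False, E2 False True, E2 True True}"
    by (metis (full_types) insertCI)
next
  have "E1 \<in> double_cosets n" "E0 \<in> double_cosets n" "E2 a b \<in> double_cosets n" for a b
    unfolding double_cosets_def E1_def E0_def E2_def
    using fd_GL dd_fd[OF length_es1] dd_fd[OF length_es2] dd_fd[of "replicate n 2"] by auto
  then show "D \<in> {E1, E0, E2 False False, E2 True False, E2 False True, E2 True True} \<Longrightarrow>
      D \<in> {D \<in> double_cosets n. D \<subseteq> DD <#>\<^bsub>GLQ n\<^esub> DD}" for D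
    using E_sub by blast
qed

text \<open>The relative positions exclude each other. Distinctness lets the sum over the set of
  double cosets expand into six separate terms.\<close>

lemma E_distinct: "E1 \<noteq> E0" "E1 \<noteq> E2 a b" "E0 \<noteq> E2 a b" "E2 a b = E2 a' b' \<longleftrightarrow> a = a' \<and> b = b'"
proof -
  have p2: "p ^ 2 \<noteq> p" "p ^ 2 \<noteq> 1" using p1 by (auto simp: power2_eq_square)
  show "E1 \<noteq> E0" using E_ne(1) E_GL(1) E_iff(1,2) not_adj_refl[OF sbgp_pbox] by metis
  show "E1 \<noteq> E2 a b"
  proof
    assume "E1 = E2 a b"
    then obtain h where "adj (pe 2) (lat n h)" "ty2 a b (pe 2) (lat n h)" using E_ne(1) E_GL(1) E_iff(1,3) by metis
    then show False using p2 by (simp add: adj_def ty2_def)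
  qed
  show "E0 \<noteq> E2 a b"
  proof
    assume "E0 = E2 a b"
    then have "ty2 a b (pe 2) (pe 2)" using E_ne(2) E_GL(2) E_iff(2,3) by metis
    then show False using p2 idx_refl[OF sbgp_pbox] by (simp add: ty2_def)
  qed
  show "E2 a b = E2 a' b' \<longleftrightarrow> a = a' \<and> b = b'"
  proof
    assume "E2 a b = E2 a' b'"
    then obtain h where "ty2 a b (pe 2) (lat n h)" "ty2 a' b' (pe 2) (lat n h)" using E_ne(3) E_GL(3) E_iff(3) by metis
    then show "a = a' \<and> b = b'" unfolding ty2_def by blast
  qed simp
qed

lemma hecke_coeff_E:
  shows "hecke_coeff n DD DD E1 + (p + 3) = 2 * br p n"
    and "hecke_coeff n DD DD E0 = br p n * (br p n - 1)"
    and "hecke_coeff n DD DD (E2 a b) = mult2 a * mult2 b"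
proof -
  have s: "(SOME h. h \<in> E1) \<in> E1" "(SOME h. h \<in> E0) \<in> E0" "(SOME h. h \<in> E2 a b) \<in> E2 a b"
    by (rule someI_ex[OF E_ne(1)], rule someI_ex[OF E_ne(2)], rule someI_ex[OF E_ne(3)])
  show "hecke_coeff n DD DD E1 + (p + 3) = 2 * br p n"
    using hecke_coeff_common[OF E_GL(1)[OF s(1)] refl] card_common_E(1)[OF s(1)] by simp
  show "hecke_coeff n DD DD E0 = br p n * (br p n - 1)"
    using hecke_coeff_common[OF E_GL(2)[OF s(2)] refl] card_common_E(2)[OF s(2)] by simp
  show "hecke_coeff n DD DD (E2 a b) = mult2 a * mult2 b"
    using hecke_coeff_common[OF E_GL(3)[OF s(3)] refl] card_common_E(3)[OF s(3)] by simp
qed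

lemma hecke_square:
  "hecke_mult n (Poly_Mapping.single DD 1) (Poly_Mapping.single DD 1) =
    Poly_Mapping.single E1 (2 * int (br p n) - (int p + 3))
    + Poly_Mapping.single E0 (int (br p n * (br p n - 1)))
    + Poly_Mapping.single (E2 False False) 1
    + Poly_Mapping.single (E2 True False) (int p + 1)
    + Poly_Mapping.single (E2 False True) (int p + 1)
    + Poly_Mapping.single (E2 True True) ((int p + 1)^2)"
proof -
  have id: "Poly_Mapping.map (\<lambda>c. c) x = x" for x :: "rat mat set \<Rightarrow>\<^sub>0 int"
    by (rule poly_mapping_eqI) (simp add: Poly_Mapping.map.rep_eq when_def)
  have "hecke_mult n (Poly_Mapping.single DD 1) (Poly_Mapping.single DD 1) = hecke_mult_basis n DD DD"
    by (simp add: hecke_mult_def id)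
  also have "\<dots> = (\<Sum>D\<in>{E1, E0, E2 False False, E2 True False, E2 False True, E2 True True}.
      Poly_Mapping.single D (int (hecke_coeff n DD DD D)))"
    unfolding hecke_mult_basis_def product_double_cosets ..
  also have "\<dots> = Poly_Mapping.single E1 (int (hecke_coeff n DD DD E1))
    + Poly_Mapping.single E0 (int (hecke_coeff n DD DD E0))
    + Poly_Mapping.single (E2 False False) (int (hecke_coeff n DD DD (E2 False False)))
    + Poly_Mapping.single (E2 True False) (int (hecke_coeff n DD DD (E2 True False)))
    + Poly_Mapping.single (E2 False True) (int (hecke_coeff n DD DD (E2 False True)))
    + Poly_Mapping.single (E2 True True) (int (hecke_coeff n DD DD (E2 True True)))"
    using E_distinct by (simp add: add.assoc)
  also have "int (hecke_coeff n DD DD E1) = 2 * int (br p n) - (int p + 3)"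
    using hecke_coeff_E(1) by linarith
  finally show ?thesis
    unfolding hecke_coeff_E(2,3) by (simp add: mult2_def power2_eq_square algebra_simps)
qed

end

section \<open>Determinantal divisors\<close>

text \<open>Each term of the Leibniz formula takes one entry from every row.\<close>

lemma prod_dvd_det:
  fixes A :: "'a::comm_ring_1 mat"
  assumes A: "A \<in> carrier_mat k k" and c: "\<And>i j. i < k \<Longrightarrow> j < k \<Longrightarrow> c i dvd A $$ (i, j)"
  shows "(\<Prod>i<k. c i) dvd det A"
  unfolding det_def'[OF A]
proof (rule dvd_sum)
  fix s assume "s \<in> {s. s permutes {0..<k}}"
  then have "s i < k" if "i < k" for i using that permutes_in_image[of s "{0..<k}" i] by simp
  then have "(\<Prod>i\<in>{0..<k}. c i) dvd (\<Prod>i\<in>{0..<k}. A $$ (i, s i))"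
    using c by (intro prod_dvd_prod) auto
  then show "(\<Prod>i<k. c i) dvd signof s * (\<Prod>i\<in>{0..<k}. A $$ (i, s i))"
    by (simp add: atLeast0LessThan)
qed

text \<open>Rows and columns are selected by arbitrary maps, repetitions and any order allowed,
  because expanding a product multilinearly produces selections of this kind.\<close>

definition fminor :: "nat \<Rightarrow> int mat \<Rightarrow> (nat \<Rightarrow> nat) \<Rightarrow> (nat \<Rightarrow> nat) \<Rightarrow> int" where
  "fminor k A f g = det (mat k k (\<lambda>(a, b). A $$ (f a, g b)))"

definition minors_dvd :: "int \<Rightarrow> nat \<Rightarrow> nat \<Rightarrow> int mat \<Rightarrow> bool" where
  "minors_dvd m n k A \<longleftrightarrow> (\<forall>f g. (\<forall>a<k. f a < n \<and> g a < n) \<longrightarrow> m dvd fminor k A f g)"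

lemma fminor_transpose:
  assumes "A \<in> carrier_mat n n" "\<forall>a<k. f a < n" "\<forall>a<k. g a < n"
  shows "fminor k (transpose_mat A) g f = fminor k A f g"
proof -
  have "transpose_mat (mat k k (\<lambda>(a, b). A $$ (f a, g b))) = mat k k (\<lambda>(a, b). transpose_mat A $$ (g a, f b))"
    using assms by (intro eq_matI) auto
  then show ?thesis
    using det_transpose[of "mat k k (\<lambda>(a, b). A $$ (f a, g b))" k] by (simp add: fminor_def)
qed

lemma minors_dvd_transpose:
  assumes "A \<in> carrier_mat n n" "minors_dvd m n k A"
  shows "minors_dvd m n k (transpose_mat A)"
  using assms fminor_transpose[OF assms(1)] unfolding minors_dvd_def by metis

text \<open>The first half of the Cauchy-Binet formula: each row of the product is a combination of
  rows of A, and the determinant is linear in each row. The maps h are fixed to the identity outside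
  {0..<k} to make the sum finite.\<close>

lemma fminor_mult:
  assumes P: "P \<in> carrier_mat n n" and A: "A \<in> carrier_mat n n"
    and fg: "\<And>a. a < k \<Longrightarrow> f a < n" "\<And>a. a < k \<Longrightarrow> g a < n"
  shows "fminor k (P * A) f g =
    (\<Sum>h\<in>{h. (\<forall>i\<in>{0..<k}. h i \<in> {0..<n}) \<and> (\<forall>i. i \<notin> {0..<k} \<longrightarrow> h i = i)}.
      (\<Prod>i\<in>{0..<k}. P $$ (f i, h i)) * fminor k A h g)"
proof -
  define r where "r i c = P $$ (f i, c) \<cdot>\<^sub>v vec k (\<lambda>b. A $$ (c, g b))" for i c
  have "mat k k (\<lambda>(a, b). (P * A) $$ (f a, g b)) = mat\<^sub>r k k (\<lambda>i. finsum_vec TYPE(int) k (r i) {0..<n})"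
  proof (rule eq_matI)
    fix i j
    assume "i < dim_row (mat\<^sub>r k k (\<lambda>i. finsum_vec TYPE(int) k (r i) {0..<n}))"
      "j < dim_col (mat\<^sub>r k k (\<lambda>i. finsum_vec TYPE(int) k (r i) {0..<n}))"
    then have ij: "i < k" "j < k" by auto
    have "finsum_vec TYPE(int) k (r i) {0..<n} $ j = (\<Sum>c\<in>{0..<n}. r i c $ j)"
      using ij by (intro index_finsum_vec) (auto simp: r_def)
    then show "mat k k (\<lambda>(a, b). (P * A) $$ (f a, g b)) $$ (i, j) =
        mat\<^sub>r k k (\<lambda>i. finsum_vec TYPE(int) k (r i) {0..<n}) $$ (i, j)"
      using ij P A fg[OF ij(1)] fg[OF ij(2)] by (simp add: r_def scalar_prod_def)
  qed auto
  then have "fminor k (P * A) f g = (\<Sum>h\<in>{h. (\<forall>i\<in>{0..<k}. h i \<in> {0..<n}) \<and> (\<forall>i. i \<notin> {0..<k} \<longrightarrow> h i = i)}.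
      det (mat\<^sub>r k k (\<lambda>i. r i (h i))))"
    unfolding fminor_def by (simp only:) (rule det_linear_rows_sum; auto simp: r_def)
  also have "\<dots> = (\<Sum>h\<in>{h. (\<forall>i\<in>{0..<k}. h i \<in> {0..<n}) \<and> (\<forall>i. i \<notin> {0..<k} \<longrightarrow> h i = i)}.
      (\<Prod>i\<in>{0..<k}. P $$ (f i, h i)) * fminor k A h g)"
  proof (rule sum.cong[OF refl])
    fix h
    have "det (mat\<^sub>r k k (\<lambda>i. r i (h i))) =
        (\<Prod>i\<in>{0..<k}. P $$ (f i, h i)) * det (mat\<^sub>r k k (\<lambda>i. vec k (\<lambda>b. A $$ (h i, g b))))"
      unfolding r_def by (rule det_rows_mul) auto
    also have "mat\<^sub>r k k (\<lambda>i. vec k (\<lambda>b. A $$ (h i, g b))) = mat k k (\<lambda>(a, b). A $$ (h a, g b))"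
      by (rule eq_matI) auto
    finally show "det (mat\<^sub>r k k (\<lambda>i. r i (h i))) = (\<Prod>i\<in>{0..<k}. P $$ (f i, h i)) * fminor k A h g"
      by (simp add: fminor_def)
  qed
  finally show ?thesis .
qed

lemma minors_dvd_mult_left:
  assumes "P \<in> carrier_mat n n" "A \<in> carrier_mat n n" "minors_dvd m n k A"
  shows "minors_dvd m n k (P * A)"
  unfolding minors_dvd_def
proof (intro allI impI)
  fix f g :: "nat \<Rightarrow> nat" assume fg: "\<forall>a<k. f a < n \<and> g a < n"
  then have f: "f a < n" and g: "g a < n" if "a < k" for a using that by auto
  have eq: "fminor k (P * A) f g =
    (\<Sum>h\<in>{h. (\<forall>i\<in>{0..<k}. h i \<in> {0..<n}) \<and> (\<forall>i. i \<notin> {0..<k} \<longrightarrow> h i = i)}.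
      (\<Prod>i\<in>{0..<k}. P $$ (f i, h i)) * fminor k A h g)"
    using f g by (rule fminor_mult[OF assms(1,2)])
  show "m dvd fminor k (P * A) f g"
    unfolding eq
  proof (rule dvd_sum)
    fix h assume "h \<in> {h. (\<forall>i\<in>{0..<k}. h i \<in> {0..<n}) \<and> (\<forall>i. i \<notin> {0..<k} \<longrightarrow> h i = i)}"
    then have "m dvd fminor k A h g" using assms(3) g by (auto simp: minors_dvd_def)
    then show "m dvd (\<Prod>i\<in>{0..<k}. P $$ (f i, h i)) * fminor k A h g" by simp
  qed
qed

text \<open>The left factor is covered by \<open>minors_dvd_mult_left\<close>, the right one by the
  same lemma after transposing.\<close>

lemma minors_dvd_eqv:
  assumes "eqv_mat n A B" "minors_dvd m n k B"
  shows "minors_dvd m n k A"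
proof -
  obtain P Q where PQ: "unim n P" "unim n Q" "A = P * B * Q" and B: "B \<in> carrier_mat n n"
    using assms by (auto simp: eqv_mat_def)
  have c: "P \<in> carrier_mat n n" "Q \<in> carrier_mat n n" "P * B \<in> carrier_mat n n"
    using PQ(1,2)[THEN unim_carrier] B by auto
  have "minors_dvd m n k (transpose_mat Q * transpose_mat (P * B))"
    using c B assms(2) by (intro minors_dvd_mult_left minors_dvd_transpose[of _ n]) auto
  then have "minors_dvd m n k (transpose_mat A)"
    unfolding PQ(3) using transpose_mult[OF c(3,2)] by simp
  moreover have "A \<in> carrier_mat n n" using eqv_mat_carrier[OF assms(1)] by simp
  ultimately show ?thesis using minors_dvd_transpose[of "transpose_mat A" n m k] by simp
qed

lemma fminor_not_inj:
  assumes "\<not> inj_on f {..<k}"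
  shows "fminor k A f g = 0"
proof -
  obtain a b where ab: "a < k" "b < k" "a \<noteq> b" "f a = f b" using assms by (auto simp: inj_on_def)
  then show ?thesis
    unfolding fminor_def by (intro det_identical_rows[of _ k a b]) auto
qed

text \<open>An injective selection differs from the increasing enumeration of its image by a
  permutation, which changes the determinant by a sign; a repeated row gives 0.\<close>

lemma fminor_pick:
  assumes A: "A \<in> carrier_mat n n" and f: "\<And>a. a < k \<Longrightarrow> f a < n"
    and dvd: "\<And>I. I \<subseteq> {..<n} \<Longrightarrow> card I = k \<Longrightarrow> m dvd fminor k A (pick I) g"
  shows "m dvd fminor k A f g"
proof (cases "inj_on f {..<k}")
  case False
  then show ?thesis by (simp add: fminor_not_inj)
next
  case True
  define I where "I = f ` {..<k}"
  have I: "I \<subseteq> {..<n}" "card I = k" "finite I" unfolding I_def using f True by (auto simp: card_image)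
  \<comment> \<open>The rank of \<open>f a\<close> within the selected set, which is its position in
    the increasing enumeration.\<close>
  define s where "s a = (if a < k then card {x \<in> I. x < f a} else a)" for a
  have ps: "pick I (s a) = f a" if "a < k" for a
    unfolding s_def using that pick_card_in_set[of "f a" I] by (auto simp: I_def)
  have "s a < k" if "a < k" for a
  proof -
    have "{x \<in> I. x < f a} \<subset> I" using that by (auto simp: I_def)
    then show ?thesis using psubset_card_mono[OF I(3)] I(2) that by (simp add: s_def)
  qed
  then have "s ` {0..<k} \<subseteq> {0..<k}" by auto
  moreover have "inj_on s {0..<k}"
    using ps True by (auto simp: inj_on_def) (metis lessThan_iff)
  ultimately have "bij_betw s {0..<k} {0..<k}"
    using endo_inj_surj[of "{0..<k}" s] by (simp add: bij_betw_def)
  then have "s permutes {0..<k}" by (rule bij_imp_permutes) (simp add: s_def)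
  from det_permute_rows[OF _ this, of "mat k k (\<lambda>(a, b). A $$ (pick I a, g b))"]
  have "det (mat k k (\<lambda>(i, j). mat k k (\<lambda>(a, b). A $$ (pick I a, g b)) $$ (s i, j))) = signof s * fminor k A (pick I) g"
    by (simp add: fminor_def)
  moreover have "mat k k (\<lambda>(i, j). mat k k (\<lambda>(a, b). A $$ (pick I a, g b)) $$ (s i, j)) = mat k k (\<lambda>(a, b). A $$ (f a, g b))"
    using \<open>s ` {0..<k} \<subseteq> {0..<k}\<close> ps by (intro eq_matI) (auto simp: image_subset_iff)
  ultimately have "fminor k A f g = signof s * fminor k A (pick I) g" by (simp add: fminor_def)
  then show ?thesis using dvd[OF I(1,2)] by simp
qed

lemma pick_less: "I \<subseteq> {..<n} \<Longrightarrow> card I = k \<Longrightarrow> a < k \<Longrightarrow> pick I a < n"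
  using pick_in_set_le[of a I] by auto

text \<open>Replaces the gcd over submatrices by a divisibility statement that behaves well under
  products. Rows are passed to arbitrary selections first, columns afterwards through the
  transpose.\<close>

lemma dvd_det_divisor_iff:
  assumes A: "A \<in> carrier_mat n n"
  shows "m dvd det_divisor k A \<longleftrightarrow> minors_dvd m n k A"
proof -
  have sub: "det (submatrix A I J) = fminor k A (pick I) (pick J)"
    if "I \<subseteq> {..<n}" "J \<subseteq> {..<n}" "card I = k" "card J = k" for I J
  proof -
    have "{i. i < dim_row A \<and> i \<in> I} = I" "{j. j < dim_col A \<and> j \<in> J} = J" using that A by auto
    then show ?thesis using that by (simp add: submatrix_def fminor_def)
  qed
  have "m dvd det_divisor k A \<longleftrightarrow> (\<forall>I J. I \<subseteq> {..<n} \<and> J \<subseteq> {..<n} \<and> card I = k \<and> card J = k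
      \<longrightarrow> m dvd det (submatrix A I J))"
    unfolding det_divisor_def dvd_Gcd_iff using A by auto
  also have "\<dots> \<longleftrightarrow> (\<forall>I J. I \<subseteq> {..<n} \<and> J \<subseteq> {..<n} \<and> card I = k \<and> card J = k
      \<longrightarrow> m dvd fminor k A (pick I) (pick J))"
    using sub by metis
  also have "\<dots> \<longleftrightarrow> minors_dvd m n k A"
  proof
    assume *: "\<forall>I J. I \<subseteq> {..<n} \<and> J \<subseteq> {..<n} \<and> card I = k \<and> card J = k
      \<longrightarrow> m dvd fminor k A (pick I) (pick J)"
    show "minors_dvd m n k A"
      unfolding minors_dvd_def
    proof (intro allI impI)
      fix f g :: "nat \<Rightarrow> nat" assume fg: "\<forall>a<k. f a < n \<and> g a < n"
      have 1: "m dvd fminor k A f (pick J)" if "J \<subseteq> {..<n}" "card J = k" for J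
      proof (rule fminor_pick[OF A])
        fix I assume "I \<subseteq> {..<n}" "card I = k"
        then show "m dvd fminor k A (pick I) (pick J)" using * that by blast
      qed (use fg in blast)
      have "m dvd fminor k (transpose_mat A) g f"
      proof (rule fminor_pick[of _ n])
        fix J assume J: "J \<subseteq> {..<n}" "card J = k"
        show "m dvd fminor k (transpose_mat A) (pick J) f"
          using 1[OF J] fminor_transpose[OF A, of k f "pick J"] fg pick_less[OF J] by auto
      qed (use A fg in auto)
      then show "m dvd fminor k A f g" using fminor_transpose[OF A, of k f g] fg by simp
    qed
  next
    assume "minors_dvd m n k A"
    then show "\<forall>I J. I \<subseteq> {..<n} \<and> J \<subseteq> {..<n} \<and> card I = k \<and> card J = k
      \<longrightarrow> m dvd fminor k A (pick I) (pick J)"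
      unfolding minors_dvd_def using pick_less by auto
  qed
  finally show ?thesis .
qed

lemma det_divisor_nonneg: "det_divisor k A \<ge> 0"
  unfolding det_divisor_def by (rule Gcd_int_greater_eq_0)

text \<open>A nonnegative gcd is determined by its divisors, and these are the same for equivalent
  matrices.\<close>

lemma det_divisor_eqv:
  assumes "eqv_mat n A B"
  shows "det_divisor k A = det_divisor k B"
proof (rule zdvd_antisym_nonneg[OF det_divisor_nonneg det_divisor_nonneg])
  have c: "A \<in> carrier_mat n n" "B \<in> carrier_mat n n" using eqv_mat_carrier[OF assms] by auto
  show "det_divisor k A dvd det_divisor k B" "det_divisor k B dvd det_divisor k A"
    using minors_dvd_eqv[OF assms] minors_dvd_eqv[OF eqv_mat_sym[OF assms]]
      dvd_det_divisor_iff[OF c(1)] dvd_det_divisor_iff[OF c(2)] by (metis dvd_refl)+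
qed

lemma fminor_diag_dvd:
  assumes "\<And>a. a < k \<Longrightarrow> f a < n" "\<And>a. a < k \<Longrightarrow> g a < n"
  shows "(\<Prod>a<k. d (f a)) dvd fminor k (mat_diag n d) f g"
  unfolding fminor_def using assms by (intro prod_dvd_det) (auto simp: mat_diag_def)

lemma fminor_diag_inj:
  assumes "\<And>a. a < k \<Longrightarrow> f a < n" "inj_on f {..<k}"
  shows "fminor k (mat_diag n d) f f = (\<Prod>a<k. d (f a))"
proof -
  define M where "M = mat k k (\<lambda>(a, b). mat_diag n d $$ (f a, f b))"
  have M: "M \<in> carrier_mat k k" by (simp add: M_def)
  have "upper_triangular M"
  proof
    fix i j assume "j < i" "i < dim_row M"
    then have ij: "j < i" "i < k" using M by auto
    then have "f i \<noteq> f j" using inj_onD[OF assms(2), of i j] by auto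
    then show "M $$ (i, j) = 0" using assms(1) ij by (simp add: M_def mat_diag_def)
  qed
  then have "det M = (\<Prod>i\<in>{0..<k}. M $$ (i, i))"
    using det_upper_triangular[OF _ M] M by (simp add: prod_list_diag_prod)
  also have "\<dots> = (\<Prod>a<k. d (f a))"
    using assms(1) by (simp add: M_def mat_diag_def atLeast0LessThan)
  finally show ?thesis by (simp add: fminor_def M_def)
qed

lemma fminor_1: "fminor 1 A f g = A $$ (f 0, g 0)"
  unfolding fminor_def by (subst det_single) auto

lemma minors_dvd_1: "minors_dvd m n 1 A \<longleftrightarrow> (\<forall>i<n. \<forall>j<n. m dvd A $$ (i, j))"
proof
  assume *: "minors_dvd m n 1 A"
  show "\<forall>i<n. \<forall>j<n. m dvd A $$ (i, j)"
  proof (intro allI impI)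
    fix i j assume "i < n" "j < n"
    then have "m dvd fminor 1 A (\<lambda>_. i) (\<lambda>_. j)" using * by (auto simp: minors_dvd_def)
    then show "m dvd A $$ (i, j)" by (simp only: fminor_1)
  qed
qed (unfold minors_dvd_def fminor_1, simp)

lemma GLQ_of_det:
  assumes A: "A \<in> carrier_mat n n" and "det A \<noteq> 0"
  shows "A \<in> carrier (GLQ n)"
proof -
  define B where "B = (1 / det A) \<cdot>\<^sub>m adj_mat A"
  note a = adj_mat[OF A]
  have "B \<in> carrier_mat n n" using a by (simp add: B_def)
  moreover have e: "(1 / det A) \<cdot>\<^sub>m (det A \<cdot>\<^sub>m 1\<^sub>m n) = 1\<^sub>m n" using assms(2) by (intro eq_matI) auto
  have "A * B = 1\<^sub>m n" "B * A = 1\<^sub>m n"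
    unfolding B_def using A a e by (simp_all add: mult_smult_distrib[OF A a(1)] mult_smult_assoc_mat[OF a(1) A])
  ultimately show ?thesis using A by (auto simp: GL_carrier)
qed

section \<open>Upper triangular representatives\<close>

lemma det_eqv:
  assumes "eqv_mat n A B"
  shows "\<bar>det A\<bar> = \<bar>det B\<bar>"
proof -
  obtain P Q where PQ: "unim n P" "unim n Q" "A = P * B * Q" and B: "B \<in> carrier_mat n n"
    using assms by (auto simp: eqv_mat_def)
  have c: "P \<in> carrier_mat n n" "Q \<in> carrier_mat n n" "P * B \<in> carrier_mat n n"
    using PQ(1,2)[THEN unim_carrier] B by auto
  have "det A = det P * det B * det Q"
    unfolding PQ(3) using det_mult[OF c(3,2)] det_mult[OF c(1) B] by simp
  then show ?thesis using PQ(1,2) by (simp add: unim_def abs_mult)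
qed

lemma det_mat_diag: "det (mat_diag n d) = (\<Prod>i<n. d i :: int)"
proof -
  have "mat n n (\<lambda>(a, b). mat_diag n d $$ (a, b)) = mat_diag n d"
    by (rule eq_matI) (auto simp: mat_diag_def)
  then show ?thesis using fminor_diag_inj[of n "\<lambda>a. a" n d] by (simp add: fminor_def)
qed

lemma det_triangular:
  assumes "A \<in> carrier_mat n n" "upper_triangular A"
  shows "det A = (\<Prod>i<n. A $$ (i, i))"
  using det_upper_triangular[OF assms(2,1)] assms(1) by (simp add: prod_list_diag_prod atLeast0LessThan)

lemma prod_eq_prime_power:
  fixes d :: "nat \<Rightarrow> int"
  assumes p: "Factorial_Ring.prime p" and "\<bar>\<Prod>i<n. d i\<bar> = int p ^ k"
  shows "\<exists>f. (\<forall>i<n. \<bar>d i\<bar> = int p ^ f i) \<and> (\<Sum>i<n. f i) = k"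
proof -
  have p1: "p > 1" using p by (rule prime_gt_1_nat)
  have pr: "(\<Prod>i<n. nat \<bar>d i\<bar>) = p ^ k"
  proof -
    have "int (\<Prod>i<n. nat \<bar>d i\<bar>) = int (p ^ k)" using assms(2) by (simp add: abs_prod)
    then show ?thesis by (simp only: of_nat_eq_iff)
  qed
  have "\<exists>j. nat \<bar>d i\<bar> = p ^ j" if "i < n" for i
  proof -
    have "nat \<bar>d i\<bar> dvd p ^ k" unfolding pr[symmetric] using that by (intro dvd_prodI) auto
    then show ?thesis using divides_primepow_nat[OF p] by blast
  qed
  then obtain f where f: "\<And>i. i < n \<Longrightarrow> nat \<bar>d i\<bar> = p ^ f i" by metis
  have "p ^ k = p ^ (\<Sum>i<n. f i)" using pr f by (simp add: power_sum)
  then have "(\<Sum>i<n. f i) = k" using power_inject_exp[OF p1] by metis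
  moreover have "\<bar>d i\<bar> = int p ^ f i" if "i < n" for i
    using f[OF that] by (metis abs_ge_zero nat_0_le of_nat_power)
  ultimately show ?thesis by blast
qed

text \<open>One exponent falls short of the average 1 by 1, so the others exceed it by 1 in total.
  This is the adjacency condition of \<open>adj_pe\<close> for e = 1.\<close>

lemma sum_one_zero:
  fixes f :: "nat \<Rightarrow> nat"
  assumes "(\<Sum>i<n. f i) = n" "i0 < n" "f i0 = 0" and pos: "\<And>i. i < n \<Longrightarrow> i \<noteq> i0 \<Longrightarrow> f i \<ge> 1"
  shows "(\<Sum>i<n. f i - 1) = 1" "(\<Sum>i<n. 1 - f i) = 1"
proof -
  let ?A = "{..<n} - {i0}"
  have split: "(\<Sum>i<n. h i) = h i0 + (\<Sum>i\<in>?A. h i)" for h :: "nat \<Rightarrow> nat"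
    using assms(2) by (intro sum.remove) auto
  have "(\<Sum>i\<in>?A. f i) = (\<Sum>i\<in>?A. (f i - 1) + 1)" using pos by (intro sum.cong) force+
  also have "\<dots> = (\<Sum>i\<in>?A. f i - 1) + (n - 1)" using assms(2) by (simp only: sum.distrib) simp
  finally show "(\<Sum>i<n. f i - 1) = 1" using split[of f] split[of "\<lambda>i. f i - 1"] assms(1-3) by simp
  have "(\<Sum>i\<in>?A. 1 - f i) = 0" using pos by (intro sum.neutral) force
  then show "(\<Sum>i<n. 1 - f i) = 1" using split[of "\<lambda>i. 1 - f i"] assms(3) by simp
qed

context gl_hecke
begin

definition D0 :: "int mat" where "D0 = mat_diag n (\<lambda>i. int p ^ (es1 1 ! i))"

lemma D0_carrier: "D0 \<in> carrier_mat n n" by (simp add: D0_def)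

lemma rat_D0: "rat_mat D0 = dd (es1 1)"
  unfolding dd_fd[OF length_es1] by (rule eq_matI) (auto simp: D0_def fd_def mat_diag_def)

lemma es1_nth: "es1 1 ! 0 = 0" "0 < i \<Longrightarrow> i < n - 1 \<Longrightarrow> es1 1 ! i = 1" "0 < i \<Longrightarrow> i < n \<Longrightarrow> es1 1 ! i \<ge> 1"
  using n4 by (auto simp: es1_def nth_Cons' nth_append)

lemma sum_es1: "(\<Sum>i<n. es1 1 ! i) = n"
proof -
  have "(\<Sum>i<n. es1 1 ! i) = sum_list (map (\<lambda>x. x) (es1 1))"
    by (rule sum_nth_list[OF length_es1, of "\<lambda>x. x"])
  also have "\<dots> = n" using n4 by (simp add: es1_def sum_list_replicate)
  finally show ?thesis .
qed

text \<open>Connects membership in the rational double coset with integral equivalence, to which the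
  Smith form and the determinantal divisors apply.\<close>

lemma DD_int_iff:
  assumes C: "C \<in> carrier_mat n n"
  shows "rat_mat C \<in> DD \<longleftrightarrow> eqv_mat n C D0"
proof
  assume "rat_mat C \<in> DD"
  then obtain P Q where PQ: "unim n P" "unim n Q" "rat_mat C = rat_mat P * rat_mat D0 * rat_mat Q"
    unfolding double_coset_eq Lam_eq rat_D0 by blast
  have "rat_mat C = rat_mat (P * D0 * Q)"
    using PQ unim_carrier[OF PQ(1)] unim_carrier[OF PQ(2)] D0_carrier by (simp add: rat_mat_mult[of _ n])
  then have "C = P * D0 * Q" by (rule rat_mat_inj)
  then show "eqv_mat n C D0" unfolding eqv_mat_def using PQ D0_carrier by blast
next
  assume "eqv_mat n C D0"
  then obtain P Q where PQ: "unim n P" "unim n Q" "C = P * D0 * Q" by (auto simp: eqv_mat_def)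
  have "rat_mat C = rat_mat P * rat_mat D0 * rat_mat Q"
    using PQ unim_carrier[OF PQ(1)] unim_carrier[OF PQ(2)] D0_carrier by (simp add: rat_mat_mult[of _ n])
  then show "rat_mat C \<in> DD" unfolding double_coset_eq Lam_eq rat_D0 using PQ by blast
qed

text \<open>A minor of a diagonal matrix is divisible by the product over its chosen rows, and the
  leading principal minor attains the least exponent sum m.\<close>

lemma det_divisor_D0_aux:
  assumes low: "\<And>f. inj_on f {..<k} \<Longrightarrow> (\<And>a. a < k \<Longrightarrow> f a < n) \<Longrightarrow> m \<le> (\<Sum>a<k. es1 1 ! f a)"
    and m: "m = (\<Sum>a<k. es1 1 ! a)" and k: "k \<le> n"
  shows "det_divisor k D0 = int p ^ m"
proof (rule zdvd_antisym_nonneg[OF det_divisor_nonneg])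
  show "int p ^ m dvd det_divisor k D0"
    unfolding dvd_det_divisor_iff[OF D0_carrier] minors_dvd_def
  proof (intro allI impI)
    fix f g :: "nat \<Rightarrow> nat" assume fg: "\<forall>a<k. f a < n \<and> g a < n"
    show "int p ^ m dvd fminor k D0 f g"
    proof (cases "inj_on f {..<k}")
      case True
      have "int p ^ m dvd int p ^ (\<Sum>a<k. es1 1 ! f a)"
        using low[OF True] fg by (intro le_imp_power_dvd) auto
      also have "\<dots> = (\<Prod>a<k. int p ^ (es1 1 ! f a))" by (simp add: power_sum)
      also have "\<dots> dvd fminor k D0 f g" unfolding D0_def using fg by (intro fminor_diag_dvd) auto
      finally show ?thesis .
    qed (simp add: fminor_not_inj)
  qed
  have "minors_dvd (det_divisor k D0) n k D0"
    unfolding dvd_det_divisor_iff[OF D0_carrier, symmetric] by simp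
  then have "det_divisor k D0 dvd fminor k D0 (\<lambda>a. a) (\<lambda>a. a)" using k by (auto simp: minors_dvd_def)
  also have "fminor k D0 (\<lambda>a. a) (\<lambda>a. a) = int p ^ m"
    unfolding D0_def m using k by (subst fminor_diag_inj) (auto simp: power_sum)
  finally show "det_divisor k D0 dvd int p ^ m" .
qed simp

lemma det_divisor_D0: "k \<in> {1..n - 1} \<Longrightarrow> det_divisor k D0 = int p ^ (k - 1)" "det_divisor n D0 = int p ^ n"
proof -
  assume k: "k \<in> {1..n - 1}"
  show "det_divisor k D0 = int p ^ (k - 1)"
  proof (rule det_divisor_D0_aux)
    fix f :: "nat \<Rightarrow> nat" assume f: "inj_on f {..<k}" "\<And>a. a < k \<Longrightarrow> f a < n"
    \<comment> \<open>Among k distinct positions at most one is position 0; every other position has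
      exponent at least 1.\<close>
    have "k - 1 \<le> card (f ` {..<k} - {0})"
      using f(1) card_Diff_singleton_if[of "f ` {..<k}" 0] by (simp add: card_image)
    also have "\<dots> = (\<Sum>x\<in>f ` {..<k} - {0}. 1)" by simp
    also have "\<dots> \<le> (\<Sum>x\<in>f ` {..<k} - {0}. es1 1 ! x)" using f(2) es1_nth(3) by (intro sum_mono) auto
    also have "\<dots> \<le> (\<Sum>x\<in>f ` {..<k}. es1 1 ! x)" by (intro sum_mono2) auto
    also have "\<dots> = (\<Sum>a<k. es1 1 ! f a)" using sum.reindex[OF f(1), of "(!) (es1 1)"] by simp
    finally show "k - 1 \<le> (\<Sum>a<k. es1 1 ! f a)" .
  next
    have "(\<Sum>a<k. es1 1 ! a) = es1 1 ! 0 + (\<Sum>a\<in>{..<k} - {0}. es1 1 ! a)"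
      using k by (intro sum.remove) auto
    also have "(\<Sum>a\<in>{..<k} - {0}. es1 1 ! a) = (\<Sum>a\<in>{..<k} - {0}. 1)"
      using k es1_nth(2) by (intro sum.cong) auto
    finally show "k - 1 = (\<Sum>a<k. es1 1 ! a)" using es1_nth(1) k by simp
  qed (use k in auto)
next
  show "det_divisor n D0 = int p ^ n"
  proof (rule det_divisor_D0_aux)
    fix f :: "nat \<Rightarrow> nat" assume f: "inj_on f {..<n}" "\<And>a. a < n \<Longrightarrow> f a < n"
    then have "f ` {..<n} = {..<n}" by (intro endo_inj_surj) auto
    then have "(\<Sum>a<n. es1 1 ! f a) = (\<Sum>a<n. es1 1 ! a)"
      using sum.reindex[OF f(1), of "(!) (es1 1)"] by simp
    then show "n \<le> (\<Sum>a<n. es1 1 ! f a)" using sum_es1 by simp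
  qed (use sum_es1 in auto)
qed

text \<open>In the Smith form, \<open>m1\<close> gives a diagonal entry prime to p and
  \<open>m2\<close> forbids a second one. With exponents summing to n, \<open>sum_one_zero\<close>
  then yields adjacency to p times the standard lattice.\<close>

lemma DD_I:
  assumes C: "C \<in> carrier_mat n n" and det: "det C = int p ^ n"
    and m1: "\<not> minors_dvd (int p) n 1 C" and m2: "minors_dvd (int p) n 2 C"
  shows "rat_mat C \<in> DD"
proof -
  obtain d where eqv: "eqv_mat n C (mat_diag n d)" using smith_normal_form[OF C] by blast
  have "\<bar>\<Prod>i<n. d i\<bar> = int p ^ n" using det_eqv[OF eqv] det det_mat_diag[of n d] by simp
  then obtain f where f: "\<And>i. i < n \<Longrightarrow> \<bar>d i\<bar> = int p ^ f i" and sf: "(\<Sum>i<n. f i) = n"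
    using prod_eq_prime_power[OF prime_p] by blast
  have "\<not> minors_dvd (int p) n 1 (mat_diag n d)" using m1 minors_dvd_eqv[OF eqv] by blast
  then obtain i0 where i0: "i0 < n" "\<not> int p dvd d i0"
    unfolding minors_dvd_1 by (auto simp: mat_diag_def split: if_splits)
  have f0: "f i0 = 0"
  proof (rule ccontr)
    assume "f i0 \<noteq> 0"
    then have "int p dvd \<bar>d i0\<bar>" unfolding f[OF i0(1)] by simp
    then show False using i0(2) by simp
  qed
  have fpos: "f i \<ge> 1" if i: "i < n" "i \<noteq> i0" for i
  proof (rule ccontr)
    assume "\<not> f i \<ge> 1"
    then have "f i = 0" by simp
    then have u: "\<bar>d i\<bar> = 1" "\<bar>d i0\<bar> = 1" using f[OF i(1)] f[OF i0(1)] f0 by simp_all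
    \<comment> \<open>Selects the two diagonal positions i and \<open>i0\<close>, whose minor would
      be 1 or -1.\<close>
    define h where "h a = (if a = 0 then i else i0)" for a :: nat
    have "minors_dvd (int p) n 2 (mat_diag n d)" using minors_dvd_eqv[OF eqv_mat_sym[OF eqv] m2] .
    then have "int p dvd fminor 2 (mat_diag n d) h h" using i i0 by (auto simp: minors_dvd_def h_def)
    also have "fminor 2 (mat_diag n d) h h = (\<Prod>a<2. d (h a))"
      using i i0 by (intro fminor_diag_inj) (auto simp: h_def inj_on_def)
    also have "\<dots> = d i * d i0" by (simp add: h_def numeral_2_eq_2)
    finally have "int p dvd \<bar>d i * d i0\<bar>" by simp
    then show False using u p1 by (simp add: abs_mult)
  qed
  note s = sum_one_zero[OF sf i0(1) f0 fpos]
  have adj: "adj (pe 1) (pbox f)" unfolding adj_pe using s by simp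
  have d0: "d i \<noteq> 0" if "i < n" for i using f[OF that] p0 by auto
  have "lat n (mat_diag n (\<lambda>i. of_int (d i))) = box n (\<lambda>i. nat \<bar>d i\<bar>)"
    using d0 by (rule lat_diag_int)
  also have "\<dots> = pbox f"
    unfolding pbox_def using f by (intro box_cong) (simp flip: of_nat_power)
  finally obtain Q where Q: "Q \<in> Lam n" "lat n (rat_mat C) = (\<lambda>x. rowv n x Q) ` pbox f"
    using lat_eqv[OF eqv] by auto
  have "adj ((\<lambda>x. rowv n x Q) ` pe 1) (lat n (rat_mat C))"
    unfolding Q(2) using rowv_invariant(1)[OF Lam_GL[OF Q(1)] sbgp_pbox pbox_VV sbgp_pbox pbox_VV] adj by blast
  then have "adj (pe 1) (lat n (rat_mat C))" using rowv_pe[OF Q(1)] by simp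
  moreover have "rat_mat C \<in> carrier (GLQ n)"
    using C det p0 by (intro GLQ_of_det) auto
  ultimately show ?thesis using DD_iff by blast
qed

lemma R_hnf:
  assumes "C \<in> R0 n p \<union> R1 n p"
  shows "C \<in> carrier_mat n n" "upper_triangular C" "\<And>i. i < n \<Longrightarrow> C $$ (i, i) > 0"
    "\<And>i j. i < j \<Longrightarrow> j < n \<Longrightarrow> 0 \<le> C $$ (i, j) \<and> C $$ (i, j) < C $$ (j, j)"
proof -
  show "C \<in> carrier_mat n n" "upper_triangular C" using assms by (auto simp: R0_def R1_def)
  show "C $$ (i, i) > 0" if i: "i < n" for i
  proof -
    have "C $$ (i, i) \<in> {1, int p, int p ^ 2}" using assms i by (auto simp: R0_def R1_def)
    then show ?thesis using p0 by auto
  qed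
  show "0 \<le> C $$ (i, j) \<and> C $$ (i, j) < C $$ (j, j)" if "i < j" "j < n" for i j
    using assms that by (auto simp: R0_def R1_def)
qed

lemma R0_DD: "C \<in> R0 n p \<Longrightarrow> rat_mat C \<in> DD"
proof -
  assume R: "C \<in> R0 n p"
  then have C: "C \<in> carrier_mat n n" "upper_triangular C" "\<And>i. i < n \<Longrightarrow> C $$ (i, i) = int p"
    and dd: "\<And>k. k \<in> {1..n - 1} \<Longrightarrow> det_divisor k C = int p ^ (k - 1)"
    by (auto simp: R0_def)
  show ?thesis
  proof (rule DD_I[OF C(1)])
    show "det C = int p ^ n" using det_triangular[OF C(1,2)] C(3) by simp
    have "det_divisor 1 C = 1" "det_divisor 2 C = int p" using dd[of 1] dd[of 2] n4 by auto
    then show "\<not> minors_dvd (int p) n 1 C" "minors_dvd (int p) n 2 C"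
      unfolding dvd_det_divisor_iff[OF C(1), symmetric] using p1 by auto
  qed
qed

text \<open>Every row except row \<open>a\<close>, the one with diagonal entry 1, is divisible by p.
  A minor of size 2 from two different rows involves at least one such row, so it is divisible by
  p.\<close>

lemma R1_DD: "C \<in> R1 n p \<Longrightarrow> rat_mat C \<in> DD"
proof -
  assume R: "C \<in> R1 n p"
  then have C: "C \<in> carrier_mat n n" "upper_triangular C" "\<And>i. i < n \<Longrightarrow> C $$ (i, i) \<in> {1, int p, int p ^ 2}"
    and ex: "\<exists>!i. i < n \<and> C $$ (i, i) = 1" "\<exists>!i. i < n \<and> C $$ (i, i) = int p ^ 2"
    and row: "\<And>i j. i < n - 1 \<Longrightarrow> int p dvd C $$ (i, i) \<Longrightarrow> i < j \<Longrightarrow> j < n \<Longrightarrow> int p dvd C $$ (i, j)"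
    by (auto simp: R1_def)
  obtain a where a: "a < n" "C $$ (a, a) = 1" "\<And>i. i < n \<Longrightarrow> C $$ (i, i) = 1 \<Longrightarrow> i = a" using ex(1) by blast
  obtain b where b: "b < n" "C $$ (b, b) = int p ^ 2" "\<And>i. i < n \<Longrightarrow> C $$ (i, i) = int p ^ 2 \<Longrightarrow> i = b" using ex(2) by blast
  have ab: "a \<noteq> b"
  proof
    assume "a = b"
    then show False using a(2) b(2) one_less_power[of "int p" 2] p1 by simp
  qed
  have rowdvd: "int p dvd C $$ (i, j)" if i: "i < n" "i \<noteq> a" and j: "j < n" for i j
  proof -
    have ii: "int p dvd C $$ (i, i)" using C(3)[OF i(1)] a(3)[OF i(1)] i(2) by auto
    consider "j < i" | "j = i" | "i < j" by linarith
    then show ?thesis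
    proof cases
      case 1
      then have "C $$ (i, j) = 0" using upper_triangularD[OF C(2)] C(1) i by auto
      then show ?thesis by simp
    next
      case 3
      then show ?thesis using row[of i j] ii j by auto
    qed (use ii in simp)
  qed
  show ?thesis
  proof (rule DD_I[OF C(1)])
    have rest: "C $$ (i, i) = int p" if "i \<in> {..<n} - {a} - {b}" for i
      using C(3)[of i] a(3)[of i] b(3)[of i] that by auto
    have "det C = (\<Prod>i<n. C $$ (i, i))" by (rule det_triangular[OF C(1,2)])
    also have "\<dots> = C $$ (a, a) * (\<Prod>i\<in>{..<n} - {a}. C $$ (i, i))" using a(1) by (intro prod.remove) auto
    also have "(\<Prod>i\<in>{..<n} - {a}. C $$ (i, i)) = C $$ (b, b) * (\<Prod>i\<in>{..<n} - {a} - {b}. C $$ (i, i))"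
      using b(1) ab by (intro prod.remove) auto
    also have "(\<Prod>i\<in>{..<n} - {a} - {b}. C $$ (i, i)) = int p ^ (n - 2)"
      using rest a(1) b(1) ab by (simp add: card_Diff_singleton numeral_2_eq_2)
    also have "C $$ (a, a) * (C $$ (b, b) * int p ^ (n - 2)) = int p ^ n"
    proof -
      have "2 + (n - 2) = n" using n4 by simp
      then have "int p ^ n = int p ^ 2 * int p ^ (n - 2)" by (metis power_add)
      then show ?thesis unfolding a(2) b(2) by (simp only: mult_1)
    qed
    finally show "det C = int p ^ n" .
    have "\<not> int p dvd C $$ (a, a)" using a(2) p1 by simp
    then show "\<not> minors_dvd (int p) n 1 C" unfolding minors_dvd_1 using a(1) by blast
    show "minors_dvd (int p) n 2 C"
      unfolding minors_dvd_def
    proof (intro allI impI)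
      fix f g :: "nat \<Rightarrow> nat" assume fg: "\<forall>a<2. f a < n \<and> g a < n"
      show "int p dvd fminor 2 C f g"
      proof (cases "f 0 = f 1")
        case True
        then have "\<not> inj_on f {..<2}" using inj_onD[of f "{..<2}" 0 1] by auto
        then show ?thesis by (simp add: fminor_not_inj)
      next
        case False
        \<comment> \<open>Of the two selected rows, one that is not row \<open>a\<close>.\<close>
        define r where "r = (if f 0 = a then 1 else 0 :: nat)"
        have r: "r < 2" "f r \<noteq> a" using False by (auto simp: r_def)
        have "(\<Prod>i<2. if i = r then int p else 1) dvd fminor 2 C f g"
          unfolding fminor_def using rowdvd r fg by (intro prod_dvd_det) auto
        moreover have "(\<Prod>i<2. if i = r then int p else 1) = int p"
          using r(1) by (simp add: prod.delta)
        ultimately show ?thesis by simp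
      qed
    qed
  qed
qed

text \<open>The determinant makes the diagonal consist of powers of p with exponents summing to n.
  If none is 0, all are 1 and the determinantal divisors give \<open>R0\<close>. Otherwise the rank
  modulo p leads to \<open>R1\<close>.\<close>

lemma hnf_DD_R:
  assumes C: "C \<in> carrier_mat n n" "upper_triangular C" "\<And>i. i < n \<Longrightarrow> C $$ (i, i) > 0"
    and red: "\<And>i j. i < j \<Longrightarrow> j < n \<Longrightarrow> 0 \<le> C $$ (i, j) \<and> C $$ (i, j) < C $$ (j, j)"
    and DD: "rat_mat C \<in> DD"
  shows "C \<in> R0 n p \<union> R1 n p"
proof -
  have eqv: "eqv_mat n C D0" using DD DD_int_iff[OF C(1)] by simp
  have detD0: "det D0 = int p ^ n" unfolding D0_def det_mat_diag by (simp only: power_sum[symmetric] sum_es1)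
  have "\<bar>\<Prod>i<n. C $$ (i, i)\<bar> = int p ^ n" using det_eqv[OF eqv] detD0 det_triangular[OF C(1,2)] by simp
  then obtain f where f: "\<And>i. i < n \<Longrightarrow> \<bar>C $$ (i, i)\<bar> = int p ^ f i" and sf: "(\<Sum>i<n. f i) = n"
    using prod_eq_prime_power[OF prime_p, where n = n and k = n and d = "\<lambda>i. C $$ (i, i)"] by blast
  have diag: "C $$ (i, i) = int p ^ f i" if "i < n" for i using f[OF that] C(3)[OF that] by simp
  show ?thesis
  proof (cases "\<exists>a<n. f a = 0")
    case False
    have "(\<Sum>i<n. f i) = (\<Sum>i<n. (f i - 1) + 1)" using False by (intro sum.cong) force+
    then have "(\<Sum>i<n. f i - 1) = 0" using sf by (simp only: sum.distrib) simp
    then have f1: "f i = 1" if "i < n" for i using that False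
      by (metis One_nat_def Suc_leI diff_is_0_eq finite_lessThan le_antisym lessThan_iff neq0_conv sum_eq_0_iff)
    then have diag1: "C $$ (i, i) = int p" if "i < n" for i using diag[OF that] f1[OF that] by simp
    have "C \<in> R0 n p"
      unfolding R0_def using C red diag1 det_divisor_D0 det_divisor_eqv[OF eqv] by auto
    then show ?thesis by simp
  next
    case True
    then obtain a where a: "a < n" "f a = 0" by blast
    have Ca: "C $$ (a, a) = 1" using diag[OF a(1)] a(2) by simp
    obtain P Q where PQ: "unim n P" "unim n Q" "C = P * D0 * Q" using eqv by (auto simp: eqv_mat_def)
    have c: "P \<in> carrier_mat n n" "Q \<in> carrier_mat n n" using PQ unim_carrier by auto
    \<comment> \<open>Modulo \<open>p\<close> the matrix has rank one, and \<open>a\<close> is the row carrying it.\<close>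
    have rank1: "int p dvd C $$ (i, j) - P $$ (i, 0) * Q $$ (0, j)" if ij: "i < n" "j < n" for i j
    proof -
      have "C $$ (i, j) = (\<Sum>k<n. P $$ (i, k) * int p ^ (es1 1 ! k) * Q $$ (k, j))"
        unfolding PQ(3) D0_def mat_diag_mult_right[OF c(1)] using c ij
        by (simp add: scalar_prod_def atLeast0LessThan)
      also have "\<dots> = P $$ (i, 0) * int p ^ (es1 1 ! 0) * Q $$ (0, j)
          + (\<Sum>k\<in>{..<n} - {0}. P $$ (i, k) * int p ^ (es1 1 ! k) * Q $$ (k, j))"
        using n4 by (intro sum.remove) auto
      finally have "C $$ (i, j) - P $$ (i, 0) * Q $$ (0, j)
          = (\<Sum>k\<in>{..<n} - {0}. P $$ (i, k) * int p ^ (es1 1 ! k) * Q $$ (k, j))"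
        using es1_nth(1) by simp
      also have "int p dvd \<dots>"
      proof (rule dvd_sum)
        fix k assume "k \<in> {..<n} - {0}"
        then have "int p dvd int p ^ (es1 1 ! k)" using es1_nth(3)[of k] by (intro dvd_power) auto
        then show "int p dvd P $$ (i, k) * int p ^ (es1 1 ! k) * Q $$ (k, j)" by simp
      qed
      finally show ?thesis .
    qed
    have pp: "Factorial_Ring.prime (int p)" using prime_p by simp
    \<comment> \<open>Modulo p the entry 1 at (a, a) equals P(a, 0) Q(0, a), so neither factor
      vanishes.\<close>
    have Qa: "\<not> int p dvd Q $$ (0, a)"
    proof
      assume "int p dvd Q $$ (0, a)"
      then have "int p dvd P $$ (a, 0) * Q $$ (0, a)" by simp
      from dvd_add[OF rank1[OF a(1) a(1)] this] have "int p dvd 1" using Ca by simp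
      then show False using p1 by simp
    qed
    \<comment> \<open>Above the diagonal the entries are nonnegative and less than 1, below it the
      matrix is triangular.\<close>
    have col: "C $$ (i, a) = 0" if i: "i < n" "i \<noteq> a" for i
    proof (cases "i < a")
      case True
      then show ?thesis using red[of i a] a(1) Ca by auto
    next
      case False
      then show ?thesis using upper_triangularD[OF C(2), of a i] C(1) i by auto
    qed
    \<comment> \<open>The vanishing column \<open>a\<close> forces P(i, 0) to vanish modulo p for i
      \<noteq> a, and with it the whole row i.\<close>
    have rows: "int p dvd C $$ (i, j)" if i: "i < n" "i \<noteq> a" and j: "j < n" for i j
    proof -
      have "int p dvd P $$ (i, 0) * Q $$ (0, a)" using rank1[OF i(1) a(1)] col[OF i] by simp
      then have "int p dvd P $$ (i, 0)" using Qa pp prime_dvd_mult_iff by blast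
      then have "int p dvd P $$ (i, 0) * Q $$ (0, j)" by simp
      from dvd_add[OF rank1[OF i(1) j] this] show ?thesis by simp
    qed
    have fpos: "f i \<ge> 1" if i: "i < n" "i \<noteq> a" for i
    proof (rule ccontr)
      assume "\<not> f i \<ge> 1"
      then have "f i = 0" by simp
      then have "C $$ (i, i) = 1" using diag[OF i(1)] by simp
      then show False using rows[OF i i(1)] p1 by simp
    qed
    have s1: "(\<Sum>i<n. f i - 1) = 1" using sum_one_zero(1)[OF sf a fpos] by simp
    have "\<exists>b<n. f b - 1 \<noteq> 0"
    proof (rule ccontr)
      assume "\<not> (\<exists>b<n. f b - 1 \<noteq> 0)"
      then have "(\<Sum>i<n. f i - 1) = 0" by (intro sum.neutral) auto
      then show False using s1 by simp
    qed
    then obtain b where b: "b < n" "f b - 1 \<noteq> 0" by blast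
    have "(\<Sum>i<n. f i - 1) = (f b - 1) + (\<Sum>i\<in>{..<n} - {b}. f i - 1)" using b(1) by (intro sum.remove) auto
    then have fb: "f b = 2" and "(\<Sum>i\<in>{..<n} - {b}. f i - 1) = 0" using s1 b(2) by linarith+
    then have "f i - 1 = 0" if "i < n" "i \<noteq> b" for i using that by (simp add: sum_eq_0_iff)
    then have rest: "f i \<le> 1" if "i < n" "i \<noteq> b" for i using that by force
    have ne: "int p \<noteq> 1" "int p ^ 2 \<noteq> 1" "int p ^ 2 \<noteq> int p"
      using p1 one_less_power[of "int p" 2] by (auto simp: power2_eq_square)
    have d1: "C $$ (i, i) = 1 \<longleftrightarrow> i = a" if i: "i < n" for i
      by (cases "i = a") (use rows[OF i _ i] Ca p1 in auto)
    have d2: "C $$ (i, i) = int p ^ 2 \<longleftrightarrow> i = b" if i: "i < n" for i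
    proof
      assume *: "C $$ (i, i) = int p ^ 2"
      show "i = b"
      proof (rule ccontr)
        assume "i \<noteq> b"
        then have "f i = 0 \<or> f i = 1" using rest[OF i] by linarith
        then show False using diag[OF i] * ne by auto
      qed
    qed (use diag[OF b(1)] fb in simp)
    have d3: "C $$ (i, i) \<in> {1, int p, int p ^ 2}" if i: "i < n" for i
    proof (cases "i = b")
      case True
      then show ?thesis using d2[OF i] by simp
    next
      case False
      then have "f i = 0 \<or> f i = 1" using rest[OF i] by linarith
      then show ?thesis using diag[OF i] by auto
    qed
    have "C \<in> R1 n p"
      unfolding R1_def mem_Collect_eq
    proof (intro conjI allI impI)
      show "\<exists>!i. i < n \<and> C $$ (i, i) = 1" using d1 a(1) by blast
      show "\<exists>!i. i < n \<and> C $$ (i, i) = int p ^ 2" using d2 b(1) by blast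
      fix i j assume "i < n - 1" "int p dvd C $$ (i, i)" "i < j \<and> j < n"
      moreover from this have "i \<noteq> a" using Ca p1 by auto
      ultimately show "int p dvd C $$ (i, j)" using rows by auto
    qed (use C red d3 in auto)
    then show ?thesis by simp
  qed
qed

text \<open>Distinct Hermite forms span distinct lattices, and the Hermite form of a lattice
  adjacent to p times the standard one lies in \<open>DD\<close>, hence in the set by
  \<open>hnf_DD_R\<close>. Finiteness follows because the degree is positive.\<close>

lemma reps_DD:
  shows "complete_reps n DD (rat_mat ` (R0 n p \<union> R1 n p))"
    and "finite (R0 n p \<union> R1 n p)" and "card (R0 n p \<union> R1 n p) = deg n (dd (es1 1))"
proof -
  let ?R = "R0 n p \<union> R1 n p"
  have sub: "rat_mat ` ?R \<subseteq> DD" using R0_DD R1_DD by blast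
  have inj: "inj_on (right_coset n) (rat_mat ` ?R)"
  proof (rule inj_onI, clarify)
    fix C E assume CE: "C \<in> ?R" "E \<in> ?R" "right_coset n (rat_mat C) = right_coset n (rat_mat E)"
    have "rat_mat C \<in> carrier (GLQ n)" "rat_mat E \<in> carrier (GLQ n)" using CE sub DD_GL by blast+
    then have l: "lat n (rat_mat C) = lat n (rat_mat E)" using CE(3) right_coset_eq_iff by blast
    have "C = E" using R_hnf[OF CE(1)] R_hnf[OF CE(2)] l by (rule hnf_unique)
    then show "rat_mat C = rat_mat E" by simp
  qed
  have surj: "right_coset n ` rat_mat ` ?R = right_coset n ` DD"
  proof
    show "right_coset n ` rat_mat ` ?R \<subseteq> right_coset n ` DD" using sub by blast
    show "right_coset n ` DD \<subseteq> right_coset n ` rat_mat ` ?R"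
    proof
      fix X assume "X \<in> right_coset n ` DD"
      then obtain g where g: "g \<in> DD" "X = right_coset n g" by blast
      have gG: "g \<in> carrier (GLQ n)" using DD_GL g by blast
      then have adj: "adj (pe 1) (lat n g)" using DD_iff g by blast
      have i: "idx (pe 1) (pe 1 \<inter> lat n g) = p ^ 1" "idx (lat n g) (pe 1 \<inter> lat n g) = p ^ 1"
        using adj by (simp_all add: adj_def)
      have pos: "p ^ (1 + 1) > 0" using p0 by simp
      have "\<exists>C\<in>carrier_mat n n. upper_triangular C \<and> (\<forall>i<n. C $$ (i, i) > 0) \<and>
          (\<forall>i j. i < j \<and> j < n \<longrightarrow> 0 \<le> C $$ (i, j) \<and> C $$ (i, j) < C $$ (j, j)) \<and> lat n (rat_mat C) = lat n g"
        by (rule hnf_exists[OF sbgp_lat lattice_between(1)[OF sbgp_lat order_refl i] pos])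
          (rule lattice_between(2)[OF sbgp_lat order_refl i])
      then obtain C where C: "C \<in> carrier_mat n n" "upper_triangular C" "\<And>i. i < n \<Longrightarrow> C $$ (i, i) > 0"
        "\<And>i j. i < j \<Longrightarrow> j < n \<Longrightarrow> 0 \<le> C $$ (i, j) \<and> C $$ (i, j) < C $$ (j, j)" "lat n (rat_mat C) = lat n g"
        by auto
      have "C $$ (i, i) \<noteq> 0" if "i < n" for i
        using C(3)[OF that] by simp
      then have "det C \<noteq> 0"
        unfolding det_triangular[OF C(1,2)] by simp
      then have CG: "rat_mat C \<in> carrier (GLQ n)" using C(1) by (intro GLQ_of_det) auto
      then have CD: "rat_mat C \<in> DD" using DD_iff adj C(5) by simp
      have "C \<in> ?R" using C(1-4) CD by (rule hnf_DD_R)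
      moreover have "right_coset n (rat_mat C) = X" using right_coset_eq_iff[OF CG gG] C(5) g by simp
      ultimately show "X \<in> right_coset n ` rat_mat ` ?R" by blast
    qed
  qed
  show "complete_reps n DD (rat_mat ` ?R)"
    unfolding complete_reps_def right_cosets_in_def bij_betw_def using sub inj surj by simp
  have rinj: "inj_on rat_mat ?R" by (rule inj_onI) (rule rat_mat_inj)
  have card: "card ?R = deg n (dd (es1 1))"
    unfolding deg_def right_cosets_in_def surj[symmetric] using card_image[OF inj] card_image[OF rinj] by simp
  then show "card ?R = deg n (dd (es1 1))" .
  have "deg n (dd (es1 1)) > 0" using deg_adj[of 1] br_lower by simp
  then show "finite ?R" using card card_ge_0_finite by metis
qed

section \<open>Closed formulas for the degrees\<close>

lemma br_shift: "k > 0 \<Longrightarrow> br p k = 1 + p * br p (k - 1)" "k > 0 \<Longrightarrow> br p k - br p (k - 1) = p ^ (k - 1)"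
  by (cases k; simp add: br_Suc; fail) (cases k; simp add: br_Suc')

lemma of_nat_br: "rat_of_nat (br p k) = (of_nat p ^ k - 1) / (of_nat p - 1)"
proof -
  have "rat_of_nat (br p k * (p - 1) + 1) = of_nat (p ^ k)" using br_mult[OF p0] by simp
  then have "rat_of_nat (br p k) * (of_nat p - 1) = of_nat p ^ k - 1"
    using p1 by (simp add: of_nat_diff)
  moreover have "rat_of_nat p - 1 \<noteq> 0" using p1 by simp
  ultimately show ?thesis by (simp add: field_simps)
qed

text \<open>The differences occurring in the counts, rewritten as products, so that passing to
  rational numbers meets no truncated subtraction.\<close>

lemma br_values:
  "br p n - 1 = p * br p (n - 1)" "br p (n - 1) - 1 = p * br p (n - 2)"
  "br p n - br p (n - 1) = p ^ (n - 1)"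
  "br p n - (p + 1) = p * (p * br p (n - 2))" "br p (n - 1) - (p + 1) = p * (p * br p (n - 3))"
proof -
  have n: "n - 1 - 1 = n - 2" "n - 2 - 1 = n - 3" by auto
  have 1: "br p n = 1 + p * br p (n - 1)" "br p (n - 1) = 1 + p * br p (n - 2)" "br p (n - 2) = 1 + p * br p (n - 3)"
    using br_shift(1)[of n] br_shift(1)[of "n - 1"] br_shift(1)[of "n - 2"] n4 unfolding n by auto
  show "br p n - 1 = p * br p (n - 1)" using 1(1) by simp
  show "br p (n - 1) - 1 = p * br p (n - 2)" using 1(2) by simp
  show "br p n - br p (n - 1) = p ^ (n - 1)" using br_shift(2)[of n] n4 by simp
  show "br p n - (p + 1) = p * (p * br p (n - 2))"
    unfolding 1(1) unfolding 1(2) by (simp add: add_mult_distrib2)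
  show "br p (n - 1) - (p + 1) = p * (p * br p (n - 3))"
    unfolding 1(2) unfolding 1(3) by (simp add: add_mult_distrib2)
qed

lemma deg_adj_rat:
  assumes "e > 0"
  shows "rat_of_nat (deg n (dd (es1 e))) =
    of_nat p * ((of_nat p ^ (n - 1) - 1) * (of_nat p ^ n - 1) / (of_nat p - 1)\<^sup>2)"
  unfolding deg_adj[OF assms] br_values(1)
  by (simp add: of_nat_br power2_eq_square)

lemma deg_ty2_rat:
  defines "q \<equiv> rat_of_nat p"
  shows "rat_of_nat (deg n (dd (es2 False False))) = q ^ (2 * n - 1) * ((q ^ (n - 1) - 1) * (q ^ n - 1) / (q - 1)\<^sup>2)"
    and "rat_of_nat (deg n (dd (es2 True False))) =
      q ^ (n + 1) * ((q ^ (n - 2) - 1) * (q ^ (n - 1) - 1) * (q ^ n - 1) / ((q - 1)\<^sup>2 * (q\<^sup>2 - 1)))"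
    and "rat_of_nat (deg n (dd (es2 False True))) =
      q ^ (n + 1) * ((q ^ (n - 2) - 1) * (q ^ (n - 1) - 1) * (q ^ n - 1) / ((q - 1)\<^sup>2 * (q\<^sup>2 - 1)))"
    and "rat_of_nat (deg n (dd (es2 True True))) =
      q ^ 4 * ((q ^ (n - 3) - 1) * (q ^ (n - 2) - 1) * (q ^ (n - 1) - 1) * (q ^ n - 1) / ((q - 1)\<^sup>2 * (q\<^sup>2 - 1)\<^sup>2))"
proof -
  have q: "q - 1 \<noteq> 0" "q + 1 \<noteq> 0" using p1 by (auto simp: q_def add_eq_0_iff)
  have qq: "q\<^sup>2 - 1 = (q - 1) * (q + 1)" by (simp add: power2_eq_square algebra_simps)
  have B: "rat_of_nat (br p k) = (q ^ k - 1) / (q - 1)" for k using of_nat_br by (simp add: q_def)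
  define Q where "Q = q ^ (n - 1)"
  have pw: "q ^ (n + 1) = q * q * Q" "q ^ (2 * n - 1) = q * Q * Q"
  proof -
    have "n + 1 = Suc (Suc (n - 1))" "2 * n - 1 = Suc (n - 1 + (n - 1))" using n4 by auto
    then show "q ^ (n + 1) = q * q * Q" "q ^ (2 * n - 1) = q * Q * Q"
      unfolding Q_def by (simp_all only: power_Suc power_add mult.assoc)
  qed
  \<comment> \<open>Both mixed types lead to this equation, which is solved for the degree by
    dividing by q + 1.\<close>
  have solve1: "d = q * q * Q * (N2 * N1 * N0 / ((q - 1)\<^sup>2 * (q\<^sup>2 - 1)))"
    if "d * (q + 1) = N0 * N1 * N2 * (q * q * Q) / ((q - 1) * (q - 1) * (q - 1))" for d N0 N1 N2
  proof -
    have "d = N0 * N1 * N2 * (q * q * Q) / ((q - 1) * (q - 1) * (q - 1)) / (q + 1)"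
      unfolding nonzero_eq_divide_eq[OF q(2)] by (rule that)
    then show ?thesis unfolding qq by (simp add: power2_eq_square mult_ac)
  qed
  have "deg n (dd (es2 False False)) = br p n * p ^ (n - 1) * (p * br p (n - 1) * p ^ (n - 1))"
    using deg_ty2[of False False] by (simp only: mult2_def if_True if_False br_values mult_1_right mult_1_left)
  then have "rat_of_nat (deg n (dd (es2 False False))) = (q ^ n - 1) / (q - 1) * Q * (q * ((q ^ (n - 1) - 1) / (q - 1)) * Q)"
    by (simp add: B Q_def q_def)
  then show "rat_of_nat (deg n (dd (es2 False False))) = q ^ (2 * n - 1) * ((q ^ (n - 1) - 1) * (q ^ n - 1) / (q - 1)\<^sup>2)"
    unfolding pw by (simp add: power2_eq_square mult_ac)
  have "deg n (dd (es2 True False)) * (p + 1) = br p n * br p (n - 1) * (p * (p * br p (n - 2)) * p ^ (n - 1))"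
    using deg_ty2[of True False] by (simp only: mult2_def if_True if_False br_values mult_1_right mult_1_left)
  then have "rat_of_nat (deg n (dd (es2 True False)) * (p + 1)) = rat_of_nat (br p n * br p (n - 1) * (p * (p * br p (n - 2)) * p ^ (n - 1)))"
    by (rule arg_cong)
  then have "rat_of_nat (deg n (dd (es2 True False))) * (q + 1) =
      (q ^ n - 1) / (q - 1) * ((q ^ (n - 1) - 1) / (q - 1)) * (q * (q * ((q ^ (n - 2) - 1) / (q - 1))) * Q)"
    unfolding of_nat_mult of_nat_add of_nat_power B Q_def q_def[symmetric] of_nat_1 .
  then show "rat_of_nat (deg n (dd (es2 True False))) =
      q ^ (n + 1) * ((q ^ (n - 2) - 1) * (q ^ (n - 1) - 1) * (q ^ n - 1) / ((q - 1)\<^sup>2 * (q\<^sup>2 - 1)))"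
    unfolding pw by (intro solve1) (simp add: mult_ac)
  have "deg n (dd (es2 False True)) * (p + 1) = br p n * p ^ (n - 1) * (p * br p (n - 1) * (p * br p (n - 2)))"
    using deg_ty2[of False True] by (simp only: mult2_def if_True if_False br_values mult_1_right mult_1_left)
  then have "rat_of_nat (deg n (dd (es2 False True)) * (p + 1)) = rat_of_nat (br p n * p ^ (n - 1) * (p * br p (n - 1) * (p * br p (n - 2))))"
    by (rule arg_cong)
  then have "rat_of_nat (deg n (dd (es2 False True))) * (q + 1) =
      (q ^ n - 1) / (q - 1) * Q * (q * ((q ^ (n - 1) - 1) / (q - 1)) * (q * ((q ^ (n - 2) - 1) / (q - 1))))"
    unfolding of_nat_mult of_nat_add of_nat_power B Q_def q_def[symmetric] of_nat_1 .
  then show "rat_of_nat (deg n (dd (es2 False True))) =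
      q ^ (n + 1) * ((q ^ (n - 2) - 1) * (q ^ (n - 1) - 1) * (q ^ n - 1) / ((q - 1)\<^sup>2 * (q\<^sup>2 - 1)))"
    unfolding pw by (intro solve1) (simp add: mult_ac)
  have "deg n (dd (es2 True True)) * ((p + 1) * (p + 1)) =
      br p n * br p (n - 1) * (p * (p * br p (n - 2)) * (p * (p * br p (n - 3))))"
    using deg_ty2[of True True] by (simp only: mult2_def if_True br_values(4,5))
  then have "rat_of_nat (deg n (dd (es2 True True)) * ((p + 1) * (p + 1))) =
      rat_of_nat (br p n * br p (n - 1) * (p * (p * br p (n - 2)) * (p * (p * br p (n - 3)))))"
    by (rule arg_cong)
  then have "rat_of_nat (deg n (dd (es2 True True))) * ((q + 1) * (q + 1)) =
      (q ^ n - 1) / (q - 1) * ((q ^ (n - 1) - 1) / (q - 1)) * (q * (q * ((q ^ (n - 2) - 1) / (q - 1))) * (q * (q * ((q ^ (n - 3) - 1) / (q - 1)))))"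
    unfolding of_nat_mult of_nat_add of_nat_power B q_def[symmetric] of_nat_1 .
  then have "rat_of_nat (deg n (dd (es2 True True))) =
      (q ^ n - 1) / (q - 1) * ((q ^ (n - 1) - 1) / (q - 1)) * (q * (q * ((q ^ (n - 2) - 1) / (q - 1))) * (q * (q * ((q ^ (n - 3) - 1) / (q - 1)))))
        / ((q + 1) * (q + 1))"
    using q by (subst nonzero_eq_divide_eq) simp_all
  then show "rat_of_nat (deg n (dd (es2 True True))) =
      q ^ 4 * ((q ^ (n - 3) - 1) * (q ^ (n - 2) - 1) * (q ^ (n - 1) - 1) * (q ^ n - 1) / ((q - 1)\<^sup>2 * (q\<^sup>2 - 1)\<^sup>2))"
    unfolding qq by (simp add: power2_eq_square power4_eq_xxxx mult_ac)
qed

lemma dd_lists: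
  "diag (1 # replicate (n - 2) p @ [p^2]) = dd (es1 1)"
  "diag (p # replicate (n - 2) (p^2) @ [p^3]) = dd (es1 2)"
  "diag (1 # replicate (n - 3) (p^2) @ [p^3, p^3]) = dd (es2 True False)"
  "diag (1 # replicate (n - 2) (p^2) @ [p^4]) = dd (es2 False False)"
  "diag (p # p # replicate (n - 3) (p^2) @ [p^4]) = dd (es2 False True)"
  "diag (p # p # replicate (n - 4) (p^2) @ [p^3, p^3]) = dd (es2 True True)"
  "diag (replicate n (p^2)) = dd (replicate n 2)"
  by (simp_all add: dd_def es1_def es2_def diff_diff_left numeral_2_eq_2[symmetric])

lemma c1_rat: "rat_of_int (2 * int (br p n) - (int p + 3)) =
    (2 * of_nat p ^ n - (of_nat p)\<^sup>2 - 2 * of_nat p + 1) / (of_nat p - 1)"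
proof -
  have "rat_of_nat p - 1 \<noteq> 0" using p1 by simp
  then show ?thesis by (simp add: of_nat_br field_simps power2_eq_square)
qed

end

theorem theoremA:
  fixes n p :: nat
  assumes "n \<ge> 4" and "Factorial_Ring.prime p"
  shows
    "let q = rat_of_nat p;
         D = diag (1 # replicate (n-2) p @ [p^2]);
         R = R0 n p \<union> R1 n p;
         H = hecke_algebra n
     in
       (R0 n p \<inter> R1 n p = {} \<and> finite R \<and> card R = deg n D \<and>
        rat_of_nat (deg n D) = q * ((q^(n-1) - 1) * (q^n - 1) / (q - 1)^2) \<and>
        complete_reps n (double_coset n D) (rat_mat ` R))
     \<and>
       (rat_of_nat (deg n (diag (p # replicate (n-2) (p^2) @ [p^3]))) =
          q * ((q^(n-1) - 1) * (q^n - 1) / (q - 1)^2) \<and>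
        rat_of_nat (deg n (diag (1 # replicate (n-3) (p^2) @ [p^3, p^3]))) =
          q^(n+1) * ((q^(n-2) - 1) * (q^(n-1) - 1) * (q^n - 1) / ((q - 1)^2 * (q^2 - 1))) \<and>
        rat_of_nat (deg n (diag (1 # replicate (n-2) (p^2) @ [p^4]))) =
          q^(2*n-1) * ((q^(n-1) - 1) * (q^n - 1) / (q - 1)^2) \<and>
        rat_of_nat (deg n (diag (p # p # replicate (n-3) (p^2) @ [p^4]))) =
          q^(n+1) * ((q^(n-2) - 1) * (q^(n-1) - 1) * (q^n - 1) / ((q - 1)^2 * (q^2 - 1))) \<and>
        rat_of_nat (deg n (diag (p # p # replicate (n-4) (p^2) @ [p^3, p^3]))) =
          q^4 * ((q^(n-3) - 1) * (q^(n-2) - 1) * (q^(n-1) - 1) * (q^n - 1)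
                  / ((q - 1)^2 * (q^2 - 1)^2)))
     \<and>
       (\<exists>c1 c2 :: int.
          rat_of_int c1 = (2 * q^n - q^2 - 2 * q + 1) / (q - 1) \<and>
          rat_of_int c2 = q * ((q^(n-1) - 1) * (q^n - 1) / (q - 1)^2) \<and>
          hecke_term n 1 D \<otimes>\<^bsub>H\<^esub> hecke_term n 1 D =
            hecke_term n c1 (diag (p # replicate (n-2) (p^2) @ [p^3]))
            \<oplus>\<^bsub>H\<^esub> hecke_term n c2 (diag (replicate n (p^2)))
            \<oplus>\<^bsub>H\<^esub> hecke_term n 1 (diag (1 # replicate (n-2) (p^2) @ [p^4]))
            \<oplus>\<^bsub>H\<^esub> hecke_term n (int p + 1) (diag (1 # replicate (n-3) (p^2) @ [p^3, p^3]))
            \<oplus>\<^bsub>H\<^esub> hecke_term n (int p + 1) (diag (p # p # replicate (n-3) (p^2) @ [p^4]))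
            \<oplus>\<^bsub>H\<^esub> hecke_term n ((int p + 1)^2)
                 (diag (p # p # replicate (n-4) (p^2) @ [p^3, p^3])))"
proof -
  interpret gl_hecke n p using assms by unfold_locales
  have disjoint: "R0 n p \<inter> R1 n p = {}"
  proof (rule ccontr)
    assume "R0 n p \<inter> R1 n p \<noteq> {}"
    then obtain C where C: "C \<in> R0 n p" "C \<in> R1 n p" by blast
    then obtain i where "i < n" "C $$ (i, i) = 1" by (auto simp: R1_def)
    then show False using C(1) p1 by (auto simp: R0_def)
  qed
  \<comment> \<open>The coefficient of the scalar double coset is the number of neighbours of a
    lattice, so the degree formula gives its value.\<close>
  have c2: "rat_of_int (int (br p n * (br p n - 1))) =
      of_nat p * ((of_nat p ^ (n - 1) - 1) * (of_nat p ^ n - 1) / (of_nat p - 1)\<^sup>2)"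
    using deg_adj_rat[of 1] deg_adj[of 1] by simp
  have square: "hecke_term n 1 (dd (es1 1)) \<otimes>\<^bsub>hecke_algebra n\<^esub> hecke_term n 1 (dd (es1 1)) =
      hecke_term n (2 * int (br p n) - (int p + 3)) (dd (es1 2))
      \<oplus>\<^bsub>hecke_algebra n\<^esub> hecke_term n (int (br p n * (br p n - 1))) (dd (replicate n 2))
      \<oplus>\<^bsub>hecke_algebra n\<^esub> hecke_term n 1 (dd (es2 False False))
      \<oplus>\<^bsub>hecke_algebra n\<^esub> hecke_term n (int p + 1) (dd (es2 True False))
      \<oplus>\<^bsub>hecke_algebra n\<^esub> hecke_term n (int p + 1) (dd (es2 False True))
      \<oplus>\<^bsub>hecke_algebra n\<^esub> hecke_term n ((int p + 1)\<^sup>2) (dd (es2 True True))"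
    using hecke_square by (simp add: hecke_algebra_def hecke_term_def E1_def E0_def E2_def)
  show ?thesis
    unfolding Let_def dd_lists
    by (intro conjI disjoint reps_DD deg_adj_rat deg_ty2_rat, simp only: zero_less_one,
        simp only: zero_less_numeral,
        rule exI[of _ "2 * int (br p n) - (int p + 3)"], rule exI[of _ "int (br p n * (br p n - 1))"],
        intro conjI c1_rat c2 square)
qed

end
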